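(* Let $G$ be a transitive nonunimodular graph. Suppose that the subgraph of $G$ induced by any finite union of levels of $G$ has only finite connected components; or suppose, more generally, that the subgraph of $G$ induced by any finite union of levels of $G$ is amenable. Then for every $p\in[0,1]$, almost surely, Bernoulli$(p)$ edge percolation on $G$ does not have infinitely many heavy clusters.
   Context: All graphs are locally finite; transitive graphs are infinite and connected. $\mathrm{Aut}(G)$ is the automorphism group of $G$, and $S_x=\{g\in \mathrm{Aut}(G): g(x)=x\}$ is the stabilizer of a vertex $x$. A transitive graph $G$ is unimodular if $|S_xy|=|S_yx|$ for all $x,y\in V(G)$; otherwise it is nonunimodular. Fix a vertex $o$; the weight of $x\in V(G)$ is $w(x)=|S_xo|/|S_ox|$ (independent of $o$ up to a constant factor; it satisfies $|S_xy|/|S_yx|=w(x)/w(y)$). A level of $G$ is a maximal set of vertices any two of which satisfy $|S_xy|=|S_yx|$, i.e. a maximal set of vertices of equal weight. A graph $H$ is amenable if $\inf |\partial K|/|K|=0$, the infimum being over finite nonempty $K\subset V(H)$, where $\partial K$ is the set of edges of $H$ with exactly one endpoint in $K$. In Bernoulli$(p)$ edge percolation each edge is independently kept (open) with probability $p$ and removed (closed) with probability $1-p$; clusters are the connected components of the resulting open subgraph (on all vertices). A cluster $C$ is heavy if $\sum_{x\in C}w(x)=\infty$ and light otherwise. *)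

theory Defs
  imports "HOL-Probability.Probability"
begin

text \<open>A graph is a pair of a vertex set \<open>V\<close> and an edge set \<open>E\<close>, an edge being the
  two-element set of its endpoints.\<close>

locale simple_graph =
  fixes V :: "'v set" and E :: "'v set set"
  assumes edge_subset: "e \<in> E \<Longrightarrow> e \<subseteq> V"
    and edge_card: "e \<in> E \<Longrightarrow> card e = 2"

definition reachable :: "'v set set \<Rightarrow> 'v \<Rightarrow> 'v \<Rightarrow> bool" where
  "reachable E = (\<lambda>x y. {x, y} \<in> E)\<^sup>*\<^sup>*"

definition graph_components :: "'v set \<Rightarrow> 'v set set \<Rightarrow> 'v set set" where
  "graph_components V E = (\<lambda>x. {y \<in> V. reachable E x y}) ` V"

definition Aut :: "'v set \<Rightarrow> 'v set set \<Rightarrow> ('v \<Rightarrow> 'v) set" where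
  "Aut V E = {g \<in> extensional V. bij_betw g V V \<and>
     (\<forall>x\<in>V. \<forall>y\<in>V. {g x, g y} \<in> E \<longleftrightarrow> {x, y} \<in> E)}"

definition stabilizer :: "'v set \<Rightarrow> 'v set set \<Rightarrow> 'v \<Rightarrow> ('v \<Rightarrow> 'v) set" where
  "stabilizer V E x = {g \<in> Aut V E. g x = x}"

definition stab_orbit :: "'v set \<Rightarrow> 'v set set \<Rightarrow> 'v \<Rightarrow> 'v \<Rightarrow> 'v set" where
  "stab_orbit V E x y = (\<lambda>g. g y) ` stabilizer V E x"

text \<open>Connectedness and local finiteness make every \<^term>\<open>stab_orbit V E x y\<close> with
  \<open>x, y \<in> V\<close> finite, so that \<^const>\<open>card\<close> is its true cardinality below.\<close>

locale transitive_graph = simple_graph +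
  assumes locally_finite: "x \<in> V \<Longrightarrow> finite {e \<in> E. x \<in> e}"
    and infinite_vertices: "infinite V"
    and graph_connected: "x \<in> V \<Longrightarrow> y \<in> V \<Longrightarrow> reachable E x y"
    and vertex_transitive: "x \<in> V \<Longrightarrow> y \<in> V \<Longrightarrow> \<exists>g\<in>Aut V E. g x = y"

definition unimodular :: "'v set \<Rightarrow> 'v set set \<Rightarrow> bool" where
  "unimodular V E \<longleftrightarrow>
     (\<forall>x\<in>V. \<forall>y\<in>V. card (stab_orbit V E x y) = card (stab_orbit V E y x))"

definition weight :: "'v set \<Rightarrow> 'v set set \<Rightarrow> 'v \<Rightarrow> 'v \<Rightarrow> real" where
  "weight V E r x = real (card (stab_orbit V E x r)) / real (card (stab_orbit V E r x))"

definition equal_weight_set :: "'v set \<Rightarrow> 'v set set \<Rightarrow> 'v set \<Rightarrow> bool" where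
  "equal_weight_set V E L \<longleftrightarrow> L \<subseteq> V \<and>
     (\<forall>x\<in>L. \<forall>y\<in>L. card (stab_orbit V E x y) = card (stab_orbit V E y x))"

definition level :: "'v set \<Rightarrow> 'v set set \<Rightarrow> 'v set \<Rightarrow> bool" where
  "level V E L \<longleftrightarrow> equal_weight_set V E L \<and>
     (\<forall>M. equal_weight_set V E M \<and> L \<subseteq> M \<longrightarrow> M = L)"

definition induced_edges :: "'v set set \<Rightarrow> 'v set \<Rightarrow> 'v set set" where
  "induced_edges E U = {e \<in> E. e \<subseteq> U}"

definition edge_boundary :: "'v set set \<Rightarrow> 'v set \<Rightarrow> 'v set set" where
  "edge_boundary E K = {e \<in> E. card (e \<inter> K) = 1}"

text \<open>Only meaningful for \<open>V \<noteq> {}\<close>: otherwise the infimum ranges over the empty set,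
  on which \<^const>\<open>Inf\<close> is unspecified for the type \<^typ>\<open>real\<close>.\<close>

definition amenable :: "'v set \<Rightarrow> 'v set set \<Rightarrow> bool" where
  "amenable V E \<longleftrightarrow>
     (INF K\<in>{K. finite K \<and> K \<noteq> {} \<and> K \<subseteq> V}.
        real (card (edge_boundary E K)) / real (card K)) = 0"

definition bernoulli_percolation :: "'v set set \<Rightarrow> real \<Rightarrow> ('v set \<Rightarrow> bool) measure" where
  "bernoulli_percolation E p = (\<Pi>\<^sub>M e\<in>E. measure_pmf (bernoulli_pmf p))"

definition clusters :: "'v set \<Rightarrow> 'v set set \<Rightarrow> ('v set \<Rightarrow> bool) \<Rightarrow> 'v set set" where
  "clusters V E \<omega> = graph_components V {e \<in> E. \<omega> e}"

definition heavy :: "'v set \<Rightarrow> 'v set set \<Rightarrow> 'v \<Rightarrow> 'v set \<Rightarrow> bool" where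
  "heavy V E r C \<longleftrightarrow> infsum (\<lambda>x. ennreal (weight V E r x)) C = \<infinity>"

end

(* A heavy cluster almost surely contains vertices of arbitrarily large weight: by insertion and
   deletion one could otherwise attach a path ending above all its weights, and a heavy cluster with a
   unique vertex of maximal weight contradicts the tilted mass transport principle. Call x a
   trifurcation if removing it leaves at least three branches of unbounded weight at x. Three heavy
   clusters can be modified locally into a trifurcation, so it suffices to exclude those. By mass
   transport, each unbounded branch at a trifurcation x contains a trifurcation of weight at least
   3/4 w(x); otherwise every vertex of the branch would send mass to x, with at most one receiver in
   each weight scale, and Borel-Cantelli bounds the branch. Finally, amenability of the finite unions
   of levels gives finite sets K whose boundary has negligible total weight (the weights form a
   finitely generated abelian group, hence one of polynomial growth), and the weighted form of the
   Burton-Keane count of trifurcations in K leaves no room for a positive density. *)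

theory Submission
  imports Defs "HOL-Real_Asymp.Real_Asymp"
begin

section \<open>Automorphisms, orbits and the modular cocycle\<close>

text \<open>The tilt shapes the argument. A vertex that receives unit masses has to account for the
  total weight of the senders relative to its own, so density and boundary must be measured by
  weight, whereas the hypothesis controls boundary edges by number, and within finite unions of
  levels only. The bridge is \<open>deg_balance\<close>: it forces an almost invariant set to carry
  nearly the same total weight on all the levels involved, so that the levels where edges leave the
  union matter little. The count compares trifurcations with trifurcations. Those with companions in
  three branches within a large fixed radius are at least 9/10 of all, the interior of the finite
  set has at least 9/10 of its weight, and the count, applied at every weight threshold, yields a
  factor 2. The constant 3/4 lies above 1/2, with \<open>2 * 3/4 * (9/10)^2 > 1\<close>, and below
  1, so that scales of ratio 4/3 grow and the probability of receiving at scale \<open>k\<close>, at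
  most \<open>(3/4)^k\<close>, is summable. Finite energy needs \<open>0 < p < 1\<close>; the two
  extreme values are treated directly.\<close>

context transitive_graph
begin

abbreviation adj :: "'a \<Rightarrow> 'a \<Rightarrow> bool" where
  "adj x y \<equiv> {x, y} \<in> E"

lemma adj_V: "adj x y \<Longrightarrow> x \<in> V" "adj x y \<Longrightarrow> y \<in> V"
  using edge_subset by auto

lemma adj_sym: "adj x y \<Longrightarrow> adj y x"
  by (simp add: insert_commute)

lemma edgeE:
  assumes "e \<in> E" obtains x y where "e = {x, y}" "x \<noteq> y" "x \<in> V" "y \<in> V"
  using edge_card[OF assms] edge_subset[OF assms] by (auto simp: card_2_iff)

lemma finite_neighbours: "finite {y. adj x y}"
proof (cases "x \<in> V")
  case True
  have "(\<lambda>y. {x, y}) ` {y. adj x y} \<subseteq> {e \<in> E. x \<in> e}" by auto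
  then have "finite ((\<lambda>y. {x, y}) ` {y. adj x y})"
    using locally_finite[OF True] finite_subset by blast
  moreover have "inj_on (\<lambda>y. {x, y}) {y. adj x y}"
    by (auto simp: inj_on_def doubleton_eq_iff)
  ultimately show ?thesis by (rule finite_imageD)
next
  case False
  then have "{y. adj x y} = {}" using adj_V(1) by blast
  then show ?thesis by simp
qed

primrec ball :: "nat \<Rightarrow> 'a \<Rightarrow> 'a set" where
  "ball 0 x = {x}"
| "ball (Suc n) x = ball n x \<union> {z. \<exists>y\<in>ball n x. adj y z}"

lemma finite_ball: "finite (ball n x)"
proof (induction n)
  case (Suc n)
  have "{z. \<exists>y\<in>ball n x. adj y z} = (\<Union>y\<in>ball n x. {z. adj y z})" by auto
  then show ?case using Suc finite_neighbours by auto
qed simp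

lemma ball_subset: "x \<in> V \<Longrightarrow> ball n x \<subseteq> V"
  by (induction n) (auto dest: adj_V)

lemma ball_self: "x \<in> ball n x"
  by (induction n) auto

lemma ball_mono: "m \<le> n \<Longrightarrow> ball m x \<subseteq> ball n x"
  by (induction rule: dec_induct) auto

lemma ball_trans: "y \<in> ball m x \<Longrightarrow> z \<in> ball n y \<Longrightarrow> z \<in> ball (m + n) x"
  by (induction n arbitrary: z) auto

lemma ball_sym: "y \<in> ball n x \<Longrightarrow> x \<in> ball n y"
proof (induction n arbitrary: y)
  case (Suc n)
  show ?case
  proof (cases "y \<in> ball n x")
    case True then show ?thesis using Suc.IH by auto
  next
    case False
    then obtain z where z: "z \<in> ball n x" "adj z y" using Suc.prems by auto
    then have "z \<in> ball 1 y" using adj_sym by auto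
    from ball_trans[OF this Suc.IH[OF z(1)]] show ?thesis by simp
  qed
qed auto

lemma reachable_ball:
  assumes "reachable E x y" shows "\<exists>n. y \<in> ball n x"
  using assms unfolding reachable_def
proof (induction rule: rtranclp_induct)
  case base
  then show ?case using ball_self by blast
next
  case (step y z)
  then obtain n where "y \<in> ball n x" by blast
  then have "z \<in> ball (Suc n) x" using step by auto
  then show ?case by blast
qed

lemma ex_ball: "x \<in> V \<Longrightarrow> y \<in> V \<Longrightarrow> \<exists>n. y \<in> ball n x"
  using reachable_ball graph_connected by blast

lemma V_nonempty: "V \<noteq> {}"
  using infinite_vertices by auto

lemma countable_V: "countable V"
proof -
  obtain x where x: "x \<in> V" using V_nonempty by blast
  have "V \<subseteq> (\<Union>n. ball n x)" using ex_ball[OF x] by auto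
  moreover have "countable (\<Union>n. ball n x)"
    using finite_ball by (auto intro: countable_finite)
  ultimately show ?thesis using countable_subset by blast
qed

lemma countable_E: "countable E"
proof -
  have "E \<subseteq> (\<lambda>(x, y). {x, y}) ` (V \<times> V)"
    by (auto elim!: edgeE)
  then show ?thesis using countable_V by (meson countable_SIGMA countable_image countable_subset)
qed

text \<open>Unlike in \<open>Aut\<close>, extensionality is not asked for, so compositions and
  \<open>inv_into V g\<close> are automorphisms as they stand; \<open>auto_Aut\<close> converts
  back.\<close>

definition graph_auto :: "('a \<Rightarrow> 'a) \<Rightarrow> bool" where
  "graph_auto g \<longleftrightarrow> bij_betw g V V \<and> (\<forall>x\<in>V. \<forall>y\<in>V. adj (g x) (g y) \<longleftrightarrow> adj x y)"

lemma auto_in [intro, simp]: "graph_auto g \<Longrightarrow> x \<in> V \<Longrightarrow> g x \<in> V"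
  by (auto simp: graph_auto_def bij_betw_def)

lemma auto_inj: "graph_auto g \<Longrightarrow> inj_on g V"
  by (auto simp: graph_auto_def bij_betw_def)

lemma auto_eq_iff: "graph_auto g \<Longrightarrow> x \<in> V \<Longrightarrow> y \<in> V \<Longrightarrow> g x = g y \<longleftrightarrow> x = y"
  by (rule inj_on_eq_iff[OF auto_inj])

lemma auto_surj: "graph_auto g \<Longrightarrow> y \<in> V \<Longrightarrow> \<exists>x\<in>V. g x = y"
  by (metis graph_auto_def bij_betw_def imageE)

lemma auto_adj: "graph_auto g \<Longrightarrow> x \<in> V \<Longrightarrow> y \<in> V \<Longrightarrow> adj (g x) (g y) \<longleftrightarrow> adj x y"
  by (auto simp: graph_auto_def)

lemma auto_comp: "graph_auto g \<Longrightarrow> graph_auto h \<Longrightarrow> graph_auto (g \<circ> h)"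
  unfolding graph_auto_def by (auto intro: bij_betw_trans dest: bij_betwE)

lemma auto_inv:
  assumes "graph_auto g" shows "graph_auto (inv_into V g)"
proof -
  have b: "bij_betw g V V" using assms by (simp add: graph_auto_def)
  have bi: "bij_betw (inv_into V g) V V" by (rule bij_betw_inv_into[OF b])
  have "adj (inv_into V g x) (inv_into V g y) \<longleftrightarrow> adj x y" if "x \<in> V" "y \<in> V" for x y
    using auto_adj[OF assms, of "inv_into V g x" "inv_into V g y"] that bi b
    by (simp add: bij_betw_inv_into_right bij_betwE)
  then show ?thesis using bi by (simp add: graph_auto_def)
qed

lemma auto_inv_eq: "graph_auto g \<Longrightarrow> x \<in> V \<Longrightarrow> g x = y \<Longrightarrow> inv_into V g y = x"
  using auto_inj by (auto simp: inv_into_f_f)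

lemma auto_inv_right: "graph_auto g \<Longrightarrow> y \<in> V \<Longrightarrow> g (inv_into V g y) = y"
  by (auto simp: graph_auto_def bij_betw_def intro: f_inv_into_f)

lemma Aut_auto: "g \<in> Aut V E \<Longrightarrow> graph_auto g"
  by (auto simp: Aut_def graph_auto_def)

lemma auto_Aut: "graph_auto g \<Longrightarrow> restrict g V \<in> Aut V E"
  unfolding Aut_def graph_auto_def by (auto cong: bij_betw_cong)

lemma ex_auto: "x \<in> V \<Longrightarrow> y \<in> V \<Longrightarrow> \<exists>g. graph_auto g \<and> g x = y"
  using vertex_transitive Aut_auto by blast

abbreviation S :: "'a \<Rightarrow> 'a \<Rightarrow> 'a set" where
  "S x y \<equiv> stab_orbit V E x y"

lemma S_eq:
  assumes "x \<in> V" "y \<in> V"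
  shows "S x y = {g y | g. graph_auto g \<and> g x = x}"
proof -
  have "\<exists>h\<in>stabilizer V E x. h y = g y" if "graph_auto g" "g x = x" for g
    using auto_Aut[OF that(1)] that assms
    by (intro bexI[of _ "restrict g V"]) (auto simp: stabilizer_def)
  then show ?thesis
    using Aut_auto by (fastforce simp: stab_orbit_def stabilizer_def image_iff)
qed

lemma auto_ball: "graph_auto g \<Longrightarrow> x \<in> V \<Longrightarrow> y \<in> ball n x \<Longrightarrow> g y \<in> ball n (g x)"
proof (induction n arbitrary: y)
  case (Suc n)
  show ?case
  proof (cases "y \<in> ball n x")
    case True
    then show ?thesis using Suc by auto
  next
    case False
    then obtain z where z: "z \<in> ball n x" "adj z y" using Suc.prems by auto
    then have "adj (g z) (g y)" using Suc.prems auto_adj adj_V by metis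
    then show ?thesis using Suc.IH[OF Suc.prems(1,2) z(1)] by auto
  qed
qed auto

lemma auto_ball_iff:
  assumes "graph_auto g" "x \<in> V" "y \<in> V"
  shows "g y \<in> ball n (g x) \<longleftrightarrow> y \<in> ball n x"
  using auto_ball[OF assms(1,2)] auto_ball[OF auto_inv[OF assms(1)], of "g x" "g y" n] assms
  by (auto simp: auto_inv_eq)

lemma auto_ball_image:
  assumes "graph_auto g" "x \<in> V" shows "ball n (g x) = g ` ball n x"
proof -
  have "z \<in> g ` ball n x" if "z \<in> ball n (g x)" for z
  proof -
    have "z \<in> V" using that ball_subset assms by blast
    then obtain y where "y \<in> V" "g y = z" using auto_surj[OF assms(1)] by blast
    then show ?thesis using that auto_ball_iff[OF assms] by blast
  qed
  then show ?thesis using auto_ball[OF assms] by blast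
qed

text \<open>Automorphisms fixing \<open>x\<close> preserve each finite ball around \<open>x\<close>,
  and some ball contains \<open>y\<close>.\<close>

lemma finite_S: assumes "x \<in> V" "y \<in> V" shows "finite (S x y)"
proof -
  obtain n where n: "y \<in> ball n x" using ex_ball assms by blast
  have "S x y \<subseteq> ball n x"
    using S_eq[OF assms] auto_ball[OF _ assms(1) n] by force
  then show ?thesis using finite_ball finite_subset by blast
qed

lemma id_auto: "graph_auto id"
  by (simp add: graph_auto_def)

lemma S_self: "x \<in> V \<Longrightarrow> y \<in> V \<Longrightarrow> y \<in> S x y"
  using S_eq id_auto by force

lemma S_V: "x \<in> V \<Longrightarrow> y \<in> V \<Longrightarrow> z \<in> S x y \<Longrightarrow> z \<in> V"
  using S_eq by auto

lemma card_S_pos: "x \<in> V \<Longrightarrow> y \<in> V \<Longrightarrow> card (S x y) > 0"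
  using finite_S S_self by (metis card_gt_0_iff empty_iff)

lemma S_sym:
  assumes "x \<in> V" "y \<in> V" "z \<in> S x y" shows "y \<in> S x z"
proof -
  obtain g where g: "graph_auto g" "g x = x" "g y = z" using assms S_eq by auto
  then have "inv_into V g x = x" "inv_into V g z = y" using assms auto_inv_eq by auto
  then show ?thesis using S_eq[OF assms(1)] S_V[OF assms] auto_inv[OF g(1)] by auto
qed

lemma S_trans:
  assumes "x \<in> V" "y \<in> V" "z \<in> S x y" "u \<in> S x z" shows "u \<in> S x y"
proof -
  obtain g where g: "graph_auto g" "g x = x" "g y = z" using assms S_eq by auto
  obtain h where h: "graph_auto h" "h x = x" "h z = u"
    using assms S_eq[of x z] S_V[OF assms(1-3)] by auto
  show ?thesis unfolding S_eq[OF assms(1,2)]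
    using auto_comp[OF h(1) g(1)] g h by (auto intro!: exI[of _ "h \<circ> g"])
qed

lemma S_cong:
  assumes "x \<in> V" "y \<in> V" "z \<in> S x y" shows "S x z = S x y"
proof
  show "S x z \<subseteq> S x y" using S_trans[OF assms] by blast
  show "S x y \<subseteq> S x z"
    using S_trans[OF assms(1) S_V[OF assms] S_sym[OF assms]] by blast
qed

lemma S_image:
  assumes "graph_auto g" "x \<in> V" "y \<in> V" shows "S (g x) (g y) = g ` S x y"
proof -
  have 1: "g ` S x y \<subseteq> S (g x) (g y)" if "graph_auto g" "x \<in> V" "y \<in> V" for g x y
  proof
    fix z assume "z \<in> g ` S x y"
    then obtain u where u: "u \<in> S x y" "z = g u" by blast
    then obtain h where h: "graph_auto h" "h x = x" "z = g (h y)"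
      using S_eq[OF \<open>x \<in> V\<close> \<open>y \<in> V\<close>] by auto
    have "graph_auto (g \<circ> h \<circ> inv_into V g)" using that h auto_comp auto_inv by blast
    moreover have "(g \<circ> h \<circ> inv_into V g) (g x) = g x" "(g \<circ> h \<circ> inv_into V g) (g y) = z"
      using that h by (auto simp: auto_inv_eq)
    ultimately show "z \<in> S (g x) (g y)" using S_eq[of "g x" "g y"] that by blast
  qed
  have "z \<in> g ` S x y" if z: "z \<in> S (g x) (g y)" for z
  proof -
    have "inv_into V g z \<in> S x y"
      using 1[OF auto_inv[OF assms(1)], of "g x" "g y"] z assms by (auto simp: auto_inv_eq)
    moreover have "z \<in> V" using z S_V assms by blast
    then have "g (inv_into V g z) = z"
      by (rule auto_inv_right[OF assms(1)])
    ultimately show ?thesis by force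
  qed
  then show ?thesis using 1[OF assms] by blast
qed

lemma card_S_image:
  assumes "graph_auto g" "x \<in> V" "y \<in> V" shows "card (S (g x) (g y)) = card (S x y)"
proof -
  have "inj_on g (S x y)" using auto_inj[OF assms(1)] S_V assms by (meson inj_on_subset subsetI)
  then show ?thesis using S_image[OF assms] by (simp add: card_image)
qed

section \<open>The modular cocycle\<close>

definition weight_ratio :: "'a \<Rightarrow> 'a \<Rightarrow> real" where
  "weight_ratio x y = real (card (S x y)) / real (card (S y x))"

lemma weight_ratio_weight: "weight V E r x = weight_ratio x r"
  by (simp add: weight_ratio_def weight_def)

lemma weight_ratio_pos: "x \<in> V \<Longrightarrow> y \<in> V \<Longrightarrow> weight_ratio x y > 0"
  using card_S_pos by (simp add: weight_ratio_def)

lemma weight_ratio_auto: "graph_auto g \<Longrightarrow> x \<in> V \<Longrightarrow> y \<in> V \<Longrightarrow> weight_ratio (g x) (g y) = weight_ratio x y"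
  by (simp add: weight_ratio_def card_S_image)

definition pair_stabilizer_orbit :: "'a \<Rightarrow> 'a \<Rightarrow> 'a \<Rightarrow> 'a set" where
  "pair_stabilizer_orbit x y z = {g z | g. graph_auto g \<and> g x = x \<and> g y = y}"

lemma pair_stabilizer_orbit_commute: "pair_stabilizer_orbit x y z = pair_stabilizer_orbit y x z"
  by (auto simp: pair_stabilizer_orbit_def)

lemma card_pair_stabilizer_orbit_pos:
  assumes "x \<in> V" "y \<in> V" "z \<in> V" shows "card (pair_stabilizer_orbit x y z) > 0"
proof -
  have "pair_stabilizer_orbit x y z \<subseteq> S x z" using assms by (auto simp: pair_stabilizer_orbit_def S_eq)
  then have "finite (pair_stabilizer_orbit x y z)" using finite_S assms finite_subset by blast
  moreover have "z \<in> pair_stabilizer_orbit x y z" using id_auto unfolding pair_stabilizer_orbit_def by (auto intro!: exI[of _ id])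
  ultimately show ?thesis by (auto simp: card_gt_0_iff)
qed

definition pair_orbit :: "'a \<Rightarrow> 'a \<Rightarrow> 'a \<Rightarrow> ('a \<times> 'a) set" where
  "pair_orbit x y z = {(g y, g z) | g. graph_auto g \<and> g x = x}"

lemma card_pair_orbit_swap: "card (pair_orbit x y z) = card (pair_orbit x z y)"
proof -
  have "pair_orbit x z y = prod.swap ` pair_orbit x y z" by (auto simp: pair_orbit_def image_iff)
  then show ?thesis by (simp add: card_image)
qed

text \<open>Orbit-stabilizer: project a pair to its first entry. The image is \<open>S x y\<close>,
  and a chosen automorphism \<open>c u\<close> that fixes \<open>x\<close> and moves
  \<open>y\<close> to \<open>u\<close> identifies the fibre over \<open>u\<close> with the orbit of
  \<open>z\<close> under the automorphisms fixing both \<open>x\<close> and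
  \<open>y\<close>.\<close>

lemma card_pair_orbit:
  assumes "x \<in> V" "y \<in> V" "z \<in> V"
  shows "card (pair_orbit x y z) = card (S x y) * card (pair_stabilizer_orbit x y z)"
proof -
  have "\<forall>u\<in>S x y. \<exists>g. graph_auto g \<and> g x = x \<and> g y = u" using S_eq assms by auto
  then obtain c where c: "\<And>u. u \<in> S x y \<Longrightarrow> graph_auto (c u) \<and> c u x = x \<and> c u y = u" by metis
  have S2V: "v \<in> V" if "v \<in> pair_stabilizer_orbit x y z" for v using that assms by (auto simp: pair_stabilizer_orbit_def)
  have "bij_betw (\<lambda>(u, v). (u, c u v)) (S x y \<times> pair_stabilizer_orbit x y z) (pair_orbit x y z)"
    unfolding bij_betw_def
  proof
    show "inj_on (\<lambda>(u, v). (u, c u v)) (S x y \<times> pair_stabilizer_orbit x y z)"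
      using c S2V auto_eq_iff by (fastforce simp: inj_on_def)
    have "(u, c u v) \<in> pair_orbit x y z" if uv: "u \<in> S x y" "v \<in> pair_stabilizer_orbit x y z" for u v
    proof -
      obtain g where g: "graph_auto g" "g x = x" "g y = y" "v = g z" using uv by (auto simp: pair_stabilizer_orbit_def)
      then have "graph_auto (c u \<circ> g)" "(c u \<circ> g) x = x" "(u, c u v) = ((c u \<circ> g) y, (c u \<circ> g) z)"
        using c[OF uv(1)] auto_comp[of "c u" g] by auto
      then show ?thesis unfolding pair_orbit_def by blast
    qed
    moreover have "p \<in> (\<lambda>(u, v). (u, c u v)) ` (S x y \<times> pair_stabilizer_orbit x y z)" if p: "p \<in> pair_orbit x y z" for p
    proof -
      obtain g where g: "graph_auto g" "g x = x" "p = (g y, g z)" using p unfolding pair_orbit_def by blast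
      have gy: "g y \<in> S x y" using g S_eq assms by auto
      let ?h = "inv_into V (c (g y)) \<circ> g"
      have "graph_auto ?h" using auto_comp auto_inv c[OF gy] g by blast
      moreover have "?h x = x" "?h y = y"
        using c[OF gy] g assms by (auto simp: auto_inv_eq)
      ultimately have "?h z \<in> pair_stabilizer_orbit x y z" unfolding pair_stabilizer_orbit_def by blast
      moreover have "c (g y) (?h z) = g z"
        using c[OF gy] g(1) assms(3) by (simp add: auto_inv_right)
      ultimately show ?thesis using g gy by (intro image_eqI[of _ _ "(g y, ?h z)"]) auto
    qed
    ultimately show "(\<lambda>(u, v). (u, c u v)) ` (S x y \<times> pair_stabilizer_orbit x y z) = pair_orbit x y z" by auto
  qed
  from bij_betw_same_card[OF this] show ?thesis by (simp add: card_cartesian_product)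
qed

text \<open>The factor \<open>card (pair_stabilizer_orbit x y z)\<close> is symmetric in
  \<open>x\<close> and \<open>y\<close> and cancels, so \<open>weight_ratio x y\<close> is the
  quotient of \<open>card (pair_orbit x y z)\<close> by \<open>card (pair_orbit y x z)\<close>. The
  cardinality of \<open>pair_orbit\<close> is symmetric in the last two arguments, which makes the
  product telescope.\<close>

lemma weight_ratio_cocycle:
  assumes "x \<in> V" "y \<in> V" "z \<in> V" shows "weight_ratio x z = weight_ratio x y * weight_ratio y z"
proof -
  have e: "weight_ratio x y = card (pair_orbit x y z) / card (pair_orbit y x z)" if "x \<in> V" "y \<in> V" "z \<in> V" for x y z
    using that card_pair_orbit[of x y z] card_pair_orbit[of y x z] card_pair_stabilizer_orbit_pos[of x y z]
    by (simp add: weight_ratio_def pair_stabilizer_orbit_commute[of y x])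
  have pos: "card (pair_orbit x y z) > 0" if "x \<in> V" "y \<in> V" "z \<in> V" for x y z
    using that card_pair_orbit card_S_pos card_pair_stabilizer_orbit_pos by simp
  show ?thesis
    using e[of x y z] e[of x z y] e[of y z x] assms pos[of y x z]
    by (simp add: card_pair_orbit_swap[of x z y] card_pair_orbit_swap[of y z x] card_pair_orbit_swap[of z y x])
qed

lemma weight_ratio_self: "x \<in> V \<Longrightarrow> weight_ratio x x = 1"
  using card_S_pos[of x x] by (simp add: weight_ratio_def)

section \<open>The tilted mass transport identity\<close>

text \<open>By invariance \<open>F y a = F a z\<close> whenever some automorphism maps
  \<open>y\<close> to \<open>a\<close> and \<open>a\<close> to \<open>z\<close>. This relation
  offers \<open>card (S y a)\<close> choices of \<open>z\<close> to each \<open>y\<close>, but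
  \<open>card (S a y)\<close> choices of \<open>y\<close> to a related \<open>z\<close>. The tilt is
  the quotient of the two, and the identity is a double count.\<close>

lemma transport:
  fixes F :: "'a \<Rightarrow> 'a \<Rightarrow> ennreal"
  assumes inv: "\<And>g x y. graph_auto g \<Longrightarrow> x \<in> V \<Longrightarrow> y \<in> V \<Longrightarrow> F (g x) (g y) = F x y"
    and a: "a \<in> V"
  shows "(\<integral>\<^sup>+y. F y a * ennreal (weight_ratio y a) \<partial>count_space V) = (\<integral>\<^sup>+z. F a z \<partial>count_space V)"
proof -
  define M where "M = (\<lambda>y z. \<exists>g. graph_auto g \<and> g y = a \<and> g a = z)"
  have A: "finite {z \<in> V. M y z} \<and> card {z \<in> V. M y z} = card (S y a)" if y: "y \<in> V" for y
  proof -
    obtain h where h: "graph_auto h" "h y = a" using ex_auto[OF y a] by blast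
    have "{z \<in> V. M y z} = S a (h a)"
    proof safe
      fix z assume "M y z"
      then obtain g where g: "graph_auto g" "g y = a" "g a = z" unfolding M_def by blast
      have "graph_auto (g \<circ> inv_into V h)" using auto_comp auto_inv g h by blast
      moreover have "(g \<circ> inv_into V h) a = a" "(g \<circ> inv_into V h) (h a) = z"
        using g h y a by (auto simp: auto_inv_eq)
      ultimately show "z \<in> S a (h a)" unfolding S_eq[OF a auto_in[OF h(1) a]] by blast
    next
      fix z assume z: "z \<in> S a (h a)"
      then show "z \<in> V" using S_V a h by blast
      obtain k where k: "graph_auto k" "k a = a" "z = k (h a)"
        using z unfolding S_eq[OF a auto_in[OF h(1) a]] by blast
      have "graph_auto (k \<circ> h)" "(k \<circ> h) y = a" "(k \<circ> h) a = z" using k h auto_comp by auto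
      then show "M y z" unfolding M_def by blast
    qed
    then show ?thesis using card_S_image[OF h(1) y a] h finite_S a by simp
  qed
  have B: "{y \<in> V. M y z} = S a y" if yz: "y \<in> V" "M y z" for y z
  proof -
    obtain g where g: "graph_auto g" "g y = a" "g a = z" using yz unfolding M_def by blast
    show ?thesis
    proof safe
      fix u assume u: "u \<in> V" "M u z"
      then obtain h where h: "graph_auto h" "h u = a" "h a = z" unfolding M_def by blast
      have "graph_auto (inv_into V h \<circ> g)" using auto_comp auto_inv g h by blast
      moreover have "(inv_into V h \<circ> g) a = a" "(inv_into V h \<circ> g) y = u"
        using g h u a by (auto simp: auto_inv_eq)
      ultimately show "u \<in> S a y" unfolding S_eq[OF a yz(1)] by blast
    next
      fix u assume u: "u \<in> S a y"
      then show "u \<in> V" using S_V a yz by blast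
      obtain k where k: "graph_auto k" "k a = a" "u = k y"
        using u unfolding S_eq[OF a yz(1)] by blast
      have "graph_auto (g \<circ> inv_into V k)" using auto_comp auto_inv g k by blast
      moreover have "(g \<circ> inv_into V k) u = a" "(g \<circ> inv_into V k) a = z"
        using g k yz a by (auto simp: auto_inv_eq)
      ultimately show "M u z" unfolding M_def by blast
    qed
  qed
  \<comment> \<open>Each \<open>z\<close> spreads \<open>F a z\<close> evenly over the
    \<open>card (S a y)\<close> vertices related to it; summing over \<open>z\<close> instead gives
    \<open>F y a\<close> with the factor \<open>card (S y a) / card (S a y)\<close>.\<close>
  define f where "f = (\<lambda>y z. F a z * ennreal (1 / card (S a y)) * indicator {p. M (fst p) (snd p)} (y, z))"
  have "F y a * ennreal (weight_ratio y a) = (\<integral>\<^sup>+z. f y z \<partial>count_space V)" if y: "y \<in> V" for y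
  proof -
    have "f y z = F y a * ennreal (1 / card (S a y))" if z: "z \<in> V" "M y z" for z
    proof -
      obtain g where "graph_auto g" "g y = a" "g a = z" using z unfolding M_def by blast
      then have "F a z = F y a" using inv[of g y a] y a by simp
      then show ?thesis using z by (simp add: f_def)
    qed
    moreover have "f y z = 0" if "z \<in> V" "\<not> M y z" for z
      using that by (simp add: f_def)
    ultimately have "(\<integral>\<^sup>+z. f y z \<partial>count_space V)
        = (\<Sum>z\<in>{z \<in> V. M y z}. F y a * ennreal (1 / card (S a y)))"
      using A[OF y] by (subst nn_integral_count_space'[of "{z \<in> V. M y z}"]) auto
    also have "\<dots> = F y a * (ennreal (real (card (S y a))) * ennreal (1 / card (S a y)))"
      using A[OF y] by (simp add: mult_ac ennreal_of_nat_eq_real_of_nat)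
    also have "\<dots> = F y a * ennreal (weight_ratio y a)"
      by (subst ennreal_mult[symmetric]) (auto simp: weight_ratio_def)
    finally show ?thesis by simp
  qed
  then have "(\<integral>\<^sup>+y. F y a * ennreal (weight_ratio y a) \<partial>count_space V)
      = (\<integral>\<^sup>+y. \<integral>\<^sup>+z. f y z \<partial>count_space V \<partial>count_space V)"
    by (intro nn_integral_cong) auto
  also have "\<dots> = (\<integral>\<^sup>+z. \<integral>\<^sup>+y. f y z \<partial>count_space V \<partial>count_space V)"
    by (rule nn_integral_count_space_nn_integral[OF countable_V]) auto
  also have "\<dots> = (\<integral>\<^sup>+z. F a z \<partial>count_space V)"
  proof (intro nn_integral_cong)
    fix z assume "z \<in> space (count_space V)"
    then have z: "z \<in> V" by simp
    obtain g where g: "graph_auto g" "g a = z" using ex_auto a z by blast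
    define y where "y = inv_into V g a"
    have y: "y \<in> V" "g y = a"
      using auto_in[OF auto_inv[OF g(1)] a] auto_inv_right[OF g(1) a] by (auto simp: y_def)
    then have M: "M y z" using g unfolding M_def by blast
    note By = B[OF y(1) M]
    have "f u z = F a z * ennreal (1 / card (S a y))" if "u \<in> S a y" for u
    proof -
      have "S a u = S a y" using S_cong[OF a y(1) that] .
      moreover have "M u z" using that By by blast
      ultimately show ?thesis by (simp add: f_def)
    qed
    moreover have "f u z = 0" if "u \<in> V" "u \<notin> S a y" for u
    proof -
      have "\<not> M u z" using that By by blast
      then show ?thesis by (simp add: f_def)
    qed
    ultimately have "(\<integral>\<^sup>+y. f y z \<partial>count_space V) = (\<Sum>u\<in>S a y. F a z * ennreal (1 / card (S a y)))"
      using finite_S[OF a y(1)] S_V[OF a y(1)]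
      by (subst nn_integral_count_space'[of "S a y"]) auto
    also have "\<dots> = F a z * (ennreal (real (card (S a y))) * ennreal (1 / card (S a y)))"
      by (simp add: mult_ac ennreal_of_nat_eq_real_of_nat)
    also have "\<dots> = F a z"
      using card_S_pos[OF a y(1)] by (subst ennreal_mult[symmetric]) auto
    finally show "(\<integral>\<^sup>+y. f y z \<partial>count_space V) = F a z" .
  qed
  finally show ?thesis .
qed

end

locale rooted_graph = transitive_graph +
  fixes r :: 'a
  assumes root_in: "r \<in> V"
begin

section \<open>Weights relative to a root\<close>

abbreviation w :: "'a \<Rightarrow> real" where "w x \<equiv> weight V E r x"

lemma w_pos: "x \<in> V \<Longrightarrow> w x > 0"
  using weight_ratio_pos root_in by (simp add: weight_ratio_weight)

lemma w_root: "w r = 1"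
  using weight_ratio_self root_in by (simp add: weight_ratio_weight)

lemma weight_ratio_eq: "x \<in> V \<Longrightarrow> y \<in> V \<Longrightarrow> weight_ratio x y = w x / w y"
  using weight_ratio_cocycle[of x y r] w_pos[of y] root_in by (simp add: weight_ratio_weight)

lemma w_auto:
  assumes "graph_auto g" "x \<in> V" "y \<in> V" shows "w (g x) / w (g y) = w x / w y"
  using weight_ratio_auto[OF assms] assms by (simp add: weight_ratio_eq)

lemma w_scale:
  assumes "graph_auto g" "x \<in> V" "y \<in> V" shows "w (g y) = w (g x) / w x * w y"
  using w_auto[OF assms] w_pos[OF assms(2)] w_pos[OF assms(3)] w_pos[of "g x"] w_pos[of "g y"] assms
  by (simp add: field_simps)

text \<open>The parameter is the ratio of weights, which automorphisms preserve, and not the weight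
  itself, which they rescale. Hence the cardinality \<open>deg s\<close> is the same at every
  vertex.\<close>

definition nbrs :: "'a \<Rightarrow> real \<Rightarrow> 'a set" where
  "nbrs x s = {y. adj x y \<and> w y = s * w x}"

lemma finite_nbrs: "finite (nbrs x s)"
  using finite_subset[OF _ finite_neighbours[of x]] by (auto simp: nbrs_def)

lemma nbrs_image:
  assumes "graph_auto g" "x \<in> V" shows "nbrs (g x) s = g ` nbrs x s"
proof (intro equalityI subsetI)
  fix z assume z: "z \<in> nbrs (g x) s"
  then have "z \<in> V" using adj_V by (auto simp: nbrs_def)
  then obtain y where y: "y \<in> V" "g y = z" using auto_surj[OF assms(1)] by blast
  have "adj x y" using z y auto_adj[OF assms y(1)] by (simp add: nbrs_def)
  moreover have "w y = s * w x"
    using w_auto[OF assms(1) y(1) assms(2)] z y w_pos[OF assms(2)] w_pos[of "g x"] assms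
    by (simp add: nbrs_def field_simps)
  ultimately show "z \<in> g ` nbrs x s" using y by (auto simp: nbrs_def)
next
  fix z assume "z \<in> g ` nbrs x s"
  then obtain y where y: "adj x y" "w y = s * w x" "z = g y" by (auto simp: nbrs_def)
  then have yV: "y \<in> V" using adj_V by blast
  show "z \<in> nbrs (g x) s"
    using y auto_adj[OF assms yV] w_scale[OF assms yV] w_pos[OF assms(2)] by (simp add: nbrs_def)
qed

definition deg :: "real \<Rightarrow> nat" where
  "deg s = card (nbrs r s)"

lemma card_nbrs:
  assumes "x \<in> V" shows "card (nbrs x s) = deg s"
proof -
  obtain g where g: "graph_auto g" "g r = x" using ex_auto root_in assms by blast
  have "nbrs r s \<subseteq> V" using adj_V by (auto simp: nbrs_def)
  then have "inj_on g (nbrs r s)" using auto_inj[OF g(1)] inj_on_subset by blast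
  then show ?thesis using nbrs_image[OF g(1) root_in] g by (simp add: deg_def card_image)
qed

text \<open>Let every vertex send unit mass to each of its neighbours of ratio \<open>s\<close>. The
  root sends \<open>deg s\<close> and receives from \<open>deg (1/s)\<close> neighbours of weight
  \<open>1/s\<close>, so transport gives \<open>deg s = deg (1/s) / s\<close>.\<close>

lemma deg_balance:
  assumes s: "s > 0" shows "real (deg (1 / s)) = s * real (deg s)"
proof -
  define F where "F = (\<lambda>x y. of_bool (y \<in> nbrs x s) :: ennreal)"
  have inv: "F (g x) (g y) = F x y" if g: "graph_auto g" "x \<in> V" "y \<in> V" for g x y
    using nbrs_image[OF g(1,2)] auto_eq_iff[OF g(1) g(3)] adj_V(2)
    by (fastforce simp: F_def image_iff nbrs_def)
  have "(\<integral>\<^sup>+z. F r z \<partial>count_space V) = (\<Sum>z\<in>nbrs r s. F r z)"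
    by (rule nn_integral_count_space') (auto simp: finite_nbrs F_def, auto simp: nbrs_def dest: adj_V)
  then have 1: "(\<integral>\<^sup>+z. F r z \<partial>count_space V) = ennreal (deg s)"
    by (simp add: F_def deg_def ennreal_of_nat_eq_real_of_nat)
  have e: "r \<in> nbrs y s \<longleftrightarrow> y \<in> nbrs r (1 / s)" for y
    using s by (auto simp: nbrs_def field_simps adj_sym)
  have "(\<integral>\<^sup>+y. F y r * ennreal (weight_ratio y r) \<partial>count_space V) = (\<Sum>y\<in>nbrs r (1/s). F y r * ennreal (weight_ratio y r))"
    by (rule nn_integral_count_space')
      (use adj_V(2) in \<open>auto simp: finite_nbrs F_def e\<close>, auto simp: nbrs_def)
  also have "\<dots> = (\<Sum>y\<in>nbrs r (1/s). ennreal (1/s))"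
  proof (intro sum.cong refl)
    fix y assume y: "y \<in> nbrs r (1/s)"
    then have "w y = 1/s" by (simp add: nbrs_def w_root)
    moreover have "F y r = 1" using y e by (simp add: F_def)
    ultimately show "F y r * ennreal (weight_ratio y r) = ennreal (1/s)" by (simp add: weight_ratio_weight)
  qed
  also have "\<dots> = ennreal (deg (1/s) * (1/s))"
    using s by (simp add: deg_def ennreal_mult ennreal_of_nat_eq_real_of_nat flip: ennreal_mult'')
  finally have "ennreal (deg (1/s) * (1/s)) = ennreal (deg s)"
    using transport[of F r] inv root_in 1 by simp
  then show ?thesis using s by (simp add: field_simps)
qed

end

section \<open>Almost invariant finite sets\<close>

lemma poly_less_exp:
  fixes c :: real assumes "c > 1" shows "\<exists>n. (real n + 2) ^ d < c ^ n"
proof -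
  have "((\<lambda>n. (real n + 2) ^ d / c ^ n) \<longlongrightarrow> 0) sequentially"
    using assms by real_asymp
  then have "eventually (\<lambda>n. (real n + 2) ^ d / c ^ n < 1) sequentially"
    by (rule order_tendstoD) simp
  then obtain n where "(real n + 2) ^ d / c ^ n < 1" by (auto simp: eventually_sequentially)
  then show ?thesis using assms by (auto simp: field_simps)
qed

context rooted_graph
begin

section \<open>Polynomial growth of the set of weights\<close>

definition steps :: "real set" where
  "steps = w ` {y. adj r y}"

text \<open>The ball of radius \<open>n\<close> around 1 in the multiplicative group of weights, for
  the generating set \<open>steps\<close>: by transitivity every vertex sees the same weight ratios
  along its edges.\<close>

definition wball :: "nat \<Rightarrow> real set" where
  "wball n = w ` ball n r"

lemma finite_steps: "finite steps"
  by (simp add: steps_def finite_neighbours)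

lemma finite_wball: "finite (wball n)"
  by (simp add: wball_def finite_ball)

lemma steps_pos: "s \<in> steps \<Longrightarrow> s > 0"
  using w_pos adj_V by (auto simp: steps_def)

lemma wball_pos: "t \<in> wball n \<Longrightarrow> t > 0"
  using w_pos ball_subset[OF root_in] by (auto simp: wball_def)

lemma step_in:
  assumes "adj x y" shows "w y / w x \<in> steps"
proof -
  have V: "x \<in> V" "y \<in> V" using adj_V assms by blast+
  obtain g where g: "graph_auto g" "g x = r" using ex_auto V root_in by blast
  have "adj r (g y)" using auto_adj[OF g(1) V] g assms by simp
  moreover have "w (g y) = w y / w x" using w_scale[OF g(1) V] g w_root by simp
  ultimately show ?thesis by (auto simp: steps_def image_iff)
qed

lemma deg_step:
  assumes "s \<in> steps" shows "deg s > 0"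
proof -
  have "nbrs r s \<noteq> {}" using assms w_root by (auto simp: steps_def nbrs_def)
  then show ?thesis using finite_nbrs by (simp add: deg_def card_gt_0_iff)
qed

lemma wball_mono: "a \<le> b \<Longrightarrow> wball a \<subseteq> wball b"
  unfolding wball_def by (intro image_mono ball_mono)

lemma wball_SucE:
  assumes "t \<in> wball (Suc n)"
  obtains "t \<in> wball n" | u s where "u \<in> wball n" "s \<in> steps" "t = u * s"
proof -
  obtain x where x: "x \<in> ball (Suc n) r" "t = w x" using assms by (auto simp: wball_def)
  show ?thesis
  proof (cases "x \<in> ball n r")
    case True
    then show ?thesis using x that by (auto simp: wball_def)
  next
    case False
    then obtain y where y: "y \<in> ball n r" "adj y x" using x by auto
    have "w y > 0" using y adj_V w_pos by blast
    then show ?thesis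
      using that(2)[of "w y" "w x / w y"] y step_in[OF y(2)] x by (auto simp: wball_def)
  qed
qed

text \<open>The vertex \<open>x\<close> may be far from the root: an automorphism carries it to a
  vertex of the ball with the same weight, and the weight of \<open>y\<close> is preserved along
  with it.\<close>

lemma wball_step:
  assumes "u \<in> wball n" "adj x y" "w x = u" shows "w y \<in> wball (Suc n)"
proof -
  obtain z where z: "z \<in> ball n r" "u = w z" using assms by (auto simp: wball_def)
  have V: "x \<in> V" "y \<in> V" "z \<in> V" using assms adj_V ball_subset[OF root_in] z by blast+
  obtain g where g: "graph_auto g" "g x = z" using ex_auto V by blast
  have adj: "adj z (g y)" using auto_adj[OF g(1) V(1,2)] g assms by simp
  have "w (g y) = w y" using w_scale[OF g(1) V(1,2)] g z assms w_pos[OF V(3)] by simp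
  moreover from adj z have "g y \<in> ball (Suc n) r" by auto
  ultimately show ?thesis unfolding wball_def by (metis imageI)
qed

text \<open>Multiplication is commutative, so an element of \<open>wball n\<close> is determined by
  the multiplicities of the steps, each of them at most \<open>n\<close>.\<close>

lemma card_wball: "card (wball n) \<le> (n + 1) ^ card steps"
proof -
  have "wball n \<subseteq> (\<lambda>k. \<Prod>s\<in>steps. s ^ k s) ` (PiE steps (\<lambda>_. {..n}))"
  proof (induction n)
    case 0
    have "(\<lambda>s. if s \<in> steps then 0 else undefined) \<in> PiE steps (\<lambda>_. {..0::nat})" by auto
    then show ?case by (force simp: wball_def w_root image_iff)
  next
    case (Suc n)
    show ?case
    proof
      fix t assume "t \<in> wball (Suc n)"
      then show "t \<in> (\<lambda>k. \<Prod>s\<in>steps. s ^ k s) ` (PiE steps (\<lambda>_. {..Suc n}))"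
      proof (cases rule: wball_SucE)
        case 1
        have "PiE steps (\<lambda>_. {..n}) \<subseteq> PiE steps (\<lambda>_. {..Suc n})" by (rule PiE_mono) auto
        then show ?thesis using subsetD[OF Suc 1] by (rule subsetD[OF image_mono])
      next
        case (2 u s)
        obtain k where k: "k \<in> PiE steps (\<lambda>_. {..n})" "u = (\<Prod>s\<in>steps. s ^ k s)"
          using subsetD[OF Suc 2(1)] by (elim imageE)
        have "(\<Prod>x\<in>steps. x ^ (k(s := Suc (k s))) x) = s ^ Suc (k s) * (\<Prod>x\<in>steps - {s}. x ^ k x)"
          using 2(2) finite_steps by (subst prod.remove[of _ s]) auto
        also have "\<dots> = t"
          using 2 k finite_steps by (simp add: prod.remove[of steps s])
        finally have "t = (\<Prod>x\<in>steps. x ^ (k(s := Suc (k s))) x)" by simp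
        moreover have "k(s := Suc (k s)) \<in> PiE steps (\<lambda>_. {..Suc n})"
          using k(1) 2(2) by (auto simp: PiE_iff extensional_def le_Suc_eq)
        ultimately show ?thesis by (rule image_eqI)
      qed
    qed
  qed
  then have "card (wball n) \<le> card ((\<lambda>k. \<Prod>s\<in>steps. s ^ k s) ` (PiE steps (\<lambda>_. {..n})))"
    using finite_steps by (intro card_mono) (auto intro!: finite_PiE)
  also have "\<dots> \<le> card (PiE steps (\<lambda>_. {..n}))"
    using finite_steps by (intro card_image_le) (auto intro!: finite_PiE)
  also have "\<dots> = (n + 1) ^ card steps" using finite_steps by (simp add: card_PiE)
  finally show ?thesis .
qed

text \<open>Otherwise the cardinality, which is 1 for \<open>n = 0\<close>, would be at least
  \<open>c ^ n\<close>, against the polynomial bound of \<open>card_wball\<close>.\<close>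

lemma slow_growth:
  fixes c :: real
  assumes "c > 1" shows "\<exists>n. real (card (wball (Suc n))) \<le> c * real (card (wball n))"
proof (rule ccontr)
  assume "\<not> ?thesis"
  then have g: "real (card (wball (Suc n))) > c * real (card (wball n))" for n
    by (auto simp: not_le)
  have "real (card (wball n)) \<ge> c ^ n" for n
  proof (induction n)
    case 0
    then show ?case by (simp add: wball_def)
  next
    case (Suc n)
    have "c ^ Suc n \<le> c * real (card (wball n))" using Suc assms by simp
    then show ?case using g[of n] by linarith
  qed
  moreover obtain n where "(real n + 2) ^ card steps < c ^ n" using poly_less_exp[OF assms] by blast
  moreover have "real (card (wball n)) \<le> real ((n + 1) ^ card steps)"
    using card_wball of_nat_mono by blast
  moreover have "real ((n + 1) ^ card steps) \<le> (real n + 2) ^ card steps"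
    by (simp add: power_mono)
  ultimately show False by (smt (verit))
qed

lemma finite_edge_boundary:
  assumes "finite K" "K \<subseteq> V" shows "finite (edge_boundary (induced_edges E U) K)"
proof -
  have "edge_boundary (induced_edges E U) K \<subseteq> (\<Union>x\<in>K. {e \<in> E. x \<in> e})"
  proof
    fix e assume "e \<in> edge_boundary (induced_edges E U) K"
    then have "e \<in> E" "card (e \<inter> K) = 1" by (auto simp: edge_boundary_def induced_edges_def)
    then show "e \<in> (\<Union>x\<in>K. {e \<in> E. x \<in> e})" by (fastforce simp: card_1_singleton_iff)
  qed
  moreover have "finite (\<Union>x\<in>K. {e \<in> E. x \<in> e})" using assms locally_finite by auto
  ultimately show ?thesis by (rule finite_subset)
qed

text \<open>The edges inside \<open>K\<close> between the levels \<open>t\<close> and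
  \<open>t'\<close> can be counted from either side, with \<open>deg s\<close> edges at each vertex
  of the one level and \<open>deg (1/s)\<close> at each vertex of the other. The totals differ only
  through edges with one end outside \<open>K\<close>, and these lie in the boundary.\<close>

lemma edge_flow:
  fixes t t' :: real
  assumes K: "finite K" "K \<subseteq> {x \<in> V. w x \<in> F}" and F: "t \<in> F" "t' \<in> F" and st: "t' = t * s" "t > 0" "s > 0"
  shows "\<bar>real (deg s) * card {x \<in> K. w x = t} - real (deg (1/s)) * card {x \<in> K. w x = t'}\<bar>
     \<le> card (edge_boundary (induced_edges E {x \<in> V. w x \<in> F}) K)"
proof -
  define B where "B = edge_boundary (induced_edges E {x \<in> V. w x \<in> F}) K"
  have finB: "finite B"
    unfolding B_def using K by (intro finite_edge_boundary) auto
  \<comment> \<open>Directed edges that start in \<open>K\<close>; those in \<open>Q\<close> also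
    end in \<open>K\<close>. \<open>Q\<close> is symmetric under reversal, and what \<open>P\<close>
    has in excess embeds in \<open>B\<close>.\<close>
  define P where "P = (\<lambda>t t'. {(x, y). x \<in> K \<and> w x = t \<and> w y = t' \<and> adj x y})"
  define Q where "Q = (\<lambda>t t'. {(x, y). x \<in> K \<and> y \<in> K \<and> w x = t \<and> w y = t' \<and> adj x y})"
  have P_eq: "P a b = (SIGMA x:{x \<in> K. w x = a}. nbrs x (b/a))" if "a > 0" for a b
    using that by (auto simp: P_def nbrs_def)
  have finP: "finite (P a b)" if "a > 0" for a b
    unfolding P_eq[OF that] using K finite_nbrs by auto
  have cardP: "card (P a b) = deg (b/a) * card {x \<in> K. w x = a}" if "a > 0" for a b
  proof -
    have "card (P a b) = (\<Sum>x\<in>{x \<in> K. w x = a}. card (nbrs x (b/a)))"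
      unfolding P_eq[OF that] using K finite_nbrs by (simp add: card_SigmaI)
    also have "\<dots> = (\<Sum>x\<in>{x \<in> K. w x = a}. deg (b/a))"
      using K by (intro sum.cong) (auto simp: card_nbrs)
    finally show ?thesis by simp
  qed
  have QP: "Q a b \<subseteq> P a b" for a b by (auto simp: P_def Q_def)
  have PQ: "card (P a b) \<le> card (Q a b) + card B" if ab: "a > 0" "a \<in> F" "b \<in> F" for a b
  proof -
    have "(\<lambda>(x, y). {x, y}) ` (P a b - Q a b) \<subseteq> B"
    proof safe
      fix x y assume xy: "(x, y) \<in> P a b" "(x, y) \<notin> Q a b"
      then have *: "x \<in> K" "y \<notin> K" "adj x y" "w x = a" "w y = b" by (auto simp: P_def Q_def)
      then have "{x, y} \<inter> K = {x}" by auto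
      then show "{x, y} \<in> B" using * ab adj_V by (auto simp: B_def edge_boundary_def induced_edges_def)
    qed
    moreover have "inj_on (\<lambda>(x, y). {x, y}) (P a b - Q a b)"
    proof (rule inj_onI, clarify)
      fix x y u v
      assume "(x, y) \<in> P a b" "(x, y) \<notin> Q a b" "(u, v) \<in> P a b" "(u, v) \<notin> Q a b"
        and eq: "{x, y} = {u, v}"
      then have "x \<in> K" "y \<notin> K" "u \<in> K" "v \<notin> K" unfolding P_def Q_def by blast+
      then have "x \<noteq> v" by blast
      then show "x = u \<and> y = v" using eq by (simp add: doubleton_eq_iff)
    qed
    ultimately have "card (P a b - Q a b) \<le> card B" using card_inj_on_le finB by blast
    moreover have "card (P a b) = card (Q a b) + card (P a b - Q a b)"
      using finP[OF ab(1)] QP[of a b] card_mono[of "P a b" "Q a b"]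
      by (subst card_Diff_subset) (auto intro: finite_subset)
    ultimately show ?thesis by simp
  qed
  have QQ: "card (Q a b) = card (Q b a)" for a b
  proof -
    have "Q b a = prod.swap ` Q a b" by (auto simp: Q_def image_iff adj_sym)
    then show ?thesis by (simp add: card_image)
  qed
  have t': "t' > 0" using st by simp
  have le: "card (Q a b) \<le> card (P a b)" if "a > 0" for a b
    using card_mono[OF finP[OF that] QP] .
  have "card (P t t') \<le> card (P t' t) + card B"
    using PQ[of t t'] QQ[of t t'] le[OF t', of t] F st by simp
  moreover have "card (P t' t) \<le> card (P t t') + card B"
    using PQ[of t' t] QQ[of t t'] le[OF st(2), of t'] F t' by simp
  ultimately have "\<bar>real (card (P t t')) - real (card (P t' t))\<bar> \<le> card B" by linarith
  moreover have "card (P t t') = deg s * card {x \<in> K. w x = t}"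
    using cardP[of t t'] st by simp
  moreover have "card (P t' t) = deg (1/s) * card {x \<in> K. w x = t'}"
    using cardP[of t' t] t' st by simp
  ultimately show ?thesis by (simp add: B_def)
qed

text \<open>The total weight that \<open>K\<close> has in level \<open>t\<close> is almost constant over \<open>t \<in> wball (Suc n)\<close>, and by slow
  growth the levels outside \<open>wball n\<close>, the only ones with neighbours outside the union, are a small
  proportion of these.\<close>

lemma folner:
  fixes \<epsilon> :: real
  assumes amen: "\<And>(F :: real set) (\<delta> :: real). finite F \<Longrightarrow> F \<noteq> {} \<Longrightarrow> F \<subseteq> w ` V \<Longrightarrow> \<delta> > 0 \<Longrightarrow>
      \<exists>K. finite K \<and> K \<noteq> {} \<and> K \<subseteq> {x \<in> V. w x \<in> F} \<and>
        card (edge_boundary (induced_edges E {x \<in> V. w x \<in> F}) K) \<le> \<delta> * card K"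
    and \<epsilon>: "\<epsilon> > 0"
  shows "\<exists>K. finite K \<and> K \<noteq> {} \<and> K \<subseteq> V \<and>
     (\<Sum>x\<in>{x \<in> K. \<exists>y. adj x y \<and> y \<notin> K}. w x) \<le> \<epsilon> * (\<Sum>x\<in>K. w x)"
proof -
  obtain n where n: "real (card (wball (Suc n))) \<le> (1 + \<epsilon>/2) * real (card (wball n))"
    using slow_growth[of "1 + \<epsilon>/2"] \<epsilon> by auto
  define F where "F = wball (Suc n)"
  have F: "finite F" "F \<noteq> {}" "F \<subseteq> w ` V"
    unfolding F_def using finite_wball[of "Suc n"] ball_self[of r "Suc n"] ball_subset[OF root_in, of "Suc n"]
    unfolding wball_def by blast+
  have Fpos: "t > 0" if "t \<in> F" for t using wball_pos that by (simp add: F_def)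
  define N where "N = real (card F)"
  have N: "N > 0" using F by (simp add: N_def card_gt_0_iff)
  define Mx where "Mx = Max F"
  define Mn where "Mn = Min F"
  have Mx: "t \<le> Mx" and Mn: "t \<ge> Mn" if "t \<in> F" for t using F that by (auto simp: Mx_def Mn_def)
  have Mnpos: "Mn > 0" using F Fpos by (simp add: Mn_def)
  have Mxpos: "Mx > 0" using F Fpos by (simp add: Mx_def)
  \<comment> \<open>Two levels are compared through the level of weight 1, by at most
    \<open>Suc n\<close> steps on each side.\<close>
  define c where "c = 2 * (real n + 1)"
  have c: "c > 0" by (simp add: c_def)
  \<comment> \<open>Chosen so that the loss \<open>N * c * \<eta>\<close> from comparing levels and
    the loss \<open>\<eta>\<close> from the boundary inside the union add up to
    \<open>\<epsilon> / 2\<close>; the outer shell of levels takes the other half.\<close>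
  define \<eta> where "\<eta> = \<epsilon> / 2 / (N * c + 1)"
  have Nc: "N * c > 0" using N c by simp
  have \<eta>: "\<eta> > 0" using \<epsilon> Nc by (simp add: \<eta>_def)
  have \<eta>2: "N * c * \<eta> + \<eta> = \<epsilon> / 2"
  proof -
    have "N * c + 1 \<noteq> 0" using Nc by linarith
    then have "(N * c + 1) * \<eta> = \<epsilon> / 2" unfolding \<eta>_def by (metis nonzero_mult_div_cancel_left times_divide_eq_right)
    then show ?thesis by (simp add: algebra_simps)
  qed
  define U where "U = {x \<in> V. w x \<in> F}"
  \<comment> \<open>The factor \<open>Mn / Mx\<close> converts numbers into weights: a boundary edge
    is charged at most \<open>Mx\<close>, while a vertex of \<open>K\<close> weighs at least
    \<open>Mn\<close>.\<close>
  obtain K where K: "finite K" "K \<noteq> {}" "K \<subseteq> U"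
    "card (edge_boundary (induced_edges E U) K) \<le> \<eta> * Mn / Mx * card K"
    using amen[OF F, of "\<eta> * Mn / Mx"] \<eta> Mnpos Mxpos unfolding U_def by auto
  define B where "B = edge_boundary (induced_edges E U) K"
  define W where "W = (\<Sum>x\<in>K. w x)"
  have KV: "K \<subseteq> V" using K by (auto simp: U_def)
  have "(\<Sum>x\<in>K. Mn) \<le> W" unfolding W_def using K Mn by (intro sum_mono) (auto simp: U_def)
  then have W: "Mn * card K \<le> W" by (simp add: mult.commute)
  have Wpos: "W > 0" unfolding W_def using K KV w_pos by (intro sum_pos) auto
  have MB: "Mx * card B \<le> \<eta> * W"
  proof -
    have "Mx * card B \<le> Mx * (\<eta> * Mn / Mx * card K)"
      using K(4) Mxpos by (intro mult_left_mono) (auto simp: B_def)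
    also have "\<dots> = \<eta> * (Mn * card K)" using Mxpos by simp
    also have "\<dots> \<le> \<eta> * W" using W \<eta> by (intro mult_left_mono) auto
    finally show ?thesis .
  qed
  define k where "k = (\<lambda>t. t * real (card {x \<in> K. w x = t}))"
  have k_sum: "k t = (\<Sum>x\<in>{x \<in> K. w x = t}. w x)" for t by (simp add: k_def)
  have kW: "(\<Sum>t\<in>F. k t) = W"
    unfolding k_sum W_def using K F by (intro sum.group) (auto simp: U_def)
  have step: "\<bar>k t - k (t * s)\<bar> \<le> \<eta> * W" if t: "t \<in> F" "s \<in> steps" "t * s \<in> F" for t s
  proof -
    have s: "s > 0" using steps_pos t by blast
    have d: "real (deg s) \<ge> 1" using deg_step t(2) by (simp add: Suc_leI)
    have "\<bar>real (deg s) * card {x \<in> K. w x = t} - real (deg (1/s)) * card {x \<in> K. w x = t * s}\<bar> \<le> card B"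
      using edge_flow[OF K(1) K(3)[unfolded U_def] t(1,3) refl Fpos[OF t(1)] s] by (simp add: B_def U_def)
    \<comment> \<open>By \<open>deg_balance\<close> the factor \<open>deg s \<ge> 1\<close> splits
      off. Multiplying the rest by \<open>t\<close> compares total weights, since
      \<open>t * s\<close> is exactly the weight of a vertex on the second level.\<close>
    then have "\<bar>real (deg s) * (card {x \<in> K. w x = t} - s * card {x \<in> K. w x = t * s})\<bar> \<le> card B"
      by (simp add: deg_balance[OF s] algebra_simps)
    then have "real (deg s) * \<bar>card {x \<in> K. w x = t} - s * card {x \<in> K. w x = t * s}\<bar> \<le> card B"
      by (simp add: abs_mult)
    then have "\<bar>card {x \<in> K. w x = t} - s * card {x \<in> K. w x = t * s}\<bar> \<le> card B"
      using d mult_right_mono[OF d, of "\<bar>card {x \<in> K. w x = t} - s * card {x \<in> K. w x = t * s}\<bar>"] by simp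
    then have "t * \<bar>card {x \<in> K. w x = t} - s * card {x \<in> K. w x = t * s}\<bar> \<le> Mx * card B"
      using Mx[OF t(1)] Fpos[OF t(1)] by (intro mult_mono) auto
    moreover have "\<bar>k t - k (t * s)\<bar> = t * \<bar>card {x \<in> K. w x = t} - s * card {x \<in> K. w x = t * s}\<bar>"
    proof -
      have "k t - k (t * s) = t * (card {x \<in> K. w x = t} - s * card {x \<in> K. w x = t * s})"
        by (simp add: k_def algebra_simps)
      then show ?thesis using Fpos[OF t(1)] by (simp add: abs_mult)
    qed
    ultimately show ?thesis using MB by linarith
  qed
  have near1: "\<bar>k t - k 1\<bar> \<le> real j * (\<eta> * W)" if "j \<le> Suc n" "t \<in> wball j" for j t
    using that
  proof (induction j arbitrary: t)
    case 0
    then show ?case by (simp add: wball_def w_root)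
  next
    case (Suc j)
    have pos: "\<eta> * W > 0" using \<eta> Wpos by simp
    from Suc.prems(2) show ?case
    proof (cases rule: wball_SucE)
      case 1
      then have "\<bar>k t - k 1\<bar> \<le> real j * (\<eta> * W)" using Suc by simp
      then show ?thesis using pos by (simp add: algebra_simps)
    next
      case (2 u s)
      have "u \<in> F" "t \<in> F" using 2 Suc.prems wball_mono[of j "Suc n"] wball_mono[of "Suc j" "Suc n"]
        by (auto simp: F_def)
      then have "\<bar>k u - k t\<bar> \<le> \<eta> * W" using step 2 by simp
      moreover have "\<bar>k u - k 1\<bar> \<le> real j * (\<eta> * W)" using Suc 2 by simp
      ultimately show ?thesis by (simp add: algebra_simps)
    qed
  qed
  have near: "k t \<le> k t' + c * \<eta> * W" if "t \<in> F" "t' \<in> F" for t t'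
    using near1[of "Suc n" t] near1[of "Suc n" t'] that by (simp add: F_def c_def algebra_simps)
  have kt: "k t \<le> W / N + c * \<eta> * W" if t: "t \<in> F" for t
  proof -
    have "(\<Sum>t'\<in>F. k t) \<le> (\<Sum>t'\<in>F. k t' + c * \<eta> * W)" using near t by (intro sum_mono) auto
    then have "N * k t \<le> W + N * (c * \<eta> * W)" by (simp add: sum.distrib kW N_def)
    then show ?thesis using N by (simp add: field_simps)
  qed
  define D where "D = {x \<in> K. \<exists>y. adj x y \<and> y \<notin> K}"
  define D1 where "D1 = {x \<in> K. w x \<in> F - wball n}"
  define D2 where "D2 = {x \<in> K. \<exists>y\<in>U. adj x y \<and> y \<notin> K}"
  have fin: "finite D1" "finite D2" using K by (auto simp: D1_def D2_def)
  have DD: "D \<subseteq> D1 \<union> D2"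
  proof
    fix x assume "x \<in> D"
    then obtain y where y: "x \<in> K" "adj x y" "y \<notin> K" by (auto simp: D_def)
    show "x \<in> D1 \<union> D2"
    proof (cases "w x \<in> wball n")
      case True
      then have "y \<in> U" using wball_step[OF True y(2) refl] adj_V[OF y(2)] by (simp add: U_def F_def)
      then show ?thesis using y by (auto simp: D2_def)
    next
      case False
      then show ?thesis using y K by (auto simp: D1_def U_def)
    qed
  qed
  have "(\<Sum>x\<in>D1. w x) = (\<Sum>t\<in>F - wball n. \<Sum>x\<in>{x \<in> D1. w x = t}. w x)"
    using fin F by (intro sum.group[symmetric]) (auto simp: D1_def)
  also have "\<dots> = (\<Sum>t\<in>F - wball n. k t)"
    unfolding k_sum by (intro sum.cong) (auto simp: D1_def)
  also have "\<dots> \<le> (\<Sum>t\<in>F - wball n. W / N + c * \<eta> * W)" using kt by (intro sum_mono) auto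
  also have "\<dots> = real (card (F - wball n)) * (W / N + c * \<eta> * W)" by simp
  also have "\<dots> = real (card (F - wball n)) * (W / N) + real (card (F - wball n)) * (c * \<eta> * W)"
    by (simp add: algebra_simps)
  also have "\<dots> \<le> (\<epsilon>/2 * N) * (W / N) + N * (c * \<eta> * W)"
  proof (intro add_mono mult_right_mono)
    have sub: "wball n \<subseteq> F" unfolding F_def by (rule wball_mono) simp
    have "real (card (F - wball n)) = N - real (card (wball n))"
      using sub F finite_wball[of n] card_mono[OF F(1) sub] by (simp add: card_Diff_subset N_def of_nat_diff)
    also have "\<dots> \<le> \<epsilon>/2 * real (card (wball n))" using n by (simp add: N_def F_def algebra_simps)
    also have "\<dots> \<le> \<epsilon>/2 * N"
      using card_mono[OF F(1) sub] \<epsilon> by (intro mult_left_mono) (auto simp: N_def)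
    finally show "real (card (F - wball n)) \<le> \<epsilon>/2 * N" .
    show "real (card (F - wball n)) \<le> N" using F by (simp add: N_def card_mono)
  qed (use Wpos N c \<eta> in auto)
  also have "\<dots> = \<epsilon>/2 * W + N * c * \<eta> * W" using N by simp
  finally have d1: "(\<Sum>x\<in>D1. w x) \<le> \<epsilon>/2 * W + N * c * \<eta> * W" .
  have "card D2 \<le> card B"
  proof -
    have "\<forall>x\<in>D2. \<exists>y. y \<in> U \<and> adj x y \<and> y \<notin> K" by (auto simp: D2_def)
    then obtain f where f: "\<And>x. x \<in> D2 \<Longrightarrow> f x \<in> U \<and> adj x (f x) \<and> f x \<notin> K" by metis
    have "{x, f x} \<in> B" if "x \<in> D2" for x
    proof -
      have "x \<in> K" using that by (simp add: D2_def)
      moreover from this have "{x, f x} \<inter> K = {x}" using f[OF that] by auto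
      ultimately show ?thesis
        using f[OF that] K by (auto simp: B_def edge_boundary_def induced_edges_def)
    qed
    moreover have "inj_on (\<lambda>x. {x, f x}) D2"
    proof (rule inj_onI)
      fix x y assume xy: "x \<in> D2" "y \<in> D2" "{x, f x} = {y, f y}"
      then have "x \<in> K" "y \<in> K" by (auto simp: D2_def)
      then have "x \<noteq> f y" using f[OF xy(2)] by blast
      then show "x = y" using xy(3) by (simp add: doubleton_eq_iff)
    qed
    moreover have "finite B" unfolding B_def using K(1) KV by (rule finite_edge_boundary)
    ultimately show ?thesis by (intro card_inj_on_le[of "\<lambda>x. {x, f x}"]) auto
  qed
  then have "Mx * card D2 \<le> Mx * card B" using Mxpos by (intro mult_left_mono) auto
  moreover have "(\<Sum>x\<in>D2. w x) \<le> (\<Sum>x\<in>D2. Mx)"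
    using K Mx by (intro sum_mono) (auto simp: D2_def U_def)
  ultimately have d2: "(\<Sum>x\<in>D2. w x) \<le> \<eta> * W" using MB by (simp add: mult.commute)
  have nn: "w x \<ge> 0" if "x \<in> K" for x using that KV w_pos less_imp_le by blast
  have "(\<Sum>x\<in>D. w x) \<le> (\<Sum>x\<in>D1 \<union> D2. w x)"
    using fin DD nn by (intro sum_mono2) (auto simp: D1_def D2_def)
  also have "\<dots> \<le> (\<Sum>x\<in>D1. w x) + (\<Sum>x\<in>D2. w x)"
    using fin nn by (subst sum.union_inter[symmetric]) (auto intro!: sum_nonneg simp: D1_def D2_def)
  also have "\<dots> \<le> \<epsilon>/2 * W + (N * c * \<eta> + \<eta>) * W" using d1 d2 by (simp add: algebra_simps)
  also have "\<dots> = \<epsilon> * W" unfolding \<eta>2 by simp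
  finally show ?thesis using K KV by (auto simp: D_def W_def)
qed

section \<open>Levels as sets of constant weight\<close>

lemma card_S_eq_iff:
  assumes "x \<in> V" "y \<in> V" shows "card (S x y) = card (S y x) \<longleftrightarrow> w x = w y"
proof -
  have "card (S x y) = card (S y x) \<longleftrightarrow> weight_ratio x y = 1"
    using card_S_pos[OF assms(2,1)] by (auto simp: weight_ratio_def)
  also have "\<dots> \<longleftrightarrow> w x = w y"
    using weight_ratio_eq[OF assms] w_pos[OF assms(2)] by auto
  finally show ?thesis .
qed

lemma level_weight:
  assumes "t \<in> w ` V" shows "level V E {x \<in> V. w x = t}"
  unfolding level_def equal_weight_set_def
proof (intro conjI allI impI ballI)
  show "{x \<in> V. w x = t} \<subseteq> V" by auto
next
  fix x y assume "x \<in> {x \<in> V. w x = t}" "y \<in> {x \<in> V. w x = t}"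
  then show "card (S x y) = card (S y x)" by (simp add: card_S_eq_iff)
next
  fix M assume M: "(M \<subseteq> V \<and> (\<forall>x\<in>M. \<forall>y\<in>M. card (S x y) = card (S y x))) \<and> {x \<in> V. w x = t} \<subseteq> M"
  obtain x where x: "x \<in> V" "w x = t" using assms by auto
  have "y \<in> V \<and> w y = t" if "y \<in> M" for y
    using M x that card_S_eq_iff[of x y] by (metis (mono_tags, lifting) mem_Collect_eq subsetD)
  then show "M = {x \<in> V. w x = t}" using M by blast
qed

text \<open>The two alternatives of the hypothesis meet here: a finite component is itself a set
  with empty boundary, and an infimum equal to 0 admits a set whose quotient is below
  \<delta>.\<close>

lemma amenable_union_of_levels:
  fixes F :: "real set" and \<delta> :: real
  assumes hyp: "(\<forall>\<L>. finite \<L> \<and> \<L> \<noteq> {} \<and> (\<forall>L\<in>\<L>. level V E L) \<longrightarrow>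
            (\<forall>C\<in>graph_components (\<Union>\<L>) (induced_edges E (\<Union>\<L>)). finite C))
       \<or> (\<forall>\<L>. finite \<L> \<and> \<L> \<noteq> {} \<and> (\<forall>L\<in>\<L>. level V E L) \<longrightarrow>
            amenable (\<Union>\<L>) (induced_edges E (\<Union>\<L>)))"
    and F: "finite F" "F \<noteq> {}" "F \<subseteq> w ` V" and \<delta>: "\<delta> > 0"
  shows "\<exists>K. finite K \<and> K \<noteq> {} \<and> K \<subseteq> {x \<in> V. w x \<in> F} \<and>
        card (edge_boundary (induced_edges E {x \<in> V. w x \<in> F}) K) \<le> \<delta> * card K"
proof -
  define \<L> where "\<L> = (\<lambda>t. {x \<in> V. w x = t}) ` F"
  define U where "U = {x \<in> V. w x \<in> F}"
  define EU where "EU = induced_edges E U"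
  have U: "\<Union>\<L> = U" by (auto simp: \<L>_def U_def)
  have L: "finite \<L> \<and> \<L> \<noteq> {} \<and> (\<forall>L\<in>\<L>. level V E L)"
    using F level_weight by (auto simp: \<L>_def)
  obtain x where x: "x \<in> U" using F by (force simp: U_def)
  consider "\<forall>C\<in>graph_components U EU. finite C" | "amenable U EU"
    using hyp L U unfolding EU_def by metis
  then have "\<exists>K. finite K \<and> K \<noteq> {} \<and> K \<subseteq> U \<and> card (edge_boundary EU K) \<le> \<delta> * card K"
  proof cases
    case 1
    define K where "K = {y \<in> U. reachable EU x y}"
    have "finite K" using 1 x by (auto simp: graph_components_def K_def)
    moreover have "x \<in> K" using x by (simp add: K_def reachable_def)
    moreover have "edge_boundary EU K = {}"
    proof -
      have "card (e \<inter> K) \<noteq> 1" if e: "e \<in> EU" for e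
      proof
        assume "card (e \<inter> K) = 1"
        then obtain u where u: "e \<inter> K = {u}" by (auto simp: card_1_singleton_iff)
        obtain a b where ab: "e = {a, b}" "a \<noteq> b"
          using edge_card[of e] e by (auto simp: EU_def induced_edges_def card_2_iff)
        have "u = a \<or> u = b" using u ab by auto
        then obtain v where v: "e = {u, v}" "v \<noteq> u" using ab by (metis insert_commute)
        then have "v \<in> U" using e by (auto simp: EU_def induced_edges_def)
        moreover have "reachable EU x v"
        proof -
          have "reachable EU x u" using u unfolding K_def by blast
          then show ?thesis using v e unfolding reachable_def by (simp add: rtranclp.rtrancl_into_rtrancl)
        qed
        ultimately have "v \<in> K" by (simp add: K_def)
        then show False using u v by blast
      qed
      then show ?thesis by (auto simp: edge_boundary_def)
    qed
    ultimately show ?thesis using \<delta> by (intro exI[of _ K]) (auto simp: K_def)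
  next
    case 2
    let ?A = "{K. finite K \<and> K \<noteq> {} \<and> K \<subseteq> U}"
    have "{x} \<in> ?A" using x by auto
    then have "?A \<noteq> {}" by blast
    moreover have "(INF K\<in>?A. real (card (edge_boundary EU K)) / real (card K)) < \<delta>"
      using 2 \<delta> by (simp add: amenable_def)
    moreover have "bdd_below ((\<lambda>K. real (card (edge_boundary EU K)) / real (card K)) ` ?A)"
      by (rule bdd_belowI[of _ 0]) auto
    ultimately obtain K where K: "K \<in> ?A" "real (card (edge_boundary EU K)) / real (card K) < \<delta>"
      by (subst (asm) cINF_less_iff) auto
    then have "card K > 0" by (auto simp: card_gt_0_iff)
    then have "card (edge_boundary EU K) \<le> \<delta> * card K" using K by (simp add: field_simps)
    then show ?thesis using K by blast
  qed
  then show ?thesis by (simp add: U_def EU_def)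
qed

text \<open>Start from a pair of weight ratio \<open>s > 1\<close>. An automorphism that moves its
  lighter vertex to one of weight \<open>s ^ n\<close> moves the heavier one to weight
  \<open>s ^ Suc n\<close>.\<close>

lemma weight_unbounded:
  assumes "\<not> unimodular V E" shows "\<exists>y\<in>V. w y > c"
proof -
  obtain x y where xy: "x \<in> V" "y \<in> V" "w x < w y"
    using assms card_S_eq_iff unfolding unimodular_def by (metis linorder_neqE_linordered_idom)
  define s where "s = w y / w x"
  have s: "s > 1" using xy w_pos[OF xy(1)] by (simp add: s_def)
  have "\<exists>z\<in>V. w z = s ^ n" for n
  proof (induction n)
    case 0
    then show ?case using root_in w_root by auto
  next
    case (Suc n)
    then obtain z where z: "z \<in> V" "w z = s ^ n" by blast
    obtain g where g: "graph_auto g" "g x = z" using ex_auto xy z by blast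
    have "w (g y) = s ^ Suc n" using w_scale[OF g(1) xy(1,2)] g z by (simp add: s_def)
    then show ?case using g xy by blast
  qed
  moreover obtain n where "c < s ^ n" using real_arch_pow[OF s] by blast
  ultimately show ?thesis by metis
qed

section \<open>Open paths and trifurcations\<close>

text \<open>No edge of the path may touch \<open>A\<close>, but the empty path is allowed even at a
  point of \<open>A\<close>. Hence the side conditions such as \<open>x \<notin> A\<close> in
  \<open>joined_notin\<close> or \<open>y \<noteq> x\<close> in \<open>poor\<close>.\<close>

definition joined :: "('a set \<Rightarrow> bool) \<Rightarrow> 'a set \<Rightarrow> 'a \<Rightarrow> 'a \<Rightarrow> bool" where
  "joined \<omega> A = (\<lambda>x y. {x, y} \<in> E \<and> \<omega> {x, y} \<and> x \<notin> A \<and> y \<notin> A)\<^sup>*\<^sup>*"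

abbreviation reach :: "('a set \<Rightarrow> bool) \<Rightarrow> 'a \<Rightarrow> 'a \<Rightarrow> bool" where
  "reach \<omega> \<equiv> joined \<omega> {}"

lemma joined_refl [simp, intro]: "joined \<omega> A x x"
  by (simp add: joined_def)

lemma joined_trans: "joined \<omega> A x y \<Longrightarrow> joined \<omega> A y z \<Longrightarrow> joined \<omega> A x z"
  by (simp add: joined_def)

lemma joined_sym:
  assumes "joined \<omega> A x y" shows "joined \<omega> A y x"
proof -
  have "symp (\<lambda>x y. {x, y} \<in> E \<and> \<omega> {x, y} \<and> x \<notin> A \<and> y \<notin> A)"
    by (auto simp: symp_def insert_commute)
  from sympD[OF symp_rtranclp[OF this]] show ?thesis using assms unfolding joined_def .
qed

lemma joined_step: "adj x y \<Longrightarrow> \<omega> {x, y} \<Longrightarrow> x \<notin> A \<Longrightarrow> y \<notin> A \<Longrightarrow> joined \<omega> A x y"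
  unfolding joined_def by (rule r_into_rtranclp) simp

lemma joined_induct [consumes 1, case_names base step]:
  assumes "joined \<omega> A x y" "P x"
    "\<And>y z. joined \<omega> A x y \<Longrightarrow> adj y z \<Longrightarrow> \<omega> {y, z} \<Longrightarrow> y \<notin> A \<Longrightarrow> z \<notin> A \<Longrightarrow> P y \<Longrightarrow> P z"
  shows "P y"
  using assms(1) unfolding joined_def
  by (induction rule: rtranclp_induct) (use assms(2,3) in \<open>auto simp: joined_def\<close>)

lemma joined_mono:
  assumes "joined \<omega> B x y" "\<And>a b. adj a b \<Longrightarrow> \<omega> {a, b} \<Longrightarrow> a \<notin> B \<Longrightarrow> b \<notin> B \<Longrightarrow> \<omega>' {a, b} \<and> a \<notin> A \<and> b \<notin> A"
  shows "joined \<omega>' A x y"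
  using assms(1)
proof (induction rule: joined_induct)
  case (step y z)
  have "joined \<omega>' A y z" using assms(2)[OF step(2-5)] step(2) by (simp add: joined_step)
  with step.IH show ?case by (rule joined_trans)
qed simp

lemma joined_anti: "joined \<omega> B x y \<Longrightarrow> A \<subseteq> B \<Longrightarrow> joined \<omega> A x y"
  by (erule joined_mono) auto

lemma joined_notin: "joined \<omega> A x y \<Longrightarrow> x \<notin> A \<Longrightarrow> y \<notin> A"
  by (induction rule: joined_induct) auto

text \<open>A path from \<open>z\<close> that meets \<open>x\<close> and \<open>y\<close> meets one of them first.\<close>

lemma joined_first:
  assumes "reach \<omega> z y" "x \<noteq> y" shows "z = x \<or> z = y \<or> joined \<omega> {y} z x \<or> joined \<omega> {x} z y"
proof -
  have "reach \<omega> y z" using assms(1) by (rule joined_sym)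
  then show ?thesis
  proof (induction rule: joined_induct)
    case (step u v)
    have 1: "joined \<omega> {y} v u" if "v \<noteq> y" "u \<noteq> y"
      using step that by (auto intro!: joined_step simp: insert_commute)
    have 2: "joined \<omega> {x} v u" if "v \<noteq> x" "u \<noteq> x"
      using step that by (auto intro!: joined_step simp: insert_commute)
    show ?case using step.IH 1 2 assms(2) joined_trans by blast
  qed simp
qed

text \<open>Unbounded weights in a branch. Integer thresholds make this a countable intersection of
  events.\<close>

definition tall :: "('a set \<Rightarrow> bool) \<Rightarrow> 'a set \<Rightarrow> 'a \<Rightarrow> bool" where
  "tall \<omega> A a \<longleftrightarrow> (\<forall>n::nat. \<exists>b\<in>V. joined \<omega> A a b \<and> w b \<ge> real n)"

definition trifurcation :: "('a set \<Rightarrow> bool) \<Rightarrow> 'a \<Rightarrow> bool" where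
  "trifurcation \<omega> x \<longleftrightarrow> (\<exists>a\<in>V. \<exists>b\<in>V. \<exists>c\<in>V. a \<noteq> x \<and> b \<noteq> x \<and> c \<noteq> x \<and>
     reach \<omega> x a \<and> reach \<omega> x b \<and> reach \<omega> x c \<and>
     \<not> joined \<omega> {x} a b \<and> \<not> joined \<omega> {x} a c \<and> \<not> joined \<omega> {x} b c \<and>
     tall \<omega> {x} a \<and> tall \<omega> {x} b \<and> tall \<omega> {x} c)"

text \<open>A version of branching that a finite set can see: companions in three branches lie
  within distance \<open>n\<close>. They are trifurcations themselves, so that trifurcations can be
  counted against trifurcations.\<close>

definition good :: "nat \<Rightarrow> ('a set \<Rightarrow> bool) \<Rightarrow> 'a \<Rightarrow> bool" where
  "good n \<omega> x \<longleftrightarrow> (\<exists>a\<in>ball n x. \<exists>b\<in>ball n x. \<exists>c\<in>ball n x. a \<noteq> x \<and> b \<noteq> x \<and> c \<noteq> x \<and>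
     reach \<omega> x a \<and> reach \<omega> x b \<and> reach \<omega> x c \<and>
     \<not> joined \<omega> {x} a b \<and> \<not> joined \<omega> {x} a c \<and> \<not> joined \<omega> {x} b c \<and>
     trifurcation \<omega> a \<and> trifurcation \<omega> b \<and> trifurcation \<omega> c \<and> w a \<ge> 3/4 * w x \<and> w b \<ge> 3/4 * w x \<and> w c \<ge> 3/4 * w x)"

text \<open>The pull-back of a configuration along \<open>g\<close>. Restriction to \<open>E\<close>
  keeps it in the extensional product space on which the measure lives.\<close>

definition act :: "('a \<Rightarrow> 'a) \<Rightarrow> ('a set \<Rightarrow> bool) \<Rightarrow> 'a set \<Rightarrow> bool" where
  "act g \<omega> = (\<lambda>e\<in>E. \<omega> (g ` e))"

lemma joined_act:
  assumes g: "graph_auto g" and A: "A \<subseteq> V" and V: "x \<in> V" "y \<in> V"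
  shows "joined (act g \<omega>) A x y \<longleftrightarrow> joined \<omega> (g ` A) (g x) (g y)"
proof
  have notin: "g a \<notin> g ` A" if "a \<notin> A" "a \<in> V" for a
    using that A auto_eq_iff[OF g] by blast
  assume "joined (act g \<omega>) A x y"
  then show "joined \<omega> (g ` A) (g x) (g y)"
  proof (induction rule: joined_induct)
    case (step y z)
    have V: "y \<in> V" "z \<in> V" using adj_V step by blast+
    have "joined \<omega> (g ` A) (g y) (g z)"
      using step notin V auto_adj[OF g V] by (intro joined_step) (auto simp: act_def)
    then show ?case using step.IH joined_trans by blast
  qed simp
next
  let ?h = "inv_into V g"
  have *: "joined (act g \<omega>) A (?h u) (?h v)" if "joined \<omega> (g ` A) u v" for u v
    using that
  proof (induction rule: joined_induct)
    case (step y z)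
    have V: "y \<in> V" "z \<in> V" using adj_V step by blast+
    have hV: "?h y \<in> V" "?h z \<in> V" using auto_inv[OF g] V by auto
    have gh: "g (?h y) = y" "g (?h z) = z" using auto_inv_right[OF g] V by auto
    have "?h y \<notin> A" "?h z \<notin> A" using gh step by force+
    moreover have "adj (?h y) (?h z)" using auto_adj[OF g hV] gh step by simp
    ultimately have "joined (act g \<omega>) A (?h y) (?h z)"
      using step gh by (intro joined_step) (auto simp: act_def)
    then show ?case using step.IH joined_trans by blast
  qed simp
  assume "joined \<omega> (g ` A) (g x) (g y)"
  from *[OF this] show "joined (act g \<omega>) A x y" using g V by (simp add: auto_inv_eq)
qed

lemma auto_Bex_V: "graph_auto g \<Longrightarrow> (\<exists>x\<in>V. P (g x)) \<longleftrightarrow> (\<exists>x\<in>V. P x)"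
  using auto_surj auto_in by metis

text \<open>An automorphism multiplies all weights by one positive constant, which does not affect
  unboundedness.\<close>

lemma tall_act:
  assumes g: "graph_auto g" and A: "A \<subseteq> V" and V: "x \<in> V"
  shows "tall (act g \<omega>) A x \<longleftrightarrow> tall \<omega> (g ` A) (g x)"
proof -
  define c where "c = w (g r) / w r"
  have c: "c > 0" using w_pos root_in g by (simp add: c_def)
  have wg: "w (g y) = c * w y" if "y \<in> V" for y
    using w_scale[OF g root_in that] by (simp add: c_def)
  have "tall (act g \<omega>) A x \<longleftrightarrow> (\<forall>n::nat. \<exists>b\<in>V. joined \<omega> (g ` A) (g x) (g b) \<and> w b \<ge> real n)"
    unfolding tall_def using joined_act[OF g A V] by blast
  also have "\<dots> \<longleftrightarrow> (\<forall>n::nat. \<exists>b\<in>V. joined \<omega> (g ` A) (g x) (g b) \<and> w (g b) \<ge> real n)"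
  proof (intro iffI allI)
    fix n :: nat
    assume L: "\<forall>n::nat. \<exists>b\<in>V. joined \<omega> (g ` A) (g x) (g b) \<and> w b \<ge> real n"
    obtain k :: nat where k: "real k \<ge> real n / c" using real_arch_simple by blast
    obtain b where "b \<in> V" "joined \<omega> (g ` A) (g x) (g b)" "w b \<ge> real k" using L by blast
    moreover from this have "w (g b) \<ge> real n"
      using k c wg[of b] by (simp add: field_simps) (smt (verit) mult_left_mono)
    ultimately show "\<exists>b\<in>V. joined \<omega> (g ` A) (g x) (g b) \<and> w (g b) \<ge> real n" by blast
  next
    fix n :: nat
    assume R: "\<forall>n::nat. \<exists>b\<in>V. joined \<omega> (g ` A) (g x) (g b) \<and> w (g b) \<ge> real n"
    obtain k :: nat where k: "real k \<ge> c * real n" using real_arch_simple by blast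
    obtain b where "b \<in> V" "joined \<omega> (g ` A) (g x) (g b)" "w (g b) \<ge> real k" using R by blast
    moreover from this have "c * w b \<ge> c * real n"
      using k wg[of b] by linarith
    ultimately show "\<exists>b\<in>V. joined \<omega> (g ` A) (g x) (g b) \<and> w b \<ge> real n" using c by auto
  qed
  also have "\<dots> \<longleftrightarrow> tall \<omega> (g ` A) (g x)"
    unfolding tall_def using auto_surj[OF g] auto_in[OF g] by metis
  finally show ?thesis .
qed

lemma trifurcation_act:
  assumes g: "graph_auto g" and V: "x \<in> V"
  shows "trifurcation (act g \<omega>) x \<longleftrightarrow> trifurcation \<omega> (g x)"
proof -
  have 1: "trifurcation (act g \<omega>) x \<longleftrightarrow> (\<exists>a\<in>V. \<exists>b\<in>V. \<exists>c\<in>V. g a \<noteq> g x \<and> g b \<noteq> g x \<and> g c \<noteq> g x \<and>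
     reach \<omega> (g x) (g a) \<and> reach \<omega> (g x) (g b) \<and> reach \<omega> (g x) (g c) \<and>
     \<not> joined \<omega> {g x} (g a) (g b) \<and> \<not> joined \<omega> {g x} (g a) (g c) \<and> \<not> joined \<omega> {g x} (g b) (g c) \<and>
     tall \<omega> {g x} (g a) \<and> tall \<omega> {g x} (g b) \<and> tall \<omega> {g x} (g c))"
    unfolding trifurcation_def using V
    by (intro bex_cong refl) (simp add: joined_act[OF g] tall_act[OF g] auto_eq_iff[OF g])
  show ?thesis
    unfolding 1 trifurcation_def[of \<omega>]
    by (subst auto_Bex_V[OF g, symmetric], subst auto_Bex_V[OF g, symmetric],
        subst auto_Bex_V[OF g, symmetric]) simp
qed

lemma good_act:
  assumes g: "graph_auto g" and V: "x \<in> V"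
  shows "good n (act g \<omega>) x \<longleftrightarrow> good n \<omega> (g x)"
proof -
  have BV: "a \<in> V" if "a \<in> ball n x" for a using that ball_subset[OF V] by blast
  have wg: "3 * w (g x) \<le> w (g a) * 4 \<longleftrightarrow> 3 * w x \<le> w a * 4" if "a \<in> V" for a
  proof -
    define c where "c = w (g x) / w x"
    have "c > 0" using w_pos V g by (simp add: c_def)
    moreover have "w (g x) = c * w x" using w_pos[OF V] by (simp add: c_def)
    moreover have "w (g a) = c * w a" using w_scale[OF g V that] by (simp add: c_def)
    moreover have "3 * (c * w x) \<le> c * w a * 4 \<longleftrightarrow> c * (3 * w x) \<le> c * (w a * 4)"
      by (simp add: mult_ac)
    ultimately show ?thesis by simp
  qed
  show ?thesis
    unfolding good_def auto_ball_image[OF g V] Set.bex_simps(7)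
    by (intro bex_cong refl)
      (use V BV in \<open>simp add: joined_act[OF g] trifurcation_act[OF g] auto_eq_iff[OF g] wg\<close>)
qed

section \<open>Invariance, mass transport and finite energy of percolation\<close>

context
  fixes p :: real
begin

abbreviation M :: "('a set \<Rightarrow> bool) measure" where
  "M \<equiv> bernoulli_percolation E p"

lemma borel_measurable_nn_integral_V:
  fixes f :: "'a \<Rightarrow> 'b \<Rightarrow> ennreal"
  assumes "\<And>y. y \<in> V \<Longrightarrow> f y \<in> borel_measurable N"
  shows "(\<lambda>\<omega>. \<integral>\<^sup>+y. f y \<omega> \<partial>count_space V) \<in> borel_measurable N"
proof -
  have "(\<integral>\<^sup>+y. f y \<omega> \<partial>count_space V) = (\<Sum>n. f (from_nat_into V n) \<omega>)" for \<omega>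
    by (simp add: nn_integral_bij_count_space[symmetric, OF bij_betw_from_nat_into[OF countable_V infinite_vertices]]
        nn_integral_count_space_nat)
  then show ?thesis
    using assms from_nat_into[OF V_nonempty] by simp
qed

lemma prob_M: "prob_space M"
  unfolding bernoulli_percolation_def by (intro prob_space_PiM measure_pmf.prob_space_axioms)

lemma emeasure_M_space [simp]: "emeasure M (space M) = 1"
  using prob_space.emeasure_space_1[OF prob_M] .

lemma edge_pred [measurable]: "e \<in> E \<Longrightarrow> Measurable.pred M (\<lambda>\<omega>. \<omega> e)"
proof -
  assume e: "e \<in> E"
  have "(\<lambda>\<omega>. \<omega> e) \<in> measurable M (measure_pmf (bernoulli_pmf p))"
    unfolding bernoulli_percolation_def by (rule measurable_component_singleton[OF e])
  then show ?thesis by simp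
qed

section \<open>Measurability of path events\<close>

lemma pred_Bex_V:
  assumes "A \<subseteq> V" "\<And>x. x \<in> A \<Longrightarrow> Measurable.pred M (P x)"
  shows "Measurable.pred M (\<lambda>\<omega>. \<exists>x\<in>A. P x \<omega>)"
  using assms countable_subset[OF assms(1) countable_V]
  unfolding pred_def by (intro sets.sets_Collect_countable_Ex')

lemma pred_Ball_V:
  assumes "A \<subseteq> V" "\<And>x. x \<in> A \<Longrightarrow> Measurable.pred M (P x)"
  shows "Measurable.pred M (\<lambda>\<omega>. \<forall>x\<in>A. P x \<omega>)"
  using assms countable_subset[OF assms(1) countable_V]
  unfolding pred_def by (intro sets.sets_Collect_countable_All')

text \<open>Split according to the length of the path; each length adds one countable union over the
  last intermediate vertex.\<close>

lemma pred_joined [measurable]: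
  assumes "x \<in> V" "y \<in> V" shows "Measurable.pred M (\<lambda>\<omega>. joined \<omega> A x y)"
proof -
  define R where "R = (\<lambda>\<omega> x y. {x, y} \<in> E \<and> \<omega> {x, y} \<and> x \<notin> A \<and> y \<notin> A)"
  have R: "Measurable.pred M (\<lambda>\<omega>. R \<omega> x y)" for x y
    unfolding R_def by (cases "{x, y} \<in> E") simp_all
  have "Measurable.pred M (\<lambda>\<omega>. (R \<omega> ^^ n) x y)" if "y \<in> V" for n y
    using that
  proof (induction n arbitrary: y)
    case 0
    then show ?case by simp
  next
    case (Suc n)
    have "(R \<omega> ^^ Suc n) x y \<longleftrightarrow> (\<exists>z\<in>V. (R \<omega> ^^ n) x z \<and> R \<omega> z y)" for \<omega>
      using adj_V by (auto simp: R_def OO_def)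
    moreover have "Measurable.pred M (\<lambda>\<omega>. \<exists>z\<in>V. (R \<omega> ^^ n) x z \<and> R \<omega> z y)"
      using Suc.IH R by (intro pred_Bex_V pred_intros_logic) auto
    ultimately show ?case by simp
  qed
  then have "Measurable.pred M (\<lambda>\<omega>. \<exists>n. (R \<omega> ^^ n) x y)"
    using assms by (intro pred_intros_countable) auto
  then show ?thesis by (simp add: joined_def R_def rtranclp_power)
qed

lemma pred_tall [measurable]:
  assumes "a \<in> V" shows "Measurable.pred M (\<lambda>\<omega>. tall \<omega> A a)"
  unfolding tall_def
  by (intro pred_intros_countable(1) pred_Bex_V pred_intros_logic pred_joined assms) auto

lemma pred_trifurcation [measurable]:
  assumes "x \<in> V" shows "Measurable.pred M (\<lambda>\<omega>. trifurcation \<omega> x)"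
  unfolding trifurcation_def
  by (intro pred_Bex_V pred_intros_logic pred_joined pred_tall assms subset_refl) auto

lemma pred_good [measurable]:
  assumes "x \<in> V" shows "Measurable.pred M (\<lambda>\<omega>. good n \<omega> x)"
proof -
  have "\<And>a. a \<in> ball n x \<Longrightarrow> a \<in> V" using ball_subset[OF assms] by blast
  then show ?thesis
    unfolding good_def
    by (intro pred_Bex_V pred_intros_logic pred_joined pred_trifurcation assms ball_subset) auto
qed

section \<open>Invariance of the measure under automorphisms\<close>

lemma auto_edge:
  assumes "graph_auto g" "e \<in> E" shows "g ` e \<in> E"
proof -
  obtain x y where "e = {x, y}" "x \<in> V" "y \<in> V" using edgeE[OF assms(2)] by metis
  then show ?thesis using auto_adj[OF assms(1)] assms(2) by simp
qed

lemma auto_edge_inj: "graph_auto g \<Longrightarrow> inj_on (image g) E"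
  by (rule inj_onI) (meson auto_inj edge_subset inj_on_image_eq_iff)

lemma act_measurable: "graph_auto g \<Longrightarrow> act g \<in> measurable M M"
  unfolding bernoulli_percolation_def act_def
  using auto_edge by (intro measurable_restrict measurable_component_singleton) auto

text \<open>\<open>image g\<close> maps the edges injectively to edges, and all coordinates are
  independent with the same law.\<close>

lemma distr_act: assumes "graph_auto g" shows "distr M M (act g) = M"
proof -
  have "distr (Pi\<^sub>M E (\<lambda>_. measure_pmf (bernoulli_pmf p))) (\<Pi>\<^sub>M i\<in>E. measure_pmf (bernoulli_pmf p))
      (\<lambda>\<omega>. \<lambda>n\<in>E. \<omega> (image g n)) = (\<Pi>\<^sub>M i\<in>E. measure_pmf (bernoulli_pmf p))"
    using auto_edge[OF assms] auto_edge_inj[OF assms]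
    by (intro distr_PiM_reindex measure_pmf.prob_space_axioms) auto
  then show ?thesis by (simp add: bernoulli_percolation_def act_def[abs_def])
qed

lemma emeasure_act:
  assumes g: "graph_auto g" and P: "Measurable.pred M P" and eq: "\<And>\<omega>. P (act g \<omega>) \<longleftrightarrow> Q \<omega>"
  shows "emeasure M {\<omega> \<in> space M. Q \<omega>} = emeasure M {\<omega> \<in> space M. P \<omega>}"
proof -
  have "emeasure M {\<omega> \<in> space M. P \<omega>} = emeasure (distr M M (act g)) {\<omega> \<in> space M. P \<omega>}"
    by (simp add: distr_act[OF g])
  also have "\<dots> = emeasure M (act g -` {\<omega> \<in> space M. P \<omega>} \<inter> space M)"
    using P by (intro emeasure_distr act_measurable[OF g]) (simp add: pred_def)
  also have "act g -` {\<omega> \<in> space M. P \<omega>} \<inter> space M = {\<omega> \<in> space M. Q \<omega>}"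
    using eq measurable_space[OF act_measurable[OF g]] by auto
  finally show ?thesis by simp
qed

section \<open>Mass transport for a random rule with at most one receiver per vertex\<close>

context
  fixes Rel :: "('a set \<Rightarrow> bool) \<Rightarrow> 'a \<Rightarrow> 'a \<Rightarrow> bool"
  assumes meas: "\<And>x y. x \<in> V \<Longrightarrow> y \<in> V \<Longrightarrow> Measurable.pred M (\<lambda>\<omega>. Rel \<omega> y x)"
    and equiv: "\<And>g x y \<omega>. graph_auto g \<Longrightarrow> x \<in> V \<Longrightarrow> y \<in> V \<Longrightarrow> Rel (act g \<omega>) y x \<longleftrightarrow> Rel \<omega> (g y) (g x)"
    and uniq: "\<And>\<omega> x x' y. x \<in> V \<Longrightarrow> x' \<in> V \<Longrightarrow> y \<in> V \<Longrightarrow> Rel \<omega> y x \<Longrightarrow> Rel \<omega> y x' \<Longrightarrow> x = x'"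
begin

text \<open>Read \<open>Rel \<omega> y x\<close> as: \<open>y\<close> sends unit mass to
  \<open>x\<close>. The expected tilted mass received equals the expected mass sent, and
  \<open>uniq\<close> caps the latter at 1.\<close>

lemma mass_transport:
  assumes x: "x \<in> V"
  shows "(\<integral>\<^sup>+\<omega>. \<integral>\<^sup>+y. of_bool (Rel \<omega> y x) * ennreal (w y / w x) \<partial>count_space V \<partial>M) \<le> 1"
proof -
  have m1: "(\<lambda>\<omega>. of_bool (Rel \<omega> y x) :: ennreal) \<in> borel_measurable M" if "x \<in> V" "y \<in> V" for x y
    using meas[OF that] by (simp add: of_bool_def)
  define F where "F = (\<lambda>y x. emeasure M {\<omega> \<in> space M. Rel \<omega> y x})"
  have F: "(\<integral>\<^sup>+\<omega>. of_bool (Rel \<omega> y x) \<partial>M) = F y x" if "x \<in> V" "y \<in> V" for x y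
  proof -
    have "(\<integral>\<^sup>+\<omega>. of_bool (Rel \<omega> y x) \<partial>M) = (\<integral>\<^sup>+\<omega>. indicator {\<omega> \<in> space M. Rel \<omega> y x} \<omega> \<partial>M)"
      by (intro nn_integral_cong) (auto simp: indicator_def)
    then show ?thesis using meas[OF that] by (simp add: F_def pred_def)
  qed
  have inv: "F (g y) (g x) = F y x" if "graph_auto g" "y \<in> V" "x \<in> V" for g x y
    unfolding F_def by (rule emeasure_act[OF that(1) meas[OF that(3,2)] equiv[OF that(1,3,2)]])
  have "(\<integral>\<^sup>+\<omega>. \<integral>\<^sup>+y. of_bool (Rel \<omega> y x) * ennreal (w y / w x) \<partial>count_space V \<partial>M)
      = (\<integral>\<^sup>+y. \<integral>\<^sup>+\<omega>. of_bool (Rel \<omega> y x) * ennreal (w y / w x) \<partial>M \<partial>count_space V)"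
    using m1[OF x] by (intro nn_integral_count_space_nn_integral countable_V) auto
  also have "\<dots> = (\<integral>\<^sup>+y. F y x * ennreal (weight_ratio y x) \<partial>count_space V)"
    using m1[OF x] F[OF x] weight_ratio_eq[OF _ x] by (intro nn_integral_cong) (simp add: nn_integral_multc)
  also have "\<dots> = (\<integral>\<^sup>+z. F x z \<partial>count_space V)"
    using inv x by (rule transport)
  also have "\<dots> = (\<integral>\<^sup>+z. \<integral>\<^sup>+\<omega>. of_bool (Rel \<omega> x z) \<partial>M \<partial>count_space V)"
    using F[OF _ x] by (intro nn_integral_cong) simp
  also have "\<dots> = (\<integral>\<^sup>+\<omega>. \<integral>\<^sup>+z. of_bool (Rel \<omega> x z) \<partial>count_space V \<partial>M)"
    using m1[OF _ x] by (intro nn_integral_count_space_nn_integral[symmetric] countable_V) auto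
  also have "\<dots> \<le> (\<integral>\<^sup>+\<omega>. 1 \<partial>M)"
    using uniq[OF _ _ x] by (intro nn_integral_mono) (subst of_bool_Bex_eq_nn_integral[symmetric], auto)
  finally show ?thesis by simp
qed

lemma AE_received_finite:
  assumes x: "x \<in> V"
  shows "AE \<omega> in M. (\<integral>\<^sup>+y. of_bool (Rel \<omega> y x) * ennreal (w y) \<partial>count_space V) < \<infinity>"
proof -
  have m1: "(\<lambda>\<omega>. of_bool (Rel \<omega> y x) :: ennreal) \<in> borel_measurable M" if "y \<in> V" for y
    using meas[OF x that] by (simp add: of_bool_def)
  have "(\<lambda>\<omega>. \<integral>\<^sup>+y. of_bool (Rel \<omega> y x) * ennreal (w y / w x) \<partial>count_space V) \<in> borel_measurable M"
    using m1 by (intro borel_measurable_nn_integral_V) auto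
  then have "AE \<omega> in M. (\<integral>\<^sup>+y. of_bool (Rel \<omega> y x) * ennreal (w y / w x) \<partial>count_space V) \<noteq> \<infinity>"
    using mass_transport[OF x] by (intro nn_integral_PInf_AE) (auto simp: top_unique)
  then show ?thesis
  proof eventually_elim
    case (elim \<omega>)
    have "(\<integral>\<^sup>+y. of_bool (Rel \<omega> y x) * ennreal (w y) \<partial>count_space V)
       = (\<integral>\<^sup>+y. of_bool (Rel \<omega> y x) * ennreal (w y / w x) * ennreal (w x) \<partial>count_space V)"
      using w_pos[OF x] w_pos
      by (intro nn_integral_cong) (simp add: mult.assoc less_imp_le flip: ennreal_mult)
    also have "\<dots> = (\<integral>\<^sup>+y. of_bool (Rel \<omega> y x) * ennreal (w y / w x) \<partial>count_space V) * ennreal (w x)"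
      by (rule nn_integral_multc) simp
    finally show ?case using elim by (simp add: ennreal_mult_less_top less_top)
  qed
qed

text \<open>Markov's inequality: one sender of weight at least \<open>c * w x\<close> already
  contributes \<open>c\<close> to a mass of expectation at most 1.\<close>

lemma emeasure_received:
  assumes x: "x \<in> V" and c: "c > 0" and cw: "\<And>\<omega> y. y \<in> V \<Longrightarrow> Rel \<omega> y x \<Longrightarrow> w y \<ge> c * w x"
  shows "emeasure M {\<omega> \<in> space M. \<exists>y\<in>V. Rel \<omega> y x} \<le> ennreal (1 / c)"
proof -
  have "Measurable.pred M (\<lambda>\<omega>. \<exists>y\<in>V. Rel \<omega> y x)" using meas x by (intro pred_Bex_V) auto
  then have "emeasure M {\<omega> \<in> space M. \<exists>y\<in>V. Rel \<omega> y x}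
      = (\<integral>\<^sup>+\<omega>. indicator {\<omega> \<in> space M. \<exists>y\<in>V. Rel \<omega> y x} \<omega> \<partial>M)"
    by (simp add: pred_def)
  also have "\<dots> \<le> (\<integral>\<^sup>+\<omega>. ennreal (1 / c) * (\<integral>\<^sup>+y. of_bool (Rel \<omega> y x) * ennreal (w y / w x) \<partial>count_space V) \<partial>M)"
  proof (intro nn_integral_mono)
    fix \<omega>
    show "indicator {\<omega> \<in> space M. \<exists>y\<in>V. Rel \<omega> y x} \<omega>
      \<le> ennreal (1 / c) * (\<integral>\<^sup>+y. of_bool (Rel \<omega> y x) * ennreal (w y / w x) \<partial>count_space V)"
    proof (cases "\<exists>y\<in>V. Rel \<omega> y x")
      case True
      then obtain y where y: "y \<in> V" "Rel \<omega> y x" by blast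
      have "c \<le> w y / w x" using cw[OF y] w_pos[OF x] by (simp add: field_simps)
      then have "ennreal c \<le> of_bool (Rel \<omega> y x) * ennreal (w y / w x)" using y by (simp add: ennreal_leI)
      also have "\<dots> = (\<integral>\<^sup>+z. of_bool (Rel \<omega> z x) * ennreal (w z / w x) * indicator {y} z \<partial>count_space V)"
        using y by (subst nn_integral_count_space'[of "{y}"]) auto
      also have "\<dots> \<le> (\<integral>\<^sup>+y. of_bool (Rel \<omega> y x) * ennreal (w y / w x) \<partial>count_space V)"
        by (intro nn_integral_mono) (auto simp: indicator_def)
      finally have "ennreal (1 / c) * ennreal c
        \<le> ennreal (1 / c) * (\<integral>\<^sup>+y. of_bool (Rel \<omega> y x) * ennreal (w y / w x) \<partial>count_space V)"
        by (intro mult_left_mono) auto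
      moreover have "ennreal (1 / c) * ennreal c = 1" using c by (simp flip: ennreal_mult)
      ultimately show ?thesis by (auto simp: indicator_def)
    qed (auto simp: indicator_def)
  qed
  also have "\<dots> \<le> ennreal (1 / c) * (\<integral>\<^sup>+\<omega>. (\<integral>\<^sup>+y. of_bool (Rel \<omega> y x) * ennreal (w y / w x) \<partial>count_space V) \<partial>M)"
  proof -
    have m1: "(\<lambda>\<omega>. of_bool (Rel \<omega> y x) :: ennreal) \<in> borel_measurable M" if "y \<in> V" for y
      using meas[OF x that] by (simp add: of_bool_def)
    show ?thesis
      using m1 by (subst nn_integral_cmult) (auto intro!: borel_measurable_nn_integral_V)
  qed
  also have "\<dots> \<le> ennreal (1 / c) * 1" using mass_transport[OF x] by (intro mult_left_mono) auto
  finally show ?thesis by simp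
qed

end

text \<open>Replacing the state of \<open>e\<close> by an independent coin preserves the measure. By
  Fubini the claim holds for almost every outcome of the coin, and \<open>0 < p < 1\<close> turns
  this into every outcome.\<close>

lemma finite_energy1:
  assumes p: "0 < p" "p < 1" and e: "e \<in> E" and Q: "AE \<omega> in M. Q \<omega>"
  shows "AE \<omega> in M. \<forall>b. Q (fun_upd \<omega> e b)"
proof -
  let ?B = "measure_pmf (bernoulli_pmf p)"
  have "distr (?B \<Otimes>\<^sub>M M) (\<Pi>\<^sub>M i\<in>insert e E. ?B) (\<lambda>(x, X). fun_upd X e x) = (\<Pi>\<^sub>M i\<in>insert e E. ?B)"
    unfolding bernoulli_percolation_def by (rule distr_pair_PiM_eq_PiM) (auto intro: measure_pmf.prob_space_axioms)
  then have d: "distr (?B \<Otimes>\<^sub>M M) M (\<lambda>(x, X). fun_upd X e x) = M"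
    using e by (simp add: bernoulli_percolation_def insert_absorb)
  have ms: "(\<lambda>(x, X). fun_upd X e x) \<in> measurable (?B \<Otimes>\<^sub>M M) M"
  proof -
    have "(\<lambda>(x, X). fun_upd X e x) \<in> measurable (?B \<Otimes>\<^sub>M (\<Pi>\<^sub>M i\<in>E. ?B)) (\<Pi>\<^sub>M i\<in>insert e E. ?B)"
      by measurable
    then show ?thesis using e by (simp add: bernoulli_percolation_def insert_absorb)
  qed
  have "AE \<omega> in distr (?B \<Otimes>\<^sub>M M) M (\<lambda>(x, X). fun_upd X e x). Q \<omega>" using Q by (subst d)
  then have a: "AE z in ?B \<Otimes>\<^sub>M M. Q ((\<lambda>(x, X). fun_upd X e x) z)" by (rule AE_distrD[OF ms])
  interpret P: prob_space M by (rule prob_M)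
  interpret PP: pair_sigma_finite ?B M
    by (intro pair_sigma_finite.intro P.sigma_finite_measure_axioms
        measure_pmf.sigma_finite_measure_axioms)
  have "AE x in ?B. AE X in M. Q (fun_upd X e x)" using PP.AE_pair[OF a] by simp
  then have "\<forall>x. AE X in M. Q (fun_upd X e x)"
    using p by (simp add: AE_measure_pmf_iff set_pmf_bernoulli)
  then have "AE X in M. Q (fun_upd X e True)" "AE X in M. Q (fun_upd X e False)" by auto
  then show ?thesis by eventually_elim (metis (full_types))
qed

text \<open>Insertion and deletion tolerance, used contrapositively: a configuration that can be
  changed on finitely many edges so as to violate an almost sure property belongs to a null set. As
  there are only countably many \<open>J\<close>, one null set serves all modifications.\<close>

lemma finite_energy:
  assumes p: "0 < p" "p < 1" and Q: "AE \<omega> in M. Q \<omega>"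
  shows "AE \<omega> in M. \<forall>J \<omega>'. finite J \<and> J \<subseteq> E \<and> (\<forall>e. e \<notin> J \<longrightarrow> \<omega>' e = \<omega> e) \<longrightarrow> Q \<omega>'"
proof -
  have 1: "AE \<omega> in M. \<forall>\<omega>'. (\<forall>e. e \<notin> J \<longrightarrow> \<omega>' e = \<omega> e) \<longrightarrow> Q \<omega>'" if "finite J" "J \<subseteq> E" for J
    using that
  proof (induction J)
    case empty
    have "\<omega>' = \<omega>" if "\<forall>e. e \<notin> {} \<longrightarrow> \<omega>' e = \<omega> e" for \<omega> \<omega>' :: "'a set \<Rightarrow> bool" using that by auto
    then show ?case using Q by auto
  next
    case (insert e J)
    then have "AE \<omega> in M. \<forall>\<omega>'. (\<forall>e. e \<notin> J \<longrightarrow> \<omega>' e = \<omega> e) \<longrightarrow> Q \<omega>'" by simp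
    from finite_energy1[OF p _ this, of e]
    have "AE \<omega> in M. \<forall>b \<omega>'. (\<forall>f. f \<notin> J \<longrightarrow> \<omega>' f = (fun_upd \<omega> e b) f) \<longrightarrow> Q \<omega>'" using insert by simp
    then show ?case
    proof eventually_elim
      case (elim \<omega>)
      show ?case
      proof (intro allI impI)
        fix \<omega>' assume "\<forall>f. f \<notin> insert e J \<longrightarrow> \<omega>' f = \<omega> f"
        then have "\<forall>f. f \<notin> J \<longrightarrow> \<omega>' f = (fun_upd \<omega> e (\<omega>' e)) f" by auto
        then show "Q \<omega>'" using elim by blast
      qed
    qed
  qed
  have "countable {J. finite J \<and> J \<subseteq> E}" using countable_Collect_finite_subset[OF countable_E] by simp
  then have "AE \<omega> in M. \<forall>J\<in>{J. finite J \<and> J \<subseteq> E}. \<forall>\<omega>'. (\<forall>e. e \<notin> J \<longrightarrow> \<omega>' e = \<omega> e) \<longrightarrow> Q \<omega>'"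
    using 1 by (subst AE_ball_countable) auto
  then show ?thesis by eventually_elim auto
qed

end

end

section \<open>Counting trifurcations and modifying configurations\<close>

text \<open>A nonnegative number is the length of the interval of positive thresholds
  \<open>c\<close> below it, so both sums are integrals over \<open>c\<close> of the cardinalities
  compared in \<open>le\<close>. This turns a plain count at every threshold into a weighted
  one.\<close>

lemma layer_cake_mono:
  fixes u v :: "'b \<Rightarrow> real"
  assumes fin: "finite A" "finite G" and nn: "\<And>x. x \<in> G \<Longrightarrow> u x \<ge> 0" "\<And>x. x \<in> A \<Longrightarrow> v x \<ge> 0"
    and le: "\<And>c. c > 0 \<Longrightarrow> k * card {x \<in> G. c \<le> u x} \<le> card {x \<in> A. c \<le> v x}"
  shows "real k * (\<Sum>x\<in>G. u x) \<le> (\<Sum>x\<in>A. v x)"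
proof -
  have cake: "ennreal (\<Sum>x\<in>B. f x) = (\<integral>\<^sup>+c. of_nat (card {x \<in> B. c \<le> f x}) * indicator {0<..} c \<partial>lborel)"
    if "finite B" "\<And>x. x \<in> B \<Longrightarrow> f x \<ge> 0" for B and f :: "'b \<Rightarrow> real"
  proof -
    have "ennreal (\<Sum>x\<in>B. f x) = (\<Sum>x\<in>B. ennreal (f x))" using that by simp
    also have "\<dots> = (\<Sum>x\<in>B. \<integral>\<^sup>+c. indicator {0<..f x} c \<partial>lborel)"
      using that by (intro sum.cong) simp_all
    also have "\<dots> = (\<integral>\<^sup>+c. (\<Sum>x\<in>B. indicator {0<..f x} c) \<partial>lborel)"
      by (subst nn_integral_sum) auto
    also have "\<dots> = (\<integral>\<^sup>+c. of_nat (card {x \<in> B. c \<le> f x}) * indicator {0<..} c \<partial>lborel)"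
    proof (intro nn_integral_cong)
      fix c :: real
      have "(\<Sum>x\<in>B. indicator {0<..f x} c :: ennreal) = (\<Sum>x\<in>B. of_bool (c \<le> f x)) * indicator {0<..} c"
        by (cases "c > 0") (auto simp: indicator_def of_bool_def intro!: sum.cong)
      also have "(\<Sum>x\<in>B. of_bool (c \<le> f x) :: ennreal) = of_nat (card {x \<in> B. c \<le> f x})"
        using that by (simp add: sum.inter_filter[symmetric] of_bool_def)
      finally show "(\<Sum>x\<in>B. indicator {0<..f x} c :: ennreal)
        = of_nat (card {x \<in> B. c \<le> f x}) * indicator {0<..} c" .
    qed
    finally show ?thesis .
  qed
  have ms: "(\<lambda>c. of_nat (card {x \<in> G. c \<le> u x}) * indicator {0<..} c :: ennreal) \<in> borel_measurable lborel"
  proof -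
    have "(\<lambda>c. of_nat (card {x \<in> G. c \<le> u x}) :: ennreal) = (\<lambda>c. \<Sum>x\<in>G. indicator {..u x} c)"
      using fin by (auto simp: fun_eq_iff sum.inter_filter[symmetric] indicator_def of_bool_def)
    then have "(\<lambda>c. of_nat (card {x \<in> G. c \<le> u x}) :: ennreal) \<in> borel_measurable lborel"
      by simp
    then show ?thesis by (rule borel_measurable_times_ennreal) simp
  qed
  have "ennreal (real k * (\<Sum>x\<in>G. u x)) = of_nat k * ennreal (\<Sum>x\<in>G. u x)"
    using nn by (simp add: ennreal_mult sum_nonneg ennreal_of_nat_eq_real_of_nat)
  also have "\<dots> = (\<integral>\<^sup>+c. of_nat k * (of_nat (card {x \<in> G. c \<le> u x}) * indicator {0<..} c) \<partial>lborel)"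
    using cake[of G u] fin nn ms by (simp add: nn_integral_cmult)
  also have "\<dots> \<le> (\<integral>\<^sup>+c. of_nat (card {x \<in> A. c \<le> v x}) * indicator {0<..} c \<partial>lborel)"
  proof (intro nn_integral_mono)
    fix c :: real
    show "of_nat k * (of_nat (card {x \<in> G. c \<le> u x}) * indicator {0<..} c)
        \<le> (of_nat (card {x \<in> A. c \<le> v x}) * indicator {0<..} c :: ennreal)"
      using le[of c] by (auto simp: indicator_def simp flip: of_nat_mult)
  qed
  also have "\<dots> = ennreal (\<Sum>x\<in>A. v x)" using cake[of A v] fin nn by simp
  finally show ?thesis using nn by (simp add: ennreal_le_iff sum_nonneg)
qed

context rooted_graph
begin

section \<open>The Burton-Keane count in a finite set\<close>

definition three_branches :: "('a set \<Rightarrow> bool) \<Rightarrow> 'a set \<Rightarrow> 'a \<Rightarrow> bool" where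
  "three_branches \<omega> A x \<longleftrightarrow> (\<exists>a\<in>A. \<exists>b\<in>A. \<exists>c\<in>A. a \<noteq> x \<and> b \<noteq> x \<and> c \<noteq> x \<and>
     reach \<omega> x a \<and> reach \<omega> x b \<and> reach \<omega> x c \<and>
     \<not> joined \<omega> {x} a b \<and> \<not> joined \<omega> {x} a c \<and> \<not> joined \<omega> {x} b c)"

text \<open>Some \<open>x \<in> G\<close> has all of \<open>G\<close> in a single one of its branches. Two of its other branches then
  meet \<open>A - G\<close>; removing \<open>x\<close> and a point of \<open>A\<close> in one of them preserves the hypothesis.\<close>

lemma card_three_branches:
  assumes "finite A" "G \<subseteq> A" "\<And>x. x \<in> G \<Longrightarrow> three_branches \<omega> A x"
  shows "2 * card G \<le> card A"
  using assms
proof (induction "card G" arbitrary: G A)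
  case 0
  then show ?case by simp
next
  case (Suc N)
  \<comment> \<open>The points of \<open>G\<close> in the cluster of \<open>x\<close> outside the
    branch of \<open>d\<close>. For a pair minimizing their number there are none.\<close>
  define rest where "rest = (\<lambda>x d. {y \<in> G. y \<noteq> x \<and> reach \<omega> x y \<and> \<not> joined \<omega> {x} d y})"
  have finG: "finite G" using Suc.prems finite_subset by blast
  have fr: "finite (rest x d)" for x d using finG by (simp add: rest_def)
  obtain x0 where x0: "x0 \<in> G" using Suc.hyps(2) by fastforce
  then obtain d0 where "d0 \<in> A" "d0 \<noteq> x0" using Suc.prems(3) unfolding three_branches_def by blast
  then have "\<exists>p. fst p \<in> G \<and> snd p \<in> A \<and> snd p \<noteq> fst p" using x0 by (intro exI[of _ "(x0, d0)"]) simp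
  then obtain p where p: "fst p \<in> G \<and> snd p \<in> A \<and> snd p \<noteq> fst p"
    and pmin: "\<And>q. fst q \<in> G \<and> snd q \<in> A \<and> snd q \<noteq> fst q \<Longrightarrow>
      card (rest (fst p) (snd p)) \<le> card (rest (fst q) (snd q))"
    using ex_has_least_nat[of "\<lambda>p. fst p \<in> G \<and> snd p \<in> A \<and> snd p \<noteq> fst p" _
        "\<lambda>p. card (rest (fst p) (snd p))"] by blast
  define x d where "x = fst p" and "d = snd p"
  have x: "x \<in> G" "x \<in> A" and d: "d \<in> A" "d \<noteq> x" using p Suc.prems by (auto simp: x_def d_def)
  have empty: "rest x d = {}"
  proof (rule ccontr)
    assume "rest x d \<noteq> {}"
    then obtain y where y: "y \<in> rest x d" by blast
    then have y': "y \<in> G" "y \<noteq> x" "reach \<omega> x y" "\<not> joined \<omega> {x} d y" by (auto simp: rest_def)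
    \<comment> \<open>The branches at \<open>y\<close> that do not contain \<open>x\<close> all lie
      in the branch of \<open>y\<close> at \<open>x\<close>, which is not that of \<open>d\<close>.
      Since \<open>y\<close> itself drops out, the inclusion is strict, against minimality.\<close>
    have "rest y x \<subseteq> rest x d"
    proof
      fix z assume "z \<in> rest y x"
      then have z: "z \<in> G" "z \<noteq> y" "reach \<omega> y z" "\<not> joined \<omega> {y} x z" by (auto simp: rest_def)
      have zx: "z \<noteq> x" using z(4) by auto
      have "joined \<omega> {x} z y"
        using joined_first[OF joined_sym[OF z(3)], of x] y'(2) zx z(2,4) joined_sym by blast
      then have "\<not> joined \<omega> {x} d z" using y'(4) joined_trans by blast
      then show "z \<in> rest x d" using z zx joined_trans[OF y'(3) z(3)] by (simp add: rest_def)
    qed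
    moreover have "y \<notin> rest y x" by (simp add: rest_def)
    ultimately have "rest y x \<subset> rest x d" using y by blast
    then have "card (rest y x) < card (rest x d)" using fr by (rule psubset_card_mono[rotated])
    moreover have "card (rest x d) \<le> card (rest y x)"
      using pmin[of "(y, x)"] y' x by (simp add: x_def d_def)
    ultimately show False by simp
  qed
  obtain a b c where abc: "a \<in> A" "b \<in> A" "c \<in> A" "a \<noteq> x" "b \<noteq> x" "c \<noteq> x"
     "reach \<omega> x a" "reach \<omega> x b" "reach \<omega> x c"
     "\<not> joined \<omega> {x} a b" "\<not> joined \<omega> {x} a c" "\<not> joined \<omega> {x} b c"
    using Suc.prems(3)[OF x(1)] unfolding three_branches_def by blast
  have "\<exists>a1 a2. a1 \<in> A \<and> a2 \<in> A \<and> a1 \<noteq> x \<and> a2 \<noteq> x \<and> reach \<omega> x a1 \<and> reach \<omega> x a2 \<and>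
      \<not> joined \<omega> {x} a1 a2 \<and> \<not> joined \<omega> {x} d a1 \<and> \<not> joined \<omega> {x} d a2"
  proof -
    \<comment> \<open>The three branches are distinct, so \<open>d\<close> lies in at most one of
      them.\<close>
    consider "\<not> joined \<omega> {x} d a" "\<not> joined \<omega> {x} d b" | "\<not> joined \<omega> {x} d a" "\<not> joined \<omega> {x} d c"
      | "\<not> joined \<omega> {x} d b" "\<not> joined \<omega> {x} d c"
      using abc(10-12) joined_trans joined_sym by metis
    then show ?thesis by cases (use abc in blast)+
  qed
  then obtain a1 a2 where a12: "a1 \<in> A" "a2 \<in> A" "a1 \<noteq> x" "a2 \<noteq> x" "reach \<omega> x a1" "reach \<omega> x a2"
      "\<not> joined \<omega> {x} a1 a2" "\<not> joined \<omega> {x} d a1" "\<not> joined \<omega> {x} d a2" by blast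
  have notG: "a1 \<notin> G" "a2 \<notin> G" using empty a12 unfolding rest_def by auto
  have ne: "a1 \<noteq> a2" using a12(7) by auto
  \<comment> \<open>Two points of \<open>A\<close> are given up for one point of \<open>G\<close>,
    whence the factor 2. Representatives equal to \<open>x\<close> or \<open>a1\<close> are
    redirected to \<open>a2\<close>: from any other \<open>y\<close> of \<open>G\<close> in this
    cluster, which must lie in the branch of \<open>d\<close>, all three are in the same
    branch.\<close>
  define A' G' where "A' = A - {x, a1}" and "G' = G - {x}"
  define f where "f = (\<lambda>u. if u \<in> {x, a1} then a2 else u)"
  have f: "f u \<in> A' \<and> f u \<noteq> y \<and> reach \<omega> y (f u) \<and> joined \<omega> {y} u (f u)"
    if y: "y \<in> G'" and u: "u \<in> A" "u \<noteq> y" "reach \<omega> y u" for y u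
  proof (cases "u \<in> {x, a1}")
    case False
    then show ?thesis using u by (auto simp: f_def A'_def)
  next
    case True
    have yG: "y \<in> G" "y \<noteq> x" using y by (auto simp: G'_def)
    have yx: "reach \<omega> y x" using True u(3) a12(5) joined_sym joined_trans by blast
    then have "joined \<omega> {x} d y" using empty yG joined_sym unfolding rest_def by blast
    then have n: "\<not> joined \<omega> {x} a1 y" "\<not> joined \<omega> {x} a2 y"
      using a12 joined_sym joined_trans by blast+
    have ny: "a1 \<noteq> y" "a2 \<noteq> y" using notG yG by auto
    have r: "reach \<omega> a1 y" "reach \<omega> a2 y" using a12(5,6) yx joined_sym joined_trans by blast+
    have "joined \<omega> {y} a1 x" "joined \<omega> {y} a2 x"
      using joined_first[OF r(1), of x] joined_first[OF r(2), of x] n ny a12(3,4) yG by auto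
    then have "joined \<omega> {y} u a2" using True joined_sym joined_trans by blast
    then show ?thesis using True ny ne a12 r joined_sym by (auto simp: f_def A'_def)
  qed
  have "three_branches \<omega> A' y" if y: "y \<in> G'" for y
  proof -
    obtain a b c where abc: "a \<in> A" "b \<in> A" "c \<in> A" "a \<noteq> y" "b \<noteq> y" "c \<noteq> y"
       "reach \<omega> y a" "reach \<omega> y b" "reach \<omega> y c"
       "\<not> joined \<omega> {y} a b" "\<not> joined \<omega> {y} a c" "\<not> joined \<omega> {y} b c"
      using Suc.prems(3)[of y] y unfolding three_branches_def G'_def by blast
    note fa = f[OF y abc(1,4,7)] and fb = f[OF y abc(2,5,8)] and fc = f[OF y abc(3,6,9)]
    have "\<not> joined \<omega> {y} (f a) (f b)" "\<not> joined \<omega> {y} (f a) (f c)" "\<not> joined \<omega> {y} (f b) (f c)"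
      using abc(10-12) fa fb fc joined_sym joined_trans by meson+
    then show ?thesis unfolding three_branches_def using fa fb fc by blast
  qed
  moreover have "G' \<subseteq> A'" using Suc.prems notG by (auto simp: A'_def G'_def)
  moreover have "N = card G'" using Suc.hyps(2) x finG by (simp add: G'_def)
  ultimately have "2 * card G' \<le> card A'" using Suc.hyps(1)[of G' A'] Suc.prems(1) by (simp add: A'_def)
  moreover have "card A = card A' + 2"
    using Suc.prems(1) x a12 card_Diff_subset[of "{x, a1}" A] card_mono[of A "{x, a1}"]
    by (simp add: A'_def)
  moreover have "card G = card G' + 1" using Suc.hyps(2) \<open>N = card G'\<close> by simp
  ultimately show ?case by simp
qed

text \<open>At a threshold \<open>c\<close>, the points of \<open>G\<close> with
  \<open>c \<le> 3/4 * w x\<close> find all their representatives among the points of weight at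
  least \<open>c\<close>, so the plain count applies there. Integration over \<open>c\<close> gives
  the constant \<open>2 * 3/4\<close>.\<close>

lemma weighted_three_branches:
  assumes "finite A" "A \<subseteq> V" "G \<subseteq> A"
    and "\<And>x. x \<in> G \<Longrightarrow> three_branches \<omega> {a \<in> A. w a \<ge> 3/4 * w x} x"
  shows "3/2 * (\<Sum>x\<in>G. w x) \<le> (\<Sum>x\<in>A. w x)"
proof -
  have fin: "finite G" using assms finite_subset by blast
  have pos: "w x > 0" if "x \<in> A" for x using w_pos assms that by blast
  have "real 2 * (\<Sum>x\<in>G. 3/4 * w x) \<le> (\<Sum>x\<in>A. w x)"
  proof (rule layer_cake_mono[OF assms(1) fin])
    fix c :: real assume c: "c > 0"
    show "2 * card {x \<in> G. c \<le> 3/4 * w x} \<le> card {x \<in> A. c \<le> w x}"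
    proof (rule card_three_branches[of _ _ \<omega>])
      show "finite {x \<in> A. c \<le> w x}" using assms by simp
      show "{x \<in> G. c \<le> 3/4 * w x} \<subseteq> {x \<in> A. c \<le> w x}" using assms(3) pos by force
      fix x assume x: "x \<in> {x \<in> G. c \<le> 3/4 * w x}"
      then have "{a \<in> A. w a \<ge> 3/4 * w x} \<subseteq> {x \<in> A. c \<le> w x}" by auto
      moreover have "three_branches \<omega> {a \<in> A. w a \<ge> 3/4 * w x} x" using assms(4) x by blast
      ultimately show "three_branches \<omega> {x \<in> A. c \<le> w x} x"
        unfolding three_branches_def by blast
    qed
  qed (use pos assms(3) in \<open>auto simp: less_imp_le subset_iff\<close>)
  then show ?thesis by (simp add: sum_distrib_left)
qed

section \<open>Finite modifications of a configuration\<close>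

definition infinite_mass :: "('a set \<Rightarrow> bool) \<Rightarrow> 'a \<Rightarrow> bool" where
  "infinite_mass \<omega> a \<longleftrightarrow> (\<integral>\<^sup>+y. of_bool (reach \<omega> y a) * ennreal (w y) \<partial>count_space V) = \<infinity>"

text \<open>The inequality is strict, so a cluster has at most one peak and all its vertices can
  agree on it as their receiver.\<close>

definition peak :: "('a set \<Rightarrow> bool) \<Rightarrow> 'a \<Rightarrow> bool" where
  "peak \<omega> x \<longleftrightarrow> (\<forall>z\<in>V. reach \<omega> x z \<and> z \<noteq> x \<longrightarrow> w z < w x)"

text \<open>Attach to a heavy cluster of bounded weight a path leading above all its weights.\<close>

lemma heavy_bounded_modification:
  assumes unb: "\<exists>y\<in>V. w y > c" and a: "a \<in> V" "infinite_mass \<omega> a"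
    and c: "\<And>y. y \<in> V \<Longrightarrow> reach \<omega> a y \<Longrightarrow> w y \<le> c"
  shows "\<exists>J \<omega>' x. finite J \<and> J \<subseteq> E \<and> (\<forall>e. e \<notin> J \<longrightarrow> \<omega>' e = \<omega> e) \<and> x \<in> V \<and> peak \<omega>' x \<and> infinite_mass \<omega>' x"
proof -
  obtain y where y: "y \<in> V" "w y > c" using unb by blast
  have "(\<lambda>x y. {x, y} \<in> E)\<^sup>*\<^sup>* a y" using graph_connected[OF a(1) y(1)] by (simp add: reachable_def)
  then obtain k f where kf: "f 0 = a" "f k = y" "\<forall>i<k. adj (f i) (f (Suc i))"
    by (auto simp: rtranclp_power relpowp_fun_conv)
  \<comment> \<open>The first vertex of the path above \<open>c\<close>: the earlier ones, like the
    cluster of \<open>a\<close>, have weight at most \<open>c\<close>, so this one becomes a strict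
    maximum.\<close>
  define n where "n = (LEAST i. w (f i) > c)"
  have fn: "w (f n) > c" unfolding n_def by (rule LeastI[of _ k]) (simp add: kf y)
  have nk: "n \<le> k" unfolding n_def by (rule Least_le) (simp add: kf y)
  have low: "w (f i) \<le> c" if "i < n" for i using not_less_Least[of i "\<lambda>i. w (f i) > c"] that by (simp add: n_def)
  have edge: "adj (f i) (f (Suc i))" if "i < n" for i using kf that nk by simp
  have fV: "f i \<in> V" if "i \<le> n" for i
    using that edge[of "i - 1"] adj_V kf a by (cases i) auto
  define P where "P = f ` {..n}"
  define C where "C = {z \<in> V. reach \<omega> a z}"
  define J where "J = {e \<in> E. e \<inter> P \<noteq> {}}"
  \<comment> \<open>Along the path only the path itself and the open edges inside the cluster of
    \<open>a\<close> survive. Closing the others keeps foreign clusters, whose weights are not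
    controlled, from being attached.\<close>
  define \<omega>' where "\<omega>' = (\<lambda>e. if e \<in> J then e \<subseteq> C \<and> \<omega> e \<or> (\<exists>i<n. e = {f i, f (Suc i)}) else \<omega> e)"
  have "J = (\<Union>x\<in>P. {e \<in> E. x \<in> e})" by (auto simp: J_def)
  then have J: "finite J" "J \<subseteq> E" using locally_finite fV by (auto simp: P_def)
  have sub: "z \<in> C \<union> P" if "reach \<omega>' a z" for z
    using that
  proof (induction rule: joined_induct)
    case base
    then show ?case using a by (simp add: C_def)
  next
    case (step y z)
    show ?case
    proof (cases "{y, z} \<in> J")
      case True
      then consider "{y, z} \<subseteq> C" | i where "i < n" "{y, z} = {f i, f (Suc i)}"
        using step(3) by (auto simp: \<omega>'_def)
      then show ?thesis
      proof cases
        case 2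
        then have "z \<in> {f i, f (Suc i)}" by blast
        then show ?thesis using 2(1) by (auto simp: P_def)
      qed simp
    next
      case False
      then have "y \<notin> P" "\<omega> {y, z}" using step by (auto simp: J_def \<omega>'_def)
      then have "reach \<omega> a y" using step.IH by (simp add: C_def)
      then have "reach \<omega> a z" using joined_trans joined_step[of y z \<omega> "{}"] step(2) \<open>\<omega> {y, z}\<close> by blast
      then show ?thesis using adj_V step(2) by (simp add: C_def)
    qed
  qed
  have sup: "reach \<omega>' a z" if "reach \<omega> a z" for z
    using that
  proof (induction rule: joined_induct)
    case (step y z)
    have "reach \<omega> a z" using joined_trans[OF step(1)] joined_step[of y z \<omega> "{}"] step by simp
    then have "{y, z} \<subseteq> C" using step adj_V by (auto simp: C_def)
    then have "\<omega>' {y, z}" using step by (simp add: \<omega>'_def)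
    then show ?case using joined_trans[OF step.IH] joined_step[of y z \<omega>' "{}"] step by simp
  qed simp
  have reach_f: "reach \<omega>' a (f i)" if "i \<le> n" for i
    using that
  proof (induction i)
    case (Suc i)
    then have "adj (f i) (f (Suc i))" using edge by simp
    moreover from this have "{f i, f (Suc i)} \<in> J" using Suc by (auto simp: J_def P_def)
    then have "\<omega>' {f i, f (Suc i)}" using Suc.prems unfolding \<omega>'_def by (auto simp: Suc_le_eq)
    ultimately show ?case using Suc joined_trans[of \<omega>' "{}" a "f i"] joined_step[of "f i" "f (Suc i)" \<omega>' "{}"] by simp
  qed (simp add: kf)
  have "peak \<omega>' (f n)"
    unfolding peak_def
  proof (intro ballI impI)
    fix z assume z: "z \<in> V" "reach \<omega>' (f n) z \<and> z \<noteq> f n"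
    then have "z \<in> C \<union> P" using sub joined_trans[OF reach_f[of n]] by simp
    then have "w z \<le> c"
    proof
      assume "z \<in> C" then show ?thesis using c by (simp add: C_def)
    next
      assume "z \<in> P"
      then obtain i where "i \<le> n" "z = f i" by (auto simp: P_def)
      then show ?thesis using low[of i] z by (cases "i = n") auto
    qed
    then show "w z < w (f n)" using fn by linarith
  qed
  moreover have "infinite_mass \<omega>' (f n)"
  proof -
    have r: "reach \<omega>' y (f n)" if "reach \<omega> y a" for y
      using sup[OF joined_sym[OF that]] reach_f[of n] joined_sym joined_trans by blast
    have "(\<integral>\<^sup>+y. of_bool (reach \<omega> y a) * ennreal (w y) \<partial>count_space V)
       \<le> (\<integral>\<^sup>+y. of_bool (reach \<omega>' y (f n)) * ennreal (w y) \<partial>count_space V)"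
      using r by (intro nn_integral_mono mult_right_mono) auto
    then show ?thesis using a by (simp add: infinite_mass_def top_unique)
  qed
  ultimately show ?thesis using J fV[of n] by (intro exI[of _ J] exI[of _ \<omega>'] exI[of _ "f n"]) (auto simp: \<omega>'_def)
qed

text \<open>Outside the finite set \<open>W\<close> the cluster of \<open>a\<close> is covered by
  the pieces behind finitely many open edges leaving \<open>W\<close>. If all of these had bounded
  weights, so would the whole cluster.\<close>

lemma tall_split:
  assumes W: "finite W" "W \<subseteq> V" "a \<in> W" and tall: "tall \<omega> {} a"
  shows "\<exists>d u. d \<in> V - W \<and> u \<in> W \<and> adj u d \<and> \<omega> {u, d} \<and> reach \<omega> a d \<and> tall \<omega> W d"
proof (rule ccontr)
  assume contra: "\<not> ?thesis"
  define N where "N = {d. d \<notin> W \<and> (\<exists>u\<in>W. adj u d \<and> \<omega> {u, d} \<and> reach \<omega> a u)}"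
  have "N \<subseteq> (\<Union>u\<in>W. {d. adj u d})" by (auto simp: N_def)
  then have finN: "finite N" using finite_neighbours W finite_subset by blast
  have N: "\<exists>n::nat. \<forall>b\<in>V. joined \<omega> W d b \<longrightarrow> w b < real n" if d: "d \<in> N" for d
  proof -
    obtain u where u: "u \<in> W" "adj u d" "\<omega> {u, d}" "reach \<omega> a u" "d \<notin> W" using d by (auto simp: N_def)
    then have "reach \<omega> a d" using joined_trans joined_step[of u d \<omega> "{}"] by blast
    then have "\<not> tall \<omega> W d" using contra u adj_V(2) by blast
    then show ?thesis by (auto simp: tall_def not_le)
  qed
  then obtain nd :: "'a \<Rightarrow> nat" where nd: "\<And>d b. d \<in> N \<Longrightarrow> b \<in> V \<Longrightarrow> joined \<omega> W d b \<Longrightarrow> w b < real (nd d)"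
    by metis
  have cover: "b \<in> W \<or> (\<exists>d\<in>N. joined \<omega> W d b)" if "reach \<omega> a b" for b
    using that
  proof (induction rule: joined_induct)
    case (step y z)
    show ?case
    proof (cases "z \<in> W")
      case False
      show ?thesis
      proof (cases "y \<in> W")
        case True
        then have "z \<in> N" using step False by (auto simp: N_def)
        then show ?thesis by blast
      next
        case y: False
        then obtain d where "d \<in> N" "joined \<omega> W d y" using step.IH by blast
        moreover have "joined \<omega> W y z" using step y False by (intro joined_step) auto
        ultimately show ?thesis using joined_trans by blast
      qed
    qed simp
  qed (use W in simp)
  \<comment> \<open>A crude common bound: a sum of nonnegative terms dominates each of them, also
    when there are no pieces at all.\<close>
  define B where "B = (\<Sum>d\<in>N. real (nd d)) + (\<Sum>b\<in>W. w b) + 1"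
  obtain n :: nat where n: "real n \<ge> B" using real_arch_simple by blast
  obtain b where b: "b \<in> V" "reach \<omega> a b" "w b \<ge> real n" using tall unfolding tall_def by blast
  have nn: "(\<Sum>d\<in>N. real (nd d)) \<ge> 0" "(\<Sum>b\<in>W. w b) \<ge> 0"
    using w_pos W by (auto intro!: sum_nonneg simp: less_imp_le subset_iff)
  from cover[OF b(2)] have "w b < B"
  proof
    assume "b \<in> W"
    then have "w b \<le> (\<Sum>b\<in>W. w b)" using W w_pos by (intro member_le_sum) (auto simp: less_imp_le subset_iff)
    then show ?thesis using nn by (simp add: B_def)
  next
    assume "\<exists>d\<in>N. joined \<omega> W d b"
    then obtain d where d: "d \<in> N" "joined \<omega> W d b" by blast
    have "real (nd d) \<le> (\<Sum>d\<in>N. real (nd d))" using d finN by (intro member_le_sum) auto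
    then show ?thesis using nd[OF d(1) b(1) d(2)] nn by (simp add: B_def)
  qed
  then show False using b n by linarith
qed

section \<open>Joining three clusters by a tripod\<close>

lemma relpowp_sym: "symp R \<Longrightarrow> (R ^^ n) x y \<Longrightarrow> (R ^^ n) y x"
proof (induction n arbitrary: y)
  case (Suc n)
  then obtain z where "(R ^^ n) x z" "R z y" by (auto elim: relpowp_Suc_E)
  then show ?case using Suc by (intro relpowp_Suc_I2[of R y z]) (auto dest: sympD)
qed simp

lemma relpowp_trans: "(R ^^ i) x y \<Longrightarrow> (R ^^ j) y z \<Longrightarrow> (R ^^ (i + j)) x z"
  by (auto simp: relpowp_add)

lemma relpowp_segment:
  assumes "\<And>k. k < n \<Longrightarrow> R (f k) (f (Suc k))" "i \<le> j" "j \<le> n"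
  shows "(R ^^ (j - i)) (f i) (f j)"
  unfolding relpowp_fun_conv using assms by (intro exI[of _ "\<lambda>k. f (i + k)"]) auto

text \<open>Choose the three walks with minimal total length: a common later vertex would be a better start.\<close>

lemma tripod_exists:
  fixes u :: "nat \<Rightarrow> 'a"
  assumes R: "symp R" and x0: "x0 \<in> W" "\<And>i. i < 3 \<Longrightarrow> R\<^sup>*\<^sup>* x0 (u i)"
    and RW: "\<And>a b. R a b \<Longrightarrow> b \<in> W"
  shows "\<exists>x\<in>W. \<exists>n f. (\<forall>i<3. f i 0 = x \<and> f i (n i) = u i \<and> (\<forall>k<n i. R (f i k) (f i (Suc k)))) \<and>
    (\<forall>i<3. \<forall>j<3. i \<noteq> j \<longrightarrow> (\<forall>s\<le>n i. \<forall>t\<le>n j. f i s = f j t \<longrightarrow> s = (0::nat) \<and> t = (0::nat)))"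
proof -
  define P where "P = (\<lambda>p. fst p \<in> W \<and> (\<forall>i<3. (R ^^ (snd p i)) (fst p) (u i)))"
  have "\<forall>i. \<exists>n. i < 3 \<longrightarrow> (R ^^ n) x0 (u i)" using x0(2) by (auto simp: rtranclp_power)
  then obtain n0 where "\<forall>i<3. (R ^^ (n0 i)) x0 (u i)" by metis
  then have "P (x0, n0)" using x0 by (simp add: P_def)
  then obtain p where p: "P p" and pmin: "\<And>q. P q \<Longrightarrow> (\<Sum>i<3. snd p i) \<le> (\<Sum>i<3. snd q i)"
    using ex_has_least_nat[of P _ "\<lambda>p. \<Sum>i<3. snd p i"] by blast
  define x n where "x = fst p" and "n = snd p"
  have x: "x \<in> W" and "\<forall>i<3. (R ^^ (n i)) x (u i)" using p by (auto simp: P_def x_def n_def)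
  then have "\<forall>i. \<exists>g. i < 3 \<longrightarrow> g 0 = x \<and> g (n i) = u i \<and> (\<forall>k<n i. R (g k) (g (Suc k)))"
    unfolding relpowp_fun_conv by blast
  then obtain f where f: "\<forall>i<3. f i 0 = x \<and> f i (n i) = u i \<and> (\<forall>k<n i. R (f i k) (f i (Suc k)))"
    by metis
  have "s = 0 \<and> t = 0" if ij: "i < 3" "j < 3" "i \<noteq> j" and st: "s \<le> n i" "t \<le> n j" "f i s = f j t" for i j s t
  proof -
    have seg: "(R ^^ (b - a)) (f l a) (f l b)" if "l < 3" "a \<le> b" "b \<le> n l" for l a b
      using f that by (intro relpowp_segment[of "n l"]) auto
    define v where "v = f i s"
    have vi: "(R ^^ (n i - s)) v (u i)" using seg[of i s "n i"] ij st f by (simp add: v_def)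
    have vj: "(R ^^ (n j - t)) v (u j)" using seg[of j t "n j"] ij st f by (simp add: v_def)
    have xv: "(R ^^ s) x v" "(R ^^ t) x v" using seg[of i 0 s] seg[of j 0 t] ij st f by (simp_all add: v_def)
    then have "(R ^^ (min s t)) v x" using relpowp_sym[OF R] by (simp add: min_def)
    \<comment> \<open>Return from \<open>v\<close> to \<open>x\<close> along the shorter initial
      piece and go on from there: the remaining leg grows by only \<open>min s t\<close>.\<close>
    then have vl: "(R ^^ (min s t + n l)) v (u l)" if "l < 3" for l
      using relpowp_trans[of "min s t" R v x "n l" "u l"] that \<open>\<forall>i<3. (R ^^ (n i)) x (u i)\<close> by blast
    have vW: "v \<in> W" using xv(1) x RW by (cases s) (auto elim: relpowp_Suc_E)
    define n' where "n' = (\<lambda>l. if l = i then n i - s else if l = j then n j - t else min s t + n l)"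
    have "P (v, n')" unfolding P_def using vi vj vl vW by (auto simp: n'_def)
    then have le: "(\<Sum>l<3. n l) \<le> (\<Sum>l<3. n' l)" using pmin[of "(v, n')"] by (simp add: n_def)
    define k where "k = 3 - i - j"
    have k: "{..<3} = {i, j, k}" "k \<noteq> i" "k \<noteq> j" 
    proof -
      have "i = 0 \<or> i = 1 \<or> i = 2" "j = 0 \<or> j = 1 \<or> j = 2" using ij by auto
      then show "{..<3} = {i, j, k}" "k \<noteq> i" "k \<noteq> j"
        using ij(3) by (auto simp: k_def)
    qed
    \<comment> \<open>Minimality amounts to \<open>s + t \<le> min s t\<close>, so both
      vanish.\<close>
    have "n i + n j + n k \<le> (n i - s) + (n j - t) + (min s t + n k)"
      using le k ij by (simp add: n'_def)
    then show ?thesis using st by (auto simp: min_def split: if_splits)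
  qed
  then show ?thesis using x f by (intro bexI[of _ x] exI[of _ n] exI[of _ f]) auto
qed

text \<open>In a ball \<open>W\<close> meeting all three clusters, every edge that touches
  \<open>W\<close> is closed, except for three legs that share only their hub and for one exit edge
  at the end of each leg. Behind each exit an unbounded piece outside \<open>W\<close> is left as it
  was.\<close>

lemma tripod_modification:
  fixes a :: "nat \<Rightarrow> 'a"
  assumes aV: "\<And>i. i < 3 \<Longrightarrow> a i \<in> V" and at: "\<And>i. i < 3 \<Longrightarrow> tall \<omega> {} (a i)"
    and sep: "\<And>i j. i < 3 \<Longrightarrow> j < 3 \<Longrightarrow> i \<noteq> j \<Longrightarrow> \<not> reach \<omega> (a i) (a j)"
  shows "\<exists>J \<omega>' x. finite J \<and> J \<subseteq> E \<and> (\<forall>e. e \<notin> J \<longrightarrow> \<omega>' e = \<omega> e) \<and> x \<in> V \<and> trifurcation \<omega>' x"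
proof -
  define a0 where "a0 = a 0"
  have a0: "a0 \<in> V" using aV by (simp add: a0_def)
  have "\<forall>i. \<exists>N. i < 3 \<longrightarrow> a i \<in> ball N a0" using ex_ball[OF a0] aV by blast
  then obtain Ns where Ns: "\<And>i. i < 3 \<Longrightarrow> a i \<in> ball (Ns i) a0" by metis
  define N where "N = (\<Sum>i<3. Ns i)"
  define W where "W = ball N a0"
  have W: "finite W" "W \<subseteq> V" "a0 \<in> W" using finite_ball ball_subset[OF a0] ball_self by (auto simp: W_def)
  have aW: "a i \<in> W" if "i < 3" for i
  proof -
    have "Ns i \<le> N" unfolding N_def using that by (intro member_le_sum) auto
    then show ?thesis using ball_mono Ns[OF that] by (auto simp: W_def)
  qed
  have "\<forall>i. \<exists>d u. i < 3 \<longrightarrow> d \<in> V - W \<and> u \<in> W \<and> adj u d \<and> \<omega> {u, d} \<and> reach \<omega> (a i) d \<and> tall \<omega> W d"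
    using tall_split[OF W(1,2) aW at] by blast
  then obtain d u where du: "\<And>i. i < 3 \<Longrightarrow> d i \<in> V - W \<and> u i \<in> W \<and> adj (u i) (d i) \<and>
      reach \<omega> (a i) (d i) \<and> tall \<omega> W (d i)" by metis
  have dsep: "\<not> joined \<omega> W (d i) (d j)" if "i < 3" "j < 3" "i \<noteq> j" for i j
  proof
    assume "joined \<omega> W (d i) (d j)"
    then have "reach \<omega> (d i) (d j)" by (rule joined_anti) simp
    then show False using sep[OF that] du[OF that(1)] du[OF that(2)] joined_trans joined_sym by meson
  qed
  define R where "R = (\<lambda>x y. adj x y \<and> x \<in> W \<and> y \<in> W)"
  have symR: "symp R" by (auto simp: symp_def R_def insert_commute)
  have conn: "R\<^sup>*\<^sup>* a0 z" if "z \<in> ball k a0" "k \<le> N" for k z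
    using that
  proof (induction k arbitrary: z)
    case (Suc k)
    show ?case
    proof (cases "z \<in> ball k a0")
      case False
      then obtain y where y: "y \<in> ball k a0" "adj y z" using Suc.prems by auto
      have "y \<in> W" "z \<in> W" using y(1) Suc.prems ball_mono[of k N a0] ball_mono[of "Suc k" N a0]
        unfolding W_def by (auto simp del: ball.simps)
      then have "R y z" using y by (simp add: R_def)
      then show ?thesis using Suc.IH[OF y(1)] Suc.prems by auto
    qed (use Suc in auto)
  qed simp
  have conn': "R\<^sup>*\<^sup>* a0 (u i)" if "i < 3" for i using conn[of "u i" N] du[OF that] by (simp add: W_def)
  have RW: "b \<in> W" if "R a b" for a b using that by (simp add: R_def)
  have "\<exists>x\<in>W. \<exists>n f. (\<forall>i<3. f i 0 = x \<and> f i (n i) = u i \<and> (\<forall>k<n i. R (f i k) (f i (Suc k)))) \<and>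
    (\<forall>i<3. \<forall>j<3. i \<noteq> j \<longrightarrow> (\<forall>s\<le>n i. \<forall>t\<le>n j. f i s = f j t \<longrightarrow> s = (0::nat) \<and> t = (0::nat)))"
    using symR W(3) conn' RW by (rule tripod_exists)
  then obtain x n f where x: "x \<in> W"
    and f0: "\<forall>i<3. f i 0 = x \<and> f i (n i) = u i \<and> (\<forall>k<n i. R (f i k) (f i (Suc k)))"
    and disj0: "\<forall>i<3. \<forall>j<3. i \<noteq> j \<longrightarrow> (\<forall>s\<le>n i. \<forall>t\<le>n j. f i s = f j t \<longrightarrow> s = (0::nat) \<and> t = (0::nat))"
    by (elim bexE exE conjE)
  have f: "f i 0 = x \<and> f i (n i) = u i \<and> (\<forall>k<n i. R (f i k) (f i (Suc k)))" if "i < 3" for i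
    using f0 that by simp
  have disj: "\<And>i j s t. i < 3 \<Longrightarrow> j < 3 \<Longrightarrow> i \<noteq> j \<Longrightarrow> s \<le> n i \<Longrightarrow> t \<le> n j \<Longrightarrow> f i s = f j t \<Longrightarrow> s = 0 \<and> t = 0"
    using disj0 by simp
  define J where "J = {e \<in> E. e \<inter> W \<noteq> {}}"
  have "J = (\<Union>x\<in>W. {e \<in> E. x \<in> e})" by (auto simp: J_def)
  then have J: "finite J" "J \<subseteq> E" using locally_finite W by auto
  define \<omega>' where "\<omega>' = (\<lambda>e. if e \<in> J then \<exists>i<3. e = {u i, d i} \<or> (\<exists>k<n i. e = {f i k, f i (Suc k)}) else \<omega> e)"
  \<comment> \<open>A leg and the piece behind its exit. The indices start at 1 to leave out the
    hub, and there are none if \<open>n i = 0\<close>, that is, if the exit starts at the hub. No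
    open step that ends away from \<open>x\<close> leaves an arm, so the arms are separate branches
    at \<open>x\<close>.\<close>
  define Arm where "Arm = (\<lambda>i. f i ` {1..n i} \<union> {z. joined \<omega> W (d i) z})"
  have fW: "f i k \<in> W" if "i < 3" "k \<le> n i" for i k
    using f[OF that(1)] that(2) x by (cases k) (auto simp: R_def)
  have notW: "z \<notin> W" if "i < 3" "joined \<omega> W (d i) z" for i z
    using joined_notin[OF that(2)] du[OF that(1)] by simp
  have armW: "\<exists>l\<ge>1. l \<le> n i \<and> y = f i l" if "i < 3" "y \<in> Arm i" "y \<in> W" for i y
    using that notW unfolding Arm_def by auto
  have arm_step: "z \<in> Arm i" if i: "i < 3" and y: "y \<in> Arm i" and yz: "adj y z" "\<omega>' {y, z}" "z \<noteq> x" for i y z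
  proof (cases "{y, z} \<in> J")
    case False
    then have "y \<notin> W" "z \<notin> W" using yz by (auto simp: J_def)
    moreover have "\<omega> {y, z}" using False yz by (simp add: \<omega>'_def)
    ultimately have s: "joined \<omega> W y z" using yz by (intro joined_step) auto
    have "joined \<omega> W (d i) y" using y \<open>y \<notin> W\<close> fW[OF i] by (auto simp: Arm_def)
    then show ?thesis using joined_trans[OF _ s] by (simp add: Arm_def)
  next
    case True
    then obtain j where j: "j < 3" and "{y, z} = {u j, d j} \<or> (\<exists>k<n j. {y, z} = {f j k, f j (Suc k)})"
      using yz(2) by (auto simp: \<omega>'_def)
    then consider "y = u j" "z = d j" | "y = d j" "z = u j"
      | k where "k < n j" "y = f j k" "z = f j (Suc k)" | k where "k < n j" "y = f j (Suc k)" "z = f j k"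
      by (auto simp: doubleton_eq_iff)
    then show ?thesis
    proof cases
      case 1
      then have "y \<in> W" using du j by blast
      then obtain l where l: "l \<ge> 1" "l \<le> n i" "y = f i l" using armW i y by blast
      have "i = j" using disj[OF i j, of l "n j"] l 1 f[OF j] by force
      then show ?thesis using 1 by (simp add: Arm_def)
    next
      case 2
      then have "y \<notin> W" using du j by blast
      then have "joined \<omega> W (d i) (d j)" using y fW[OF i] 2 by (auto simp: Arm_def)
      then have ij: "i = j" using dsep[OF i j] by blast
      \<comment> \<open>Otherwise \<open>u i\<close> is the hub, and the exit edge would lead to
        \<open>x\<close>.\<close>
      have "n i \<noteq> 0" using 2 ij f[OF i] yz(3) by metis
      then have "z \<in> f i ` {1..n i}" using 2 ij f[OF i] by (intro image_eqI[of _ _ "n i"]) auto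
      then show ?thesis by (simp add: Arm_def)
    next
      case 3
      then have "y \<in> W" using fW[OF j, of k] by simp
      then obtain l where l: "l \<ge> 1" "l \<le> n i" "y = f i l" using armW i y by blast
      have "i = j" using disj[OF i j, of l k] l 3 by force
      then show ?thesis using 3 by (simp add: Arm_def)
    next
      case 4
      then have "y \<in> W" using fW[OF j, of "Suc k"] by simp
      then obtain l where l: "l \<ge> 1" "l \<le> n i" "y = f i l" using armW i y by blast
      have ij: "i = j" using disj[OF i j, of l "Suc k"] l 4 by force
      have "k \<noteq> 0" using 4 yz(3) f[OF j] by metis
      then have "z \<in> f i ` {1..n i}" using 4 ij by (intro image_eqI[of _ _ k]) auto
      then show ?thesis by (simp add: Arm_def)
    qed
  qed
  have arm: "z \<in> Arm i" if i: "i < 3" and "joined \<omega>' {x} (d i) z" for i z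
    using that(2)
  proof (induction rule: joined_induct)
    case base
    then show ?case by (simp add: Arm_def)
  next
    case (step y z)
    then show ?case using arm_step[OF i, of y z]
      by simp
  qed
  have sep': "\<not> joined \<omega>' {x} (d i) (d j)" if ij: "i < 3" "j < 3" "i \<noteq> j" for i j
  proof
    assume "joined \<omega>' {x} (d i) (d j)"
    then have "d j \<in> Arm i" using arm ij by blast
    moreover have "d j \<notin> W" using du ij by blast
    ultimately have "joined \<omega> W (d i) (d j)" using fW[OF ij(1)] by (auto simp: Arm_def)
    then show False using dsep ij by blast
  qed
  have reach_f: "reach \<omega>' x (f i k)" if i: "i < 3" and "k \<le> n i" for i k
    using that(2)
  proof (induction k)
    case 0
    then show ?case using f[OF i] by simp
  next
    case (Suc k)
    have Rk: "R (f i k) (f i (Suc k))" using f[OF i] Suc by simp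
    then have "{f i k, f i (Suc k)} \<in> J" by (auto simp: R_def J_def)
    moreover have "\<exists>j<3. {f i k, f i (Suc k)} = {u j, d j} \<or> (\<exists>l<n j. {f i k, f i (Suc k)} = {f j l, f j (Suc l)})"
      using i Suc.prems by (intro exI[of _ i]) (auto simp: Suc_le_eq)
    ultimately have "\<omega>' {f i k, f i (Suc k)}" unfolding \<omega>'_def by simp
    then have "reach \<omega>' (f i k) (f i (Suc k))" using Rk by (intro joined_step) (auto simp: R_def)
    moreover have "reach \<omega>' x (f i k)" using Suc by simp
    ultimately show ?case by (rule joined_trans[rotated])
  qed
  have reach_d: "reach \<omega>' x (d i)" if i: "i < 3" for i
  proof -
    have "{u i, d i} \<in> J" using du[OF i] by (auto simp: J_def)
    then have "\<omega>' {u i, d i}" using i by (auto simp: \<omega>'_def)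
    then have "reach \<omega>' (u i) (d i)" using du[OF i] by (intro joined_step) auto
    moreover have "reach \<omega>' x (u i)" using reach_f[OF i, of "n i"] f[OF i] by simp
    ultimately show ?thesis by (rule joined_trans[rotated])
  qed
  have tall': "tall \<omega>' {x} (d i)" if i: "i < 3" for i
  proof -
    have "joined \<omega>' {x} (d i) b" if "joined \<omega> W (d i) b" for b
      using that
    proof (rule joined_mono)
      fix a b assume "adj a b" "\<omega> {a, b}" "a \<notin> W" "b \<notin> W"
      then show "\<omega>' {a, b} \<and> a \<notin> {x} \<and> b \<notin> {x}" using x by (auto simp: \<omega>'_def J_def)
    qed
    then show ?thesis using du[OF i] unfolding tall_def by blast
  qed
  have dx: "d i \<in> V \<and> d i \<noteq> x" if "i < 3" for i using du[OF that] x by auto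
  have "trifurcation \<omega>' x"
    unfolding trifurcation_def
    using dx[of 0] dx[of 1] dx[of 2] reach_d[of 0] reach_d[of 1] reach_d[of 2] tall'[of 0] tall'[of 1] tall'[of 2]
      sep'[of 0 1] sep'[of 0 2] sep'[of 1 2]
    by (intro bexI[of _ "d 0"] bexI[of _ "d 1"] bexI[of _ "d 2"]) auto
  then show ?thesis using J x W by (intro exI[of _ J] exI[of _ \<omega>'] exI[of _ x]) (auto simp: \<omega>'_def)
qed

end

section \<open>Heavy clusters and trifurcations\<close>

lemma sum_UN_le:
  fixes f :: "'b \<Rightarrow> real"
  assumes "finite D" "\<And>y. finite (B y)" "\<And>x. x \<in> (\<Union>y\<in>D. B y) \<Longrightarrow> f x \<ge> 0"
  shows "(\<Sum>x\<in>(\<Union>y\<in>D. B y). f x) \<le> (\<Sum>y\<in>D. \<Sum>x\<in>B y. f x)"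
  using assms(1,3)
proof (induction D)
  case (insert y D)
  let ?U = "\<Union>y\<in>D. B y"
  have "(\<Sum>x\<in>B y \<union> ?U. f x) + (\<Sum>x\<in>B y \<inter> ?U. f x) = (\<Sum>x\<in>B y. f x) + (\<Sum>x\<in>?U. f x)"
    using insert.hyps assms(2) by (intro sum.union_inter) auto
  moreover have "(\<Sum>x\<in>B y \<inter> ?U. f x) \<ge> 0" using insert.prems by (intro sum_nonneg) auto
  moreover have "(\<Sum>x\<in>?U. f x) \<le> (\<Sum>y\<in>D. \<Sum>x\<in>B y. f x)" using insert by simp
  ultimately show ?case using insert.hyps by simp
qed simp

context rooted_graph
begin

text \<open>Every vertex sends its mass to the peak of its cluster, if there is one. A peak then
  receives the total weight of its cluster, which is almost surely finite.\<close>

lemma AE_no_heavy_peak: "AE \<omega> in M p. \<forall>x\<in>V. peak \<omega> x \<longrightarrow> \<not> infinite_mass \<omega> x"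
proof -
  define Rel where "Rel = (\<lambda>\<omega> y x. reach \<omega> y x \<and> peak \<omega> x)"
  have meas: "Measurable.pred (M p) (\<lambda>\<omega>. Rel \<omega> y x)" if "x \<in> V" "y \<in> V" for x y
  proof -
    have "Measurable.pred (M p) (\<lambda>\<omega>. \<forall>z\<in>V. reach \<omega> x z \<and> z \<noteq> x \<longrightarrow> w z < w x)"
      by (intro pred_Ball_V pred_intros_logic pred_joined that) auto
    then show ?thesis unfolding Rel_def peak_def by (intro pred_intros_logic pred_joined that)
  qed
  have equiv: "Rel (act g \<omega>) y x \<longleftrightarrow> Rel \<omega> (g y) (g x)" if g: "graph_auto g" "x \<in> V" "y \<in> V" for g x y \<omega>
  proof -
    have wg: "w (g z) < w (g x) \<longleftrightarrow> w z < w x" if "z \<in> V" for z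
      using w_auto[OF g(1) that g(2)] w_pos[OF g(2)] w_pos[OF auto_in[OF g(1,2)]]
      by (metis divide_less_eq_1_pos)
    have "peak (act g \<omega>) x \<longleftrightarrow> (\<forall>z\<in>V. reach \<omega> (g x) (g z) \<and> g z \<noteq> g x \<longrightarrow> w (g z) < w (g x))"
      unfolding peak_def using joined_act[OF g(1) empty_subsetI g(2)] wg auto_eq_iff[OF g(1) _ g(2)] by auto
    also have "\<dots> \<longleftrightarrow> peak \<omega> (g x)"
      unfolding peak_def using auto_surj[OF g(1)] auto_in[OF g(1)] by metis
    finally show ?thesis using joined_act[OF g(1) empty_subsetI g(3,2)] by (simp add: Rel_def)
  qed
  have uniq: "x = x'" if "x \<in> V" "x' \<in> V" "y \<in> V" "Rel \<omega> y x" "Rel \<omega> y x'" for \<omega> x x' y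
  proof (rule ccontr)
    assume ne: "x \<noteq> x'"
    have "reach \<omega> x x'" "reach \<omega> x' x" using that joined_sym joined_trans unfolding Rel_def by blast+
    then have "w x < w x'" "w x' < w x" using that ne unfolding Rel_def peak_def by blast+
    then show False by simp
  qed
  have "AE \<omega> in M p. \<forall>x\<in>V. (\<integral>\<^sup>+y. of_bool (Rel \<omega> y x) * ennreal (w y) \<partial>count_space V) < \<infinity>"
    unfolding AE_ball_countable[OF countable_V]
    using AE_received_finite[of Rel] meas equiv uniq by blast
  then show ?thesis
  proof eventually_elim
    case (elim \<omega>)
    show ?case
    proof (intro ballI impI notI)
      fix x assume x: "x \<in> V" "peak \<omega> x" "infinite_mass \<omega> x"
      then have "(\<integral>\<^sup>+y. of_bool (Rel \<omega> y x) * ennreal (w y) \<partial>count_space V) = \<infinity>"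
        by (simp add: Rel_def infinite_mass_def)
      then show False using elim x by auto
    qed
  qed
qed

lemma AE_heavy_tall:
  assumes p: "0 < p" "p < 1" and unb: "\<And>c. \<exists>y\<in>V. w y > c"
  shows "AE \<omega> in M p. \<forall>a\<in>V. infinite_mass \<omega> a \<longrightarrow> tall \<omega> {} a"
  using finite_energy[OF p AE_no_heavy_peak]
proof eventually_elim
  case (elim \<omega>)
  show ?case
  proof (intro ballI impI, rule ccontr)
    fix a assume a: "a \<in> V" "infinite_mass \<omega> a" "\<not> tall \<omega> {} a"
    then obtain n :: nat where n: "\<And>b. b \<in> V \<Longrightarrow> reach \<omega> a b \<Longrightarrow> w b \<le> real n"
      unfolding tall_def by (metis linorder_le_cases)
    from heavy_bounded_modification[OF unb a(1,2) n] show False using elim by blast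
  qed
qed

text \<open>\<open>k\<close> is the scale of \<open>w y\<close> relative to \<open>w x\<close>. The
  ratio 4/3 of consecutive scales is the reciprocal of the 3/4 required of a companion; this is what
  singles out one \<open>x\<close> for given \<open>y\<close> and \<open>k\<close>.\<close>

definition poor :: "nat \<Rightarrow> ('a set \<Rightarrow> bool) \<Rightarrow> 'a \<Rightarrow> 'a \<Rightarrow> bool" where
  "poor k \<omega> y x \<longleftrightarrow> trifurcation \<omega> x \<and> y \<noteq> x \<and> reach \<omega> x y \<and>
     (\<forall>z\<in>V. joined \<omega> {x} y z \<and> trifurcation \<omega> z \<longrightarrow> w z < 3/4 * w x) \<and>
     (4/3) ^ k * w x \<le> w y \<and> w y < (4/3) ^ Suc k * w x"

text \<open>With one receiver per scale, \<open>x\<close> receives something at scale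
  \<open>k\<close> with probability at most \<open>(3/4) ^ k\<close>, which is summable.\<close>

lemma AE_finitely_many_poor:
  assumes x: "x \<in> V"
  shows "AE \<omega> in M p. eventually (\<lambda>k. \<not> (\<exists>y\<in>V. poor k \<omega> y x)) sequentially"
proof -
  have meas: "Measurable.pred (M p) (\<lambda>\<omega>. poor k \<omega> y x)" if "x \<in> V" "y \<in> V" for x y k
  proof -
    have "Measurable.pred (M p) (\<lambda>\<omega>. \<forall>z\<in>V. joined \<omega> {x} y z \<and> trifurcation \<omega> z \<longrightarrow> w z < 3/4 * w x)"
      by (intro pred_Ball_V pred_intros_logic pred_joined pred_trifurcation that) auto
    moreover note pred_trifurcation[OF that(1)] pred_joined[OF that]
    ultimately show ?thesis unfolding poor_def by (intro pred_intros_logic) auto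
  qed
  have equiv: "poor k (act g \<omega>) y x \<longleftrightarrow> poor k \<omega> (g y) (g x)"
    if g: "graph_auto g" "x \<in> V" "y \<in> V" for g x y \<omega> k
  proof -
    define c where "c = w (g x) / w x"
    have c: "c > 0" using w_pos g by (simp add: c_def)
    have wg: "w (g z) = c * w z" if "z \<in> V" for z using w_scale[OF g(1,2) that] by (simp add: c_def)
    have e1: "w (g z) < s * w (g x) \<longleftrightarrow> w z < s * w x" if "z \<in> V" for z s
    proof -
      have "w (g z) < s * w (g x) \<longleftrightarrow> c * w z < c * (s * w x)"
        using wg that g by (simp add: mult_ac)
      then show ?thesis using c by simp
    qed
    have e2: "s * w (g x) \<le> w (g z) \<longleftrightarrow> s * w x \<le> w z" if "z \<in> V" for z s
      using e1[OF that, of s] by linarith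
    have "(\<forall>z\<in>V. joined (act g \<omega>) {x} y z \<and> trifurcation (act g \<omega>) z \<longrightarrow> w z < 3/4 * w x)
        \<longleftrightarrow> (\<forall>z\<in>V. joined \<omega> {g x} (g y) (g z) \<and> trifurcation \<omega> (g z) \<longrightarrow> w (g z) < 3/4 * w (g x))"
    proof (intro ball_cong refl)
      fix z assume z: "z \<in> V"
      have "joined (act g \<omega>) {x} y z \<longleftrightarrow> joined \<omega> {g x} (g y) (g z)"
        using joined_act[OF g(1) _ g(3) z, of "{x}"] g(2) by simp
      then show "(joined (act g \<omega>) {x} y z \<and> trifurcation (act g \<omega>) z \<longrightarrow> w z < 3/4 * w x)
        \<longleftrightarrow> (joined \<omega> {g x} (g y) (g z) \<and> trifurcation \<omega> (g z) \<longrightarrow> w (g z) < 3/4 * w (g x))"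
        unfolding trifurcation_act[OF g(1) z] e1[OF z] by simp
    qed
    also have "\<dots> \<longleftrightarrow> (\<forall>z\<in>V. joined \<omega> {g x} (g y) z \<and> trifurcation \<omega> z \<longrightarrow> w z < 3/4 * w (g x))"
      using auto_surj[OF g(1)] auto_in[OF g(1)] by metis
    finally show ?thesis
      unfolding poor_def e1[OF g(3)] e2[OF g(3)] trifurcation_act[OF g(1,2)]
      using joined_act[OF g(1) empty_subsetI g(2,3)] auto_eq_iff[OF g(1,3,2)] by simp
  qed
  have uniq: "x = x'" if V: "x \<in> V" "x' \<in> V" "y \<in> V" and r: "poor k \<omega> y x" "poor k \<omega> y x'" for \<omega> x x' y k
  proof (rule ccontr)
    assume ne: "x \<noteq> x'"
    \<comment> \<open>As a trifurcation in the branch of \<open>y\<close> at \<open>x\<close>, the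
      vertex \<open>x'\<close> is lighter than \<open>3/4 * w x\<close>. Then
      \<open>w y < (4/3) ^ Suc k * w x'\<close> puts \<open>y\<close> below scale \<open>k\<close>
      as seen from \<open>x\<close>.\<close>
    have *: False if V: "x \<in> V" "x' \<in> V" and r: "poor k \<omega> y x" "poor k \<omega> y x'" and joined: "joined \<omega> {x} y x'" for x x'
    proof -
      have "w x' < 3/4 * w x" using r V joined unfolding poor_def by blast
      then have "(4/3) ^ Suc k * w x' < (4/3) ^ Suc k * (3/4 * w x)" by (intro mult_strict_left_mono) auto
      also have "\<dots> = (4/3) ^ k * w x" by simp
      finally show False using r unfolding poor_def by linarith
    qed
    have "reach \<omega> y x'" using r(2) joined_sym unfolding poor_def by blast
    from joined_first[OF this ne] have "joined \<omega> {x'} y x \<or> joined \<omega> {x} y x'"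
      using r unfolding poor_def by blast
    then show False using *[OF V(1,2) r] *[OF V(2,1) r(2,1)] by blast
  qed
  interpret prob_space "M p" by (rule prob_M)
  define A where "A = (\<lambda>k. {\<omega> \<in> space (M p). \<exists>y\<in>V. poor k \<omega> y x})"
  have A: "A k \<in> sets (M p)" for k
    using pred_Bex_V[of V "\<lambda>y \<omega>. poor k \<omega> y x"] meas x by (simp add: A_def pred_def)
  have "emeasure (M p) (A k) \<le> ennreal ((3/4) ^ k)" for k
  proof -
    have "emeasure (M p) (A k) \<le> ennreal (1 / (4/3) ^ k)"
      unfolding A_def
    proof (rule emeasure_received[of "poor k", OF _ _ _ x])
      show "Measurable.pred (M p) (\<lambda>\<omega>. poor k \<omega> y x)" if "x \<in> V" "y \<in> V" for x y
        by (rule meas[OF that])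
      show "poor k (act g \<omega>) y x \<longleftrightarrow> poor k \<omega> (g y) (g x)" if "graph_auto g" "x \<in> V" "y \<in> V" for g x y \<omega>
        by (rule equiv[OF that])
      show "x = x'" if "x \<in> V" "x' \<in> V" "y \<in> V" "poor k \<omega> y x" "poor k \<omega> y x'" for \<omega> x x' y
        by (rule uniq[OF that])
      show "w y \<ge> (4/3) ^ k * w x" if "poor k \<omega> y x" for \<omega> y using that by (simp add: poor_def)
    qed simp
    then show ?thesis by (simp add: power_divide)
  qed
  then have le: "prob (A k) \<le> (3/4) ^ k" for k
    by (simp add: emeasure_eq_measure)
  have "summable (\<lambda>k. prob (A k))"
    by (rule summable_comparison_test'[of "\<lambda>k. (3/4::real) ^ k" 0]) (use le in \<open>auto simp: summable_geometric\<close>)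
  then have "AE \<omega> in M p. eventually (\<lambda>k. \<omega> \<in> space (M p) - A k) sequentially"
    using A by (intro borel_cantelli_AE1) (auto simp: emeasure_eq_measure)
  then show ?thesis
    by eventually_elim (auto simp: A_def elim: eventually_mono)
qed

text \<open>An unbounded branch without such a trifurcation would contain vertices that are
  \<open>poor\<close> at arbitrarily large scales.\<close>

lemma AE_rich:
  "AE \<omega> in M p. \<forall>x\<in>V. trifurcation \<omega> x \<longrightarrow> (\<forall>a\<in>V. a \<noteq> x \<and> reach \<omega> x a \<and> tall \<omega> {x} a \<longrightarrow>
     (\<exists>z\<in>V. joined \<omega> {x} a z \<and> trifurcation \<omega> z \<and> w z \<ge> 3/4 * w x))"
proof -
  have "AE \<omega> in M p. \<forall>x\<in>V. eventually (\<lambda>k. \<not> (\<exists>y\<in>V. poor k \<omega> y x)) sequentially"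
    unfolding AE_ball_countable[OF countable_V] using AE_finitely_many_poor by blast
  then show ?thesis
  proof eventually_elim
    case (elim \<omega>)
    show ?case
    proof (intro ballI impI, rule ccontr)
      fix x a
      assume x: "x \<in> V" "trifurcation \<omega> x" and a: "a \<in> V" "a \<noteq> x \<and> reach \<omega> x a \<and> tall \<omega> {x} a"
        and c: "\<not> (\<exists>z\<in>V. joined \<omega> {x} a z \<and> trifurcation \<omega> z \<and> w z \<ge> 3/4 * w x)"
      obtain N where N: "\<And>k y. k \<ge> N \<Longrightarrow> y \<in> V \<Longrightarrow> \<not> poor k \<omega> y x"
        using bspec[OF elim x(1)] unfolding eventually_sequentially by blast
      have wx: "w x > 0" using w_pos x by blast
      obtain n :: nat where n: "real n \<ge> (4/3) ^ N * w x" using real_arch_simple by blast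
      obtain b where b: "b \<in> V" "joined \<omega> {x} a b" "w b \<ge> real n" using a unfolding tall_def by blast
      \<comment> \<open>The first power that exceeds \<open>w b\<close>. It comes after
        \<open>N\<close>, so it has a predecessor, and that is the scale of
        \<open>b\<close>.\<close>
      define l where "l = (LEAST i. w b < (4/3) ^ i * w x)"
      obtain i where "w b / w x < (4/3) ^ i" using real_arch_pow[of "4/3" "w b / w x"] by auto
      then have "w b < (4/3) ^ i * w x" using wx by (simp add: field_simps)
      then have l: "w b < (4/3) ^ l * w x" unfolding l_def by (rule LeastI)
      have l2: "w b \<ge> (4/3) ^ j * w x" if "j < l" for j
        using not_less_Least[of j "\<lambda>i. w b < (4/3) ^ i * w x"] that by (simp add: l_def)
      have "l > N"
      proof (rule ccontr)
        assume "\<not> l > N"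
        then have "(4/3::real) ^ l \<le> (4/3) ^ N" by (intro power_increasing) auto
        then have "(4/3) ^ l * w x \<le> (4/3) ^ N * w x" using wx by (intro mult_right_mono) auto
        then show False using l n b by linarith
      qed
      then obtain k where k: "l = Suc k" "k \<ge> N" by (cases l) auto
      have bx: "b \<noteq> x" using joined_notin[OF b(2)] a by blast
      have "reach \<omega> x b" using a joined_anti[OF b(2), of "{}"] joined_trans by blast
      moreover have "w z < 3/4 * w x" if "z \<in> V" "joined \<omega> {x} b z" "trifurcation \<omega> z" for z
        using c that joined_trans[OF b(2) that(2)] by (meson not_le)
      ultimately have "poor k \<omega> b x" using x bx l l2[of k] k unfolding poor_def by auto
      then show False using N k b by blast
    qed
  qed
qed

lemma good_mono: "good n \<omega> x \<Longrightarrow> n \<le> n' \<Longrightarrow> good n' \<omega> x"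
  unfolding good_def using ball_mono[of n n' x] by (meson subsetD)

lemma AE_good: "AE \<omega> in M p. \<forall>x\<in>V. trifurcation \<omega> x \<longrightarrow> (\<exists>n. good n \<omega> x)"
  using AE_rich
proof eventually_elim
  case (elim \<omega>)
  show ?case
  proof (intro ballI impI)
    fix x assume x: "x \<in> V" "trifurcation \<omega> x"
    then obtain a b c where abc: "a \<in> V" "b \<in> V" "c \<in> V" "a \<noteq> x" "b \<noteq> x" "c \<noteq> x"
       "reach \<omega> x a" "reach \<omega> x b" "reach \<omega> x c"
       "\<not> joined \<omega> {x} a b" "\<not> joined \<omega> {x} a c" "\<not> joined \<omega> {x} b c"
       "tall \<omega> {x} a" "tall \<omega> {x} b" "tall \<omega> {x} c"
      unfolding trifurcation_def by blast
    have ex: "\<exists>z\<in>V. joined \<omega> {x} a z \<and> trifurcation \<omega> z \<and> w z \<ge> 3/4 * w x \<and> z \<noteq> x \<and> reach \<omega> x z \<and> (\<exists>n. z \<in> ball n x)"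
      if a: "a \<in> V" "a \<noteq> x" "reach \<omega> x a" "tall \<omega> {x} a" for a
    proof -
      obtain z where z: "z \<in> V" "joined \<omega> {x} a z" "trifurcation \<omega> z" "w z \<ge> 3/4 * w x"
        using elim x a by blast
      moreover have "z \<noteq> x" using joined_notin[OF z(2)] a by blast
      moreover have "reach \<omega> x z" using joined_trans[OF a(3)] joined_anti[OF z(2), of "{}"] by blast
      ultimately show ?thesis using ex_ball[OF x(1) z(1)] by blast
    qed
    obtain za na where a: "za \<in> V" "joined \<omega> {x} a za" "trifurcation \<omega> za" "w za \<ge> 3/4 * w x" "za \<noteq> x" "reach \<omega> x za" "za \<in> ball na x"
      using ex[of a] abc by blast
    obtain zb nb where b: "zb \<in> V" "joined \<omega> {x} b zb" "trifurcation \<omega> zb" "w zb \<ge> 3/4 * w x" "zb \<noteq> x" "reach \<omega> x zb" "zb \<in> ball nb x"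
      using ex[of b] abc by blast
    obtain zc nc where c: "zc \<in> V" "joined \<omega> {x} c zc" "trifurcation \<omega> zc" "w zc \<ge> 3/4 * w x" "zc \<noteq> x" "reach \<omega> x zc" "zc \<in> ball nc x"
      using ex[of c] abc by blast
    have sep: "\<not> joined \<omega> {x} za zb" "\<not> joined \<omega> {x} za zc" "\<not> joined \<omega> {x} zb zc"
      using abc(10-12) a(2) b(2) c(2) joined_trans joined_sym by meson+
    have "za \<in> ball (na + nb + nc) x" "zb \<in> ball (na + nb + nc) x" "zc \<in> ball (na + nb + nc) x"
      using ball_mono[of na "na + nb + nc" x] ball_mono[of nb "na + nb + nc" x] ball_mono[of nc "na + nb + nc" x]
        a b c by auto
    then have "good (na + nb + nc) \<omega> x" unfolding good_def using a b c sep by blast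
    then show "\<exists>n. good n \<omega> x" by blast
  qed
qed

text \<open>An automorphism taking the root to \<open>y\<close> multiplies all weights by
  \<open>w y\<close>. Thickening a set by balls of radius \<open>n\<close> thus increases its weight
  by a constant factor at most.\<close>

lemma ball_sum:
  assumes "y \<in> V" shows "(\<Sum>x\<in>ball n y. w x) = (\<Sum>x\<in>ball n r. w x) * w y"
proof -
  obtain g where g: "graph_auto g" "g r = y" using ex_auto root_in assms by blast
  have sub: "ball n r \<subseteq> V" using ball_subset root_in by blast
  have "(\<Sum>x\<in>ball n y. w x) = (\<Sum>x\<in>g ` ball n r. w x)"
    using auto_ball_image[OF g(1) root_in] g by simp
  also have "\<dots> = (\<Sum>x\<in>ball n r. w (g x))"
    using inj_on_subset[OF auto_inj[OF g(1)] sub] by (simp add: sum.reindex)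
  also have "\<dots> = (\<Sum>x\<in>ball n r. w x * w y)"
  proof (intro sum.cong refl)
    fix x assume "x \<in> ball n r"
    then have "w (g x) = w (g r) / w r * w x" using sub by (intro w_scale g root_in) auto
    then show "w (g x) = w x * w y" using g w_root by simp
  qed
  finally show ?thesis by (simp add: sum_distrib_right)
qed

lemma ball_exit:
  assumes "x \<in> K" "\<not> ball n x \<subseteq> K"
  shows "\<exists>y\<in>K \<inter> ball n x. \<exists>z. adj y z \<and> z \<notin> K"
  using assms(2)
proof (induction n)
  case 0
  then show ?case using assms(1) by simp
next
  case (Suc n)
  show ?case
  proof (cases "ball n x \<subseteq> K")
    case True
    then show ?thesis using Suc.prems by auto
  next
    case False
    then show ?thesis using Suc.IH by auto
  qed
qed

text \<open>Both sides of the count are random weights inside \<open>K\<close>. By invariance their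
  expectations are a fixed probability times a deterministic weight, so the factor 3/2 survives on
  average and contradicts a positive probability.\<close>

lemma AE_no_trifurcation:
  assumes folner: "\<And>\<epsilon>::real. \<epsilon> > 0 \<Longrightarrow> \<exists>K. finite K \<and> K \<noteq> {} \<and> K \<subseteq> V \<and>
     (\<Sum>x\<in>{x \<in> K. \<exists>y. adj x y \<and> y \<notin> K}. w x) \<le> \<epsilon> * (\<Sum>x\<in>K. w x)"
  shows "AE \<omega> in M p. \<forall>x\<in>V. \<not> trifurcation \<omega> x"
proof -
  interpret prob_space "M p" by (rule prob_M)
  define A where "A = (\<lambda>x. {\<omega> \<in> space (M p). trifurcation \<omega> x})"
  define B where "B = (\<lambda>n x. {\<omega> \<in> space (M p). trifurcation \<omega> x \<and> good n \<omega> x})"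
  have mA: "A x \<in> events" if "x \<in> V" for x using pred_trifurcation[OF that] by (simp add: A_def pred_def)
  have mB: "B n x \<in> events" if "x \<in> V" for n x
    unfolding B_def using pred_trifurcation[OF that] pred_good[OF that] by measurable
  have cA: "prob (A x) = prob (A r)" if x: "x \<in> V" for x
  proof -
    obtain g where g: "graph_auto g" "g r = x" using ex_auto root_in x by blast
    have "emeasure (M p) {\<omega> \<in> space (M p). trifurcation \<omega> x} = emeasure (M p) {\<omega> \<in> space (M p). trifurcation \<omega> r}"
      using trifurcation_act[OF g(1) root_in] g by (intro emeasure_act[OF g(1) pred_trifurcation[OF root_in]]) simp
    then show ?thesis by (simp add: A_def measure_def)
  qed
  have cB: "prob (B n x) = prob (B n r)" if x: "x \<in> V" for n x
  proof -
    obtain g where g: "graph_auto g" "g r = x" using ex_auto root_in x by blast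
    have "emeasure (M p) {\<omega> \<in> space (M p). trifurcation \<omega> x \<and> good n \<omega> x}
        = emeasure (M p) {\<omega> \<in> space (M p). trifurcation \<omega> r \<and> good n \<omega> r}"
      using trifurcation_act[OF g(1) root_in] good_act[OF g(1) root_in] g
      by (intro emeasure_act[OF g(1)] pred_intros_logic pred_trifurcation pred_good root_in) auto
    then show ?thesis by (simp add: B_def measure_def)
  qed
  have zero: "prob (A r) = 0"
  proof (rule ccontr)
    assume "prob (A r) \<noteq> 0"
    then have c: "prob (A r) > 0" using measure_nonneg[of "M p" "A r"] by linarith
    have "(\<lambda>n. prob (B n r)) \<longlonglongrightarrow> prob (\<Union>n. B n r)"
      using mB[OF root_in] good_mono
      by (intro finite_Lim_measure_incseq) (auto simp: incseq_def B_def)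
    moreover have "prob (\<Union>n. B n r) = prob (A r)"
    proof (rule measure_eq_AE)
      show "AE \<omega> in M p. \<omega> \<in> (\<Union>n. B n r) \<longleftrightarrow> \<omega> \<in> A r"
        using AE_good by eventually_elim (use root_in in \<open>auto simp: A_def B_def\<close>)
    qed (use mA mB root_in in auto)
    ultimately have "(\<lambda>n. prob (B n r)) \<longlonglongrightarrow> prob (A r)" by simp
    \<comment> \<open>One factor 9/10 is lost here, another to vertices close to the boundary of
      \<open>K\<close>; \<open>3/2 * 9/10 * 9/10\<close> still exceeds 1.\<close>
    then have "eventually (\<lambda>n. prob (B n r) > 9/10 * prob (A r)) sequentially"
      using c by (intro order_tendstoD) auto
    then obtain n where n: "prob (B n r) > 9/10 * prob (A r)" by (auto simp: eventually_sequentially)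
    define \<kappa> where "\<kappa> = (\<Sum>x\<in>ball n r. w x)"
    have \<kappa>: "\<kappa> > 0"
      unfolding \<kappa>_def
    proof (rule sum_pos)
      show "ball n r \<noteq> {}" using ball_self by blast
      show "w x > 0" if "x \<in> ball n r" for x using that w_pos ball_subset[OF root_in] by blast
    qed (rule finite_ball)
    \<comment> \<open>Thickening the boundary by radius \<open>n\<close> multiplies its weight by at
      most \<open>\<kappa>\<close>, so a tenth of the total weight is lost.\<close>
    obtain K where K: "finite K" "K \<noteq> {}" "K \<subseteq> V"
      "(\<Sum>x\<in>{x \<in> K. \<exists>y. adj x y \<and> y \<notin> K}. w x) \<le> 1 / (10 * \<kappa>) * (\<Sum>x\<in>K. w x)"
      using folner[of "1 / (10 * \<kappa>)"] \<kappa> by auto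
    define D where "D = {x \<in> K. \<exists>y. adj x y \<and> y \<notin> K}"
    define Dn where "Dn = {x \<in> K. \<not> ball n x \<subseteq> K}"
    define W where "W = (\<Sum>x\<in>K. w x)"
    have nn: "w x \<ge> 0" if "x \<in> V" for x using w_pos[OF that] by simp
    have W: "W > 0" unfolding W_def using K w_pos by (intro sum_pos) auto
    have "Dn \<subseteq> (\<Union>y\<in>D. ball n y)"
    proof
      fix x assume "x \<in> Dn"
      then obtain y where "y \<in> D" "y \<in> ball n x" using ball_exit[of x K n] by (auto simp: Dn_def D_def)
      then show "x \<in> (\<Union>y\<in>D. ball n y)" using ball_sym by blast
    qed
    moreover have BV: "(\<Union>y\<in>D. ball n y) \<subseteq> V" using K ball_subset by (auto simp: D_def)
    moreover have finD: "finite D" using K by (simp add: D_def)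
    ultimately have "(\<Sum>x\<in>Dn. w x) \<le> (\<Sum>x\<in>(\<Union>y\<in>D. ball n y). w x)"
      using finite_ball nn by (intro sum_mono2) auto
    also have "\<dots> \<le> (\<Sum>y\<in>D. \<Sum>x\<in>ball n y. w x)"
      by (rule sum_UN_le[OF finD finite_ball]) (use nn BV in auto)
    also have "\<dots> = (\<Sum>y\<in>D. \<kappa> * w y)" using K by (intro sum.cong) (auto simp: \<kappa>_def D_def ball_sum)
    also have "\<dots> = \<kappa> * (\<Sum>y\<in>D. w y)" by (simp add: sum_distrib_left)
    also have "\<dots> \<le> \<kappa> * (1 / (10 * \<kappa>) * W)" using K \<kappa> unfolding D_def W_def by (intro mult_left_mono) auto
    finally have Dn: "(\<Sum>x\<in>Dn. w x) \<le> W / 10" using \<kappa> by simp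
    have "(\<Sum>x\<in>K - Dn. w x) + (\<Sum>x\<in>Dn. w x) = W"
      unfolding W_def using K by (intro sum.subset_diff[symmetric]) (auto simp: Dn_def)
    then have big: "(\<Sum>x\<in>K - Dn. w x) \<ge> 9/10 * W" using Dn by linarith
    \<comment> \<open>Off \<open>Dn\<close> the whole ball of radius \<open>n\<close> lies in
      \<open>K\<close>, so the companions of a good trifurcation are among the trifurcations counted
      on the right.\<close>
    have pw: "3/2 * (\<Sum>x\<in>K - Dn. w x * indicator (B n x) \<omega>) \<le> (\<Sum>x\<in>K. w x * indicator (A x) \<omega>)"
      if \<omega>: "\<omega> \<in> space (M p)" for \<omega>
    proof -
      define Tk where "Tk = {x \<in> K. trifurcation \<omega> x}"
      define G where "G = {x \<in> K - Dn. trifurcation \<omega> x \<and> good n \<omega> x}"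
      have "3/2 * (\<Sum>x\<in>G. w x) \<le> (\<Sum>x\<in>Tk. w x)"
      proof (rule weighted_three_branches[of Tk G \<omega>])
        fix x assume x: "x \<in> G"
        have bK: "ball n x \<subseteq> K" using x by (auto simp: G_def Dn_def)
        obtain a b c where abc: "a \<in> ball n x" "b \<in> ball n x" "c \<in> ball n x" "a \<noteq> x" "b \<noteq> x" "c \<noteq> x"
          "reach \<omega> x a" "reach \<omega> x b" "reach \<omega> x c"
          "\<not> joined \<omega> {x} a b" "\<not> joined \<omega> {x} a c" "\<not> joined \<omega> {x} b c"
          "trifurcation \<omega> a" "trifurcation \<omega> b" "trifurcation \<omega> c" "w a \<ge> 3/4 * w x" "w b \<ge> 3/4 * w x" "w c \<ge> 3/4 * w x"
          using x unfolding G_def good_def by blast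
        then have "a \<in> {a \<in> Tk. w a \<ge> 3/4 * w x}" "b \<in> {a \<in> Tk. w a \<ge> 3/4 * w x}"
          "c \<in> {a \<in> Tk. w a \<ge> 3/4 * w x}" using bK by (auto simp: Tk_def)
        then show "three_branches \<omega> {a \<in> Tk. w a \<ge> 3/4 * w x} x"
          unfolding three_branches_def using abc(4-12) by blast
      qed (use K in \<open>auto simp: Tk_def G_def\<close>)
      moreover have "(\<Sum>x\<in>G. w x) = (\<Sum>x\<in>K - Dn. w x * indicator (B n x) \<omega>)"
        using K(1) \<omega> by (intro sum.mono_neutral_cong_left) (auto simp: G_def B_def indicator_def)
      moreover have "(\<Sum>x\<in>Tk. w x) = (\<Sum>x\<in>K. w x * indicator (A x) \<omega>)"
        using K(1) \<omega> by (intro sum.mono_neutral_cong_left) (auto simp: Tk_def A_def indicator_def)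
      ultimately show ?thesis by simp
    qed
    have iA: "integrable (M p) (\<lambda>\<omega>. w x * indicator (A x) \<omega>)" if "x \<in> K" for x
      using mA that K by (intro integrable_mult_right integrable_real_indicator) (auto simp: emeasure_eq_measure)
    have iB: "integrable (M p) (\<lambda>\<omega>. w x * indicator (B n x) \<omega>)" if "x \<in> K" for x
      using mB that K by (intro integrable_mult_right integrable_real_indicator) (auto simp: emeasure_eq_measure)
    have AS: "A x \<inter> space (M p) = A x" and BS: "B n x \<inter> space (M p) = B n x" for x
      by (auto simp: A_def B_def)
    have eA: "expectation (\<lambda>\<omega>. \<Sum>x\<in>K. w x * indicator (A x) \<omega>) = prob (A r) * W"
    proof -
      have "expectation (\<lambda>\<omega>. \<Sum>x\<in>K. w x * indicator (A x) \<omega>) = (\<Sum>x\<in>K. w x * prob (A x))"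
        by (subst Bochner_Integration.integral_sum[OF iA]) (simp_all add: AS)
      also have "\<dots> = (\<Sum>x\<in>K. w x * prob (A r))"
        using K by (intro sum.cong refl arg_cong[where f = "\<lambda>t. _ * t"] cA) auto
      finally show ?thesis by (simp add: W_def sum_distrib_right mult.commute)
    qed
    have eB: "expectation (\<lambda>\<omega>. 3/2 * (\<Sum>x\<in>K - Dn. w x * indicator (B n x) \<omega>))
        = 3/2 * (prob (B n r) * (\<Sum>x\<in>K - Dn. w x))"
    proof -
      have "expectation (\<lambda>\<omega>. \<Sum>x\<in>K - Dn. w x * indicator (B n x) \<omega>) = (\<Sum>x\<in>K - Dn. w x * prob (B n x))"
        by (subst Bochner_Integration.integral_sum[OF iB]) (simp_all add: BS)
      also have "\<dots> = (\<Sum>x\<in>K - Dn. w x * prob (B n r))"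
        using K by (intro sum.cong refl arg_cong[where f = "\<lambda>t. _ * t"] cB) auto
      also have "\<dots> = prob (B n r) * (\<Sum>x\<in>K - Dn. w x)" by (simp add: sum_distrib_left mult.commute)
      finally show ?thesis by simp
    qed
    have "3/2 * (prob (B n r) * (\<Sum>x\<in>K - Dn. w x)) \<le> prob (A r) * W"
      unfolding eA[symmetric] eB[symmetric] using iA iB pw
      by (intro integral_mono integrable_mult_right Bochner_Integration.integrable_sum) auto
    moreover have "prob (B n r) * (\<Sum>x\<in>K - Dn. w x) \<ge> (9/10 * prob (A r)) * (9/10 * W)"
      using n big c W by (intro mult_mono) auto
    ultimately have "3/2 * ((9/10 * prob (A r)) * (9/10 * W)) \<le> prob (A r) * W" by linarith
    moreover have "prob (A r) * W > 0" using c W by simp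
    ultimately show False by (simp add: mult.commute)
  qed
  have "AE \<omega> in M p. \<not> trifurcation \<omega> x" if x: "x \<in> V" for x
  proof (rule AE_I'[of "A x"])
    show "A x \<in> null_sets (M p)" using mA[OF x] cA[OF x] zero by (simp add: null_sets_def emeasure_eq_measure)
  qed (auto simp: A_def)
  then show ?thesis by (simp add: AE_ball_countable[OF countable_V])
qed

section \<open>From heavy clusters to the theorem\<close>

lemma clusters_eq: "clusters V E \<omega> = (\<lambda>x. {y \<in> V. reach \<omega> x y}) ` V"
  by (simp add: clusters_def graph_components_def reachable_def joined_def)

text \<open>Passes from the sum that defines heaviness to the integral that mass transport bounds;
  every finite partial sum is dominated by it.\<close>

lemma heavy_imp_infinite_mass:
  assumes "a \<in> V" "heavy V E r {y \<in> V. reach \<omega> a y}" shows "infinite_mass \<omega> a"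
proof -
  let ?C = "{y \<in> V. reach \<omega> a y}"
  let ?I = "\<integral>\<^sup>+y. of_bool (reach \<omega> y a) * ennreal (w y) \<partial>count_space V"
  have "infsum (\<lambda>x. ennreal (w x)) ?C \<le> ?I"
  proof (rule infsum_le_finite_sums)
    fix F assume F: "finite F" "F \<subseteq> ?C"
    have "(\<Sum>x\<in>F. ennreal (w x)) = (\<integral>\<^sup>+y. of_bool (y \<in> F) * ennreal (w y) \<partial>count_space V)"
      using F by (subst nn_integral_count_space'[of F]) auto
    also have "\<dots> \<le> ?I"
      using F joined_sym by (intro nn_integral_mono mult_right_mono) auto
    finally show "(\<Sum>x\<in>F. ennreal (w x)) \<le> ?I" .
  qed (simp add: nonneg_summable_on_complete)
  then show ?thesis using assms by (simp add: heavy_def infinite_mass_def top_unique)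
qed

text \<open>The argument leaves at most two heavy clusters: any three are almost surely
  \<open>tall\<close>, hence one finite modification away from a trifurcation.\<close>

lemma finite_heavy_clusters:
  assumes "\<not> unimodular V E"
    and hyp: "(\<forall>\<L>. finite \<L> \<and> \<L> \<noteq> {} \<and> (\<forall>L\<in>\<L>. level V E L) \<longrightarrow>
            (\<forall>C\<in>graph_components (\<Union>\<L>) (induced_edges E (\<Union>\<L>)). finite C))
       \<or> (\<forall>\<L>. finite \<L> \<and> \<L> \<noteq> {} \<and> (\<forall>L\<in>\<L>. level V E L) \<longrightarrow>
            amenable (\<Union>\<L>) (induced_edges E (\<Union>\<L>)))"
    and p: "0 < p" "p < 1"
  shows "AE \<omega> in M p. finite {C \<in> clusters V E \<omega>. heavy V E r C}"
proof -
  have "AE \<omega> in M p. \<forall>x\<in>V. \<not> trifurcation \<omega> x"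
    by (rule AE_no_trifurcation, rule folner, rule amenable_union_of_levels[OF hyp])
  from finite_energy[OF p this] AE_heavy_tall[OF p weight_unbounded[OF assms(1)]]
  show ?thesis
  proof eventually_elim
    case (elim \<omega>)
    show ?case
    proof (rule ccontr)
      assume "infinite {C \<in> clusters V E \<omega>. heavy V E r C}"
      then obtain S where S: "S \<subseteq> {C \<in> clusters V E \<omega>. heavy V E r C}" "card S = 3" "finite S"
        using infinite_arbitrarily_large by blast
      then obtain h where h: "bij_betw h {..<3::nat} S"
        using ex_bij_betw_nat_finite[OF S(3)] by (auto simp: atLeast0LessThan)
      have "\<exists>x. i < 3 \<longrightarrow> x \<in> V \<and> h i = {y \<in> V. reach \<omega> x y} \<and> heavy V E r (h i)" for i
      proof (cases "i < 3")
        case True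
        then have "h i \<in> S" using h by (auto simp: bij_betw_def)
        then show ?thesis using S(1) unfolding clusters_eq by blast
      qed simp
      then obtain a where a: "\<And>i. i < 3 \<Longrightarrow> a i \<in> V \<and> h i = {y \<in> V. reach \<omega> (a i) y} \<and> heavy V E r (h i)"
        by metis
      have aV: "a i \<in> V" if "i < 3" for i using a[OF that] by blast
      have tl: "tall \<omega> {} (a i)" if "i < 3" for i
        using heavy_imp_infinite_mass[OF aV[OF that], of \<omega>] a[OF that] elim(2) by auto
      have sep: "\<not> reach \<omega> (a i) (a j)" if ij: "i < 3" "j < 3" "i \<noteq> j" for i j
      proof
        assume "reach \<omega> (a i) (a j)"
        then have "h i = h j" using a[OF ij(1)] a[OF ij(2)] joined_sym joined_trans by blast
        then show False using h ij by (auto simp: bij_betw_def inj_on_def)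
      qed
      from tripod_modification[of a \<omega>, OF aV tl sep] show False using elim(1) by blast
    qed
  qed
qed

text \<open>Finite energy fails at \<open>p = 1\<close>, but there \<open>V\<close> is the only
  cluster.\<close>

lemma finite_clusters_all_open:
  "AE \<omega> in M 1. finite {C \<in> clusters V E \<omega>. heavy V E r C}"
proof -
  have "AE x in measure_pmf (bernoulli_pmf 1). x"
    unfolding AE_measure_pmf_iff
  proof
    fix x assume "x \<in> set_pmf (bernoulli_pmf 1)"
    then show "x" by (cases x) (auto simp: set_pmf_iff)
  qed
  then have "AE \<omega> in M 1. \<omega> e" if "e \<in> E" for e
    unfolding bernoulli_percolation_def
    by (rule AE_PiM_component[OF measure_pmf.prob_space_axioms that])
  then have "AE \<omega> in M 1. \<forall>e\<in>E. \<omega> e" by (simp add: AE_ball_countable[OF countable_E])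
  then show ?thesis
  proof eventually_elim
    case (elim \<omega>)
    have "{e \<in> E. \<omega> e} = E" using elim by auto
    then have "clusters V E \<omega> \<subseteq> {V}"
      using graph_connected by (auto simp: clusters_def graph_components_def)
    then show ?case by (rule finite_subset[OF subset_trans, rotated]) auto
  qed
qed

text \<open>At \<open>p = 0\<close> almost surely every cluster is a single vertex, whose weight is
  finite.\<close>

lemma finite_clusters_all_closed:
  "AE \<omega> in M 0. finite {C \<in> clusters V E \<omega>. heavy V E r C}"
proof -
  have "AE x in measure_pmf (bernoulli_pmf 0). \<not> x"
    unfolding AE_measure_pmf_iff
  proof
    fix x assume "x \<in> set_pmf (bernoulli_pmf 0)"
    then show "\<not> x" by (cases x) (auto simp: set_pmf_iff)
  qed
  then have "AE \<omega> in M 0. \<not> \<omega> e" if "e \<in> E" for e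
    unfolding bernoulli_percolation_def
    by (rule AE_PiM_component[OF measure_pmf.prob_space_axioms that])
  then have "AE \<omega> in M 0. \<forall>e\<in>E. \<not> \<omega> e" by (simp add: AE_ball_countable[OF countable_E])
  then show ?thesis
  proof eventually_elim
    case (elim \<omega>)
    have "\<not> heavy V E r C" if C: "C \<in> clusters V E \<omega>" for C
    proof -
      have e: "{e \<in> E. \<omega> e} = {}" using elim by auto
      have r: "reachable {} x y \<longleftrightarrow> x = y" for x y :: 'a
        by (auto simp: reachable_def elim: rtranclp_induct)
      obtain x where "x \<in> V" "C = {y \<in> V. x = y}"
        using C unfolding clusters_def graph_components_def e r by blast
      then have "C = {x}" by blast
      then show ?thesis by (simp add: heavy_def)
    qed
    then have "{C \<in> clusters V E \<omega>. heavy V E r C} = {}" by blast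
    then show ?case by (metis finite.emptyI)
  qed
qed

end

theorem corollary5p8:
  fixes V :: "'v set" and E :: "'v set set" and r :: 'v and p :: real
  assumes "transitive_graph V E"
    and "\<not> unimodular V E"
    and "r \<in> V"
    and "(\<forall>\<L>. finite \<L> \<and> \<L> \<noteq> {} \<and> (\<forall>L\<in>\<L>. level V E L) \<longrightarrow>
            (\<forall>C\<in>graph_components (\<Union>\<L>) (induced_edges E (\<Union>\<L>)). finite C))
       \<or> (\<forall>\<L>. finite \<L> \<and> \<L> \<noteq> {} \<and> (\<forall>L\<in>\<L>. level V E L) \<longrightarrow>
            amenable (\<Union>\<L>) (induced_edges E (\<Union>\<L>)))"
    and "0 \<le> p" and "p \<le> 1"
  shows "AE \<omega> in bernoulli_percolation E p. finite {C \<in> clusters V E \<omega>. heavy V E r C}"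
proof -
  interpret transitive_graph V E by (rule assms(1))
  interpret rooted_graph V E r by unfold_locales (rule assms(3))
  consider "p = 0" | "p = 1" | "0 < p" "p < 1" using assms(5,6) by linarith
  then show ?thesis
  proof cases
    case 1
    show ?thesis unfolding 1 by (rule finite_clusters_all_closed)
  next
    case 2
    show ?thesis unfolding 2 by (rule finite_clusters_all_open)
  next
    case 3
    then show ?thesis by (rule finite_heavy_clusters[OF assms(2,4)])
  qed
qed

end
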